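(* Let $\mathbf{k}$ be a field of characteristic different from $2$ and $3$. Skew-symmetrization defines a projection 2-functor $$SS:\mathbf{2Lie}\to\mathbf{SS2Lie}$$ from the 2-category $\mathbf{2Lie}$ of Lie 2-algebras over $\mathbf{k}$ onto the 2-category $\mathbf{SS2Lie}$ of semistrict Lie 2-algebras.
   Context: **Linear categories.** A linear category (2-vector space) $V$ is a category internal to $\mathbf{k}$-vector spaces: objects $V_0$ and arrows $V_1$ are vector spaces and source $s$, target $t$, identity $x\mapsto 1_x$ and composition are linear. Linear functors and linear natural transformations are those whose structure maps are linear. The tensor product is $(V\otimes W)_i=V_i\otimes W_i$. Objects appearing in arrow expressions denote their identity arrows. $N(V)$ is the 2-term complex $N(V)^0=V_0$, $N(V)^{-1}=\ker s$, $d=t|_{\ker s}$. Any arrow $\mathbf a:x\to y$ is written $(x,a)$ with $a=\mathbf a-1_x\in\ker s$; then $y=x+da$, and composition is addition of the second components. This identifies $V$ with the linear category determined by the complex $N(V)$. **The 2-category $\mathbf{2Lie}$.** A Lie 2-algebra is a linear category $L$ with a bilinear functor $[\cdot,\cdot]:L\otimes L\to L$, a bilinear natural transformation $S_{x,y}:[x,y]\to-[y,x]$ (alternator) and a trilinear natural transformation $J_{x,y,z}:[x,[y,z]]\to[[x,y],z]+[y,[x,z]]$ (Jacobiator), such that for all objects $x,y,z,w$, with $\hat J_{x,y,z}=J_{x,y,z}^{-1}-1_{[y,[x,z]]}$: (L1) $([J_{x,y,z},w]+1_{[[y,z],[x,w]]}+1_{[[x,z],[y,w]]}+[z,J_{x,y,w}])\circ(J_{x,[y,z],w}+J_{x,z,[y,w]})\circ[x,J_{y,z,w}]=(1_{[[[x,y],z],w]}+1_{[z,[[x,y],w]]}+J_{y,[x,z],w}+J_{y,z,[x,w]})\circ(J_{[x,y],z,w}+[y,J_{x,z,w}])\circ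 J_{x,y,[z,w]}$; (L2) $(-\hat J_{y,x,z})\circ[S_{x,y},z]=\hat J_{x,y,z}$; (L3) $(-J_{x,z,y})\circ[x,S_{y,z}]=(S_{[x,y],z}+S_{y,[x,z]})\circ J_{x,y,z}$; (L4) $(-S_{[y,z],x})\circ S_{x,[y,z]}=1_{[x,[y,z]]}$. It is semistrict if $S$ is the identity; semistrict Lie 2-algebras form the full sub-2-category $\mathbf{SS2Lie}$ of $\mathbf{2Lie}$. A morphism $(F,F^2):L\to L'$ is a linear functor $F$ with a linear natural transformation $F^2_{x,y}:[F(x),F(y)]'\to F([x,y])$ such that $F(S_{x,y})\circ F^2_{x,y}=(-F^2_{y,x})\circ S'_{F(x),F(y)}$ and $F(J_{x,y,z})\circ F^2_{x,[y,z]}\circ[F(x),F^2_{y,z}]'=(F^2_{[x,y],z}+F^2_{y,[x,z]})\circ([F^2_{x,y},F(z)]'+[F(y),F^2_{x,z}]')\circ J'_{F(x),F(y),F(z)}$. The composite of $(F,F^2)$ and $(G,G^2)$ is $(GF,(GF)^2)$ with $(GF)^2_{x,y}=G(F^2_{x,y})\circ G^2_{F(x),F(y)}$. A 2-morphism $\Theta:(F,F^2)\Rightarrow(G,G^2)$ is a linear natural transformation $\Theta:F\Rightarrow G$ with $\Theta_{[x,y]}\circ F^2_{x,y}=G^2_{x,y}\circ[\Theta_x,\Theta_y]'$. Compositions of 2-morphisms are those of natural transformations. **Associated 2-term $EL_\infty$-algebra.** A Lie 2-algebra structure on $L$ is encoded by data $(C,[\cdot,\cdot],\langle\cdot,\cdot\rangle,\langle\cdot,\cdot,\cdot\rangle)$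 on the complex $C=N(L)$: the restrictions of the bracket of $L$ to $C^0\times C^0\to C^0$, $C^0\times C^{-1}\to C^{-1}$, $C^{-1}\times C^0\to C^{-1}$ (an object being regarded as its identity arrow; the bracket of $L$ is recovered as $[(x,a),(y,b)]=([x,y],[x,b]+[a,y]+[da,b])$), and the maps $\langle\cdot,\cdot\rangle:C^0\otimes C^0\to C^{-1}$, $\langle\cdot,\cdot,\cdot\rangle:(C^0)^{\otimes3}\to C^{-1}$ defined by $S_{x,y}=([x,y],-\langle x,y\rangle)$, $J_{x,y,z}=([x,[y,z]],-\langle x,y,z\rangle)$. Semistrict means $\langle\cdot,\cdot\rangle=0$; semistrict Lie 2-algebras correspond in this way to 2-term $L_\infty$-algebras. **Skew-symmetrization.** Given a Lie 2-algebra with associated data $(C,[\cdot,\cdot],\langle\cdot,\cdot\rangle,\langle\cdot,\cdot,\cdot\rangle)$, its skew-symmetrization is the semistrict Lie 2-algebra corresponding to the 2-term $L_\infty$-algebra $(C,\{\cdot,\cdot\},\{\cdot,\cdot,\cdot\})$, where for $x,y,x_i\in C^0$, $a\in C^{-1}$ $$\{x,y\}=\tfrac12([x,y]-[y,x]),\qquad \{x,a\}=\tfrac12([x,a]-[a,x])=-\{a,x\},$$ $$\{x_1,x_2,x_3\}=\tfrac16\sum_{\sigma\in S_3}(-1)^\sigma\langle x_{\sigma(1)},x_{\sigma(2)},x_{\sigma(3)}\rangle-\tfrac1{12}\sum_{\sigma\in S_3}(-1)^\sigma\langle[x_{\sigma(1)},x_{\sigma(2)}],x_{\sigma(3)}\rangle.$$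 *)

theory Defs
  imports "HOL-Algebra.Module" "HOL-Library.FuncSet"
begin

section \<open>Fields and multilinear maps\<close>

definition ring_char :: "('k, 'm) ring_scheme \<Rightarrow> nat" where
  "ring_char K =
     (if \<exists>n::nat. n > 0 \<and> [n] \<cdot>\<^bsub>K\<^esub> \<one>\<^bsub>K\<^esub> = \<zero>\<^bsub>K\<^esub>
      then (LEAST n::nat. n > 0 \<and> [n] \<cdot>\<^bsub>K\<^esub> \<one>\<^bsub>K\<^esub> = \<zero>\<^bsub>K\<^esub>) else 0)"

definition recip :: "('k, 'm) ring_scheme \<Rightarrow> nat \<Rightarrow> 'k" where
  "recip K n = inv\<^bsub>K\<^esub> ([n] \<cdot>\<^bsub>K\<^esub> \<one>\<^bsub>K\<^esub>)"

text \<open>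
  A vector space over a field \<open>K\<close> is a \<open>module K V\<close>.  Since its elements form a carrier set inside
  a type, all structure maps below are required to be \<open>undefined\<close> outside their domain; thus
  equality of HOL functions is equality of the mathematical maps.
\<close>

definition linear_map ::
    "('k, 'm) ring_scheme \<Rightarrow> ('k, 'v) module \<Rightarrow> ('k, 'w) module \<Rightarrow> ('v \<Rightarrow> 'w) \<Rightarrow> bool" where
  "linear_map K V W f \<longleftrightarrow>
     f \<in> carrier V \<rightarrow>\<^sub>E carrier W \<and>
     (\<forall>x\<in>carrier V. \<forall>y\<in>carrier V. f (x \<oplus>\<^bsub>V\<^esub> y) = f x \<oplus>\<^bsub>W\<^esub> f y) \<and>
     (\<forall>c\<in>carrier K. \<forall>x\<in>carrier V. f (c \<odot>\<^bsub>V\<^esub> x) = c \<odot>\<^bsub>W\<^esub> f x)"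

definition bilinear_map ::
    "('k, 'm) ring_scheme \<Rightarrow> ('k, 'u) module \<Rightarrow> ('k, 'v) module \<Rightarrow> ('k, 'w) module \<Rightarrow>
     ('u \<Rightarrow> 'v \<Rightarrow> 'w) \<Rightarrow> bool" where
  "bilinear_map K U V W f \<longleftrightarrow>
     (\<lambda>(x, y). f x y) \<in> extensional (carrier U \<times> carrier V) \<and>
     (\<forall>x\<in>carrier U. linear_map K V W (\<lambda>y. f x y)) \<and>
     (\<forall>y\<in>carrier V. linear_map K U W (\<lambda>x. f x y))"

definition trilinear_map ::
    "('k, 'm) ring_scheme \<Rightarrow> ('k, 't) module \<Rightarrow> ('k, 'u) module \<Rightarrow> ('k, 'v) module \<Rightarrow>
     ('k, 'w) module \<Rightarrow> ('t \<Rightarrow> 'u \<Rightarrow> 'v \<Rightarrow> 'w) \<Rightarrow> bool" where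
  "trilinear_map K T U V W f \<longleftrightarrow>
     (\<lambda>(x, y, z). f x y z) \<in> extensional (carrier T \<times> carrier U \<times> carrier V) \<and>
     (\<forall>x\<in>carrier T. \<forall>y\<in>carrier U. linear_map K V W (\<lambda>z. f x y z)) \<and>
     (\<forall>x\<in>carrier T. \<forall>z\<in>carrier V. linear_map K U W (\<lambda>y. f x y z)) \<and>
     (\<forall>y\<in>carrier U. \<forall>z\<in>carrier V. linear_map K T W (\<lambda>x. f x y z))"

definition restrict2 :: "('u \<Rightarrow> 'v \<Rightarrow> 'w) \<Rightarrow> 'u set \<Rightarrow> 'v set \<Rightarrow> 'u \<Rightarrow> 'v \<Rightarrow> 'w" where
  "restrict2 f A B = (\<lambda>x y. if x \<in> A \<and> y \<in> B then f x y else undefined)"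

definition restrict3 ::
    "('t \<Rightarrow> 'u \<Rightarrow> 'v \<Rightarrow> 'w) \<Rightarrow> 't set \<Rightarrow> 'u set \<Rightarrow> 'v set \<Rightarrow> 't \<Rightarrow> 'u \<Rightarrow> 'v \<Rightarrow> 'w" where
  "restrict3 f A B C = (\<lambda>x y z. if x \<in> A \<and> y \<in> B \<and> z \<in> C then f x y z else undefined)"


section \<open>Linear categories\<close>

record ('k, 'o, 'a) linear_cat =
  Obj :: "('k, 'o) module"
  Arr :: "('k, 'a) module"
  src :: "'a \<Rightarrow> 'o"
  tgt :: "'a \<Rightarrow> 'o"
  ident :: "'o \<Rightarrow> 'a" (\<open>\<iota>\<index> _\<close> [90] 90)
  cmp :: "'a \<Rightarrow> 'a \<Rightarrow> 'a" (infixr \<open>\<bullet>\<index>\<close> 60)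

text \<open>\<open>g \<bullet> f\<close> is the composite of \<open>f\<close> followed by \<open>g\<close>.\<close>

abbreviation obj_add (infixl \<open>\<oplus>\<^sub>0\<index>\<close> 65) where
  "x \<oplus>\<^sub>0\<^bsub>V\<^esub> y \<equiv> x \<oplus>\<^bsub>Obj V\<^esub> y"
abbreviation obj_neg (\<open>\<ominus>\<^sub>0\<index> _\<close> [81] 80) where
  "\<ominus>\<^sub>0\<^bsub>V\<^esub> x \<equiv> \<ominus>\<^bsub>Obj V\<^esub> x"
abbreviation arr_add (infixl \<open>\<oplus>\<^sub>1\<index>\<close> 65) where
  "f \<oplus>\<^sub>1\<^bsub>V\<^esub> g \<equiv> f \<oplus>\<^bsub>Arr V\<^esub> g"
abbreviation arr_neg (\<open>\<ominus>\<^sub>1\<index> _\<close> [81] 80) where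
  "\<ominus>\<^sub>1\<^bsub>V\<^esub> f \<equiv> \<ominus>\<^bsub>Arr V\<^esub> f"

abbreviation objs :: "('k, 'o, 'a, 'z) linear_cat_scheme \<Rightarrow> 'o set" where
  "objs V \<equiv> carrier (Obj V)"
abbreviation arrs :: "('k, 'o, 'a, 'z) linear_cat_scheme \<Rightarrow> 'a set" where
  "arrs V \<equiv> carrier (Arr V)"

definition composable :: "('k, 'o, 'a, 'z) linear_cat_scheme \<Rightarrow> ('a \<times> 'a) set" where
  "composable V = {(g, f). g \<in> arrs V \<and> f \<in> arrs V \<and> src V g = tgt V f}"

locale linear_category =
  field K + Ob: module K "Obj V" + Ar: module K "Arr V"
  for K and V :: "('k, 'o, 'a, 'z) linear_cat_scheme" (structure) +
  assumes src_linear: "linear_map K (Arr V) (Obj V) (src V)"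
    and tgt_linear: "linear_map K (Arr V) (Obj V) (tgt V)"
    and ident_linear: "linear_map K (Obj V) (Arr V) (ident V)"
    and cmp_closed: "(\<lambda>(g, f). g \<bullet> f) \<in> composable V \<rightarrow>\<^sub>E arrs V"
    and cmp_add: "\<lbrakk>(g, f) \<in> composable V; (g', f') \<in> composable V\<rbrakk>
      \<Longrightarrow> (g \<oplus>\<^sub>1 g') \<bullet> (f \<oplus>\<^sub>1 f') = (g \<bullet> f) \<oplus>\<^sub>1 (g' \<bullet> f')"
    and cmp_smult: "\<lbrakk>c \<in> carrier K; (g, f) \<in> composable V\<rbrakk>
      \<Longrightarrow> (c \<odot>\<^bsub>Arr V\<^esub> g) \<bullet> (c \<odot>\<^bsub>Arr V\<^esub> f) = c \<odot>\<^bsub>Arr V\<^esub> (g \<bullet> f)"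
    and src_ident: "x \<in> objs V \<Longrightarrow> src V (\<iota> x) = x"
    and tgt_ident: "x \<in> objs V \<Longrightarrow> tgt V (\<iota> x) = x"
    and src_cmp: "(g, f) \<in> composable V \<Longrightarrow> src V (g \<bullet> f) = src V f"
    and tgt_cmp: "(g, f) \<in> composable V \<Longrightarrow> tgt V (g \<bullet> f) = tgt V g"
    and cmp_ident_right: "f \<in> arrs V \<Longrightarrow> f \<bullet> \<iota> (src V f) = f"
    and cmp_ident_left: "f \<in> arrs V \<Longrightarrow> \<iota> (tgt V f) \<bullet> f = f"
    and cmp_assoc: "\<lbrakk>(h, g) \<in> composable V; (g, f) \<in> composable V\<rbrakk>
      \<Longrightarrow> (h \<bullet> g) \<bullet> f = h \<bullet> (g \<bullet> f)"

definition arr_inv :: "('k, 'o, 'a, 'z) linear_cat_scheme \<Rightarrow> 'a \<Rightarrow> 'a" where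
  "arr_inv V f = (THE g. g \<in> arrs V \<and> src V g = tgt V f \<and> tgt V g = src V f \<and>
     g \<bullet>\<^bsub>V\<^esub> f = \<iota>\<^bsub>V\<^esub> (src V f) \<and> f \<bullet>\<^bsub>V\<^esub> g = \<iota>\<^bsub>V\<^esub> (tgt V f))"

definition linear_functor ::
    "('k, 'm) ring_scheme \<Rightarrow> ('k, 'o, 'a, 'z) linear_cat_scheme \<Rightarrow>
     ('k, 'p, 'b, 'y) linear_cat_scheme \<Rightarrow> ('o \<Rightarrow> 'p) \<Rightarrow> ('a \<Rightarrow> 'b) \<Rightarrow> bool" where
  "linear_functor K V W F\<^sub>0 F\<^sub>1 \<longleftrightarrow>
     linear_map K (Obj V) (Obj W) F\<^sub>0 \<and> linear_map K (Arr V) (Arr W) F\<^sub>1 \<and>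
     (\<forall>f\<in>arrs V. src W (F\<^sub>1 f) = F\<^sub>0 (src V f) \<and> tgt W (F\<^sub>1 f) = F\<^sub>0 (tgt V f)) \<and>
     (\<forall>x\<in>objs V. F\<^sub>1 (\<iota>\<^bsub>V\<^esub> x) = \<iota>\<^bsub>W\<^esub> (F\<^sub>0 x)) \<and>
     (\<forall>(g, f)\<in>composable V. F\<^sub>1 (g \<bullet>\<^bsub>V\<^esub> f) = F\<^sub>1 g \<bullet>\<^bsub>W\<^esub> F\<^sub>1 f)"

text \<open>
  A bilinear functor out of \<open>U \<otimes> V\<close> is a functor on the product category \<open>U \<times> V\<close> that is bilinear on
  objects and on arrows.  Compatibility with composition is what forces
  \<open>[a, b] = [da, b] = [a, db]\<close> for \<open>a\<close> and \<open>b\<close> in the kernel of the source map.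
\<close>

definition bilinear_functor ::
    "('k, 'm) ring_scheme \<Rightarrow> ('k, 'o1, 'a1, 'z1) linear_cat_scheme \<Rightarrow>
     ('k, 'o2, 'a2, 'z2) linear_cat_scheme \<Rightarrow> ('k, 'p, 'b, 'y) linear_cat_scheme \<Rightarrow>
     ('o1 \<Rightarrow> 'o2 \<Rightarrow> 'p) \<Rightarrow> ('a1 \<Rightarrow> 'a2 \<Rightarrow> 'b) \<Rightarrow> bool" where
  "bilinear_functor K U V W F\<^sub>0 F\<^sub>1 \<longleftrightarrow>
     bilinear_map K (Obj U) (Obj V) (Obj W) F\<^sub>0 \<and> bilinear_map K (Arr U) (Arr V) (Arr W) F\<^sub>1 \<and>
     (\<forall>f\<in>arrs U. \<forall>g\<in>arrs V. src W (F\<^sub>1 f g) = F\<^sub>0 (src U f) (src V g) \<and>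
                                tgt W (F\<^sub>1 f g) = F\<^sub>0 (tgt U f) (tgt V g)) \<and>
     (\<forall>x\<in>objs U. \<forall>y\<in>objs V. F\<^sub>1 (\<iota>\<^bsub>U\<^esub> x) (\<iota>\<^bsub>V\<^esub> y) = \<iota>\<^bsub>W\<^esub> (F\<^sub>0 x y)) \<and>
     (\<forall>(f', f)\<in>composable U. \<forall>(g', g)\<in>composable V.
        F\<^sub>1 (f' \<bullet>\<^bsub>U\<^esub> f) (g' \<bullet>\<^bsub>V\<^esub> g) = F\<^sub>1 f' g' \<bullet>\<^bsub>W\<^esub> F\<^sub>1 f g)"

text \<open>
  In the next three definitions the pairs \<open>(F\<^sub>0, F\<^sub>1)\<close> and \<open>(G\<^sub>0, G\<^sub>1)\<close> are the object and arrow parts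
  of the functors between which \<open>T\<close> is a transformation.
\<close>

definition linear_nat_trans ::
    "('k, 'm) ring_scheme \<Rightarrow> ('k, 'o, 'a, 'z) linear_cat_scheme \<Rightarrow>
     ('k, 'p, 'b, 'y) linear_cat_scheme \<Rightarrow> ('o \<Rightarrow> 'p) \<Rightarrow> ('a \<Rightarrow> 'b) \<Rightarrow> ('o \<Rightarrow> 'p) \<Rightarrow> ('a \<Rightarrow> 'b) \<Rightarrow>
     ('o \<Rightarrow> 'b) \<Rightarrow> bool" where
  "linear_nat_trans K V W F\<^sub>0 F\<^sub>1 G\<^sub>0 G\<^sub>1 T \<longleftrightarrow>
     linear_map K (Obj V) (Arr W) T \<and>
     (\<forall>x\<in>objs V. src W (T x) = F\<^sub>0 x \<and> tgt W (T x) = G\<^sub>0 x) \<and>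
     (\<forall>f\<in>arrs V. T (tgt V f) \<bullet>\<^bsub>W\<^esub> F\<^sub>1 f = G\<^sub>1 f \<bullet>\<^bsub>W\<^esub> T (src V f))"

definition bilinear_nat_trans ::
    "('k, 'm) ring_scheme \<Rightarrow> ('k, 'o, 'a, 'z) linear_cat_scheme \<Rightarrow>
     ('k, 'p, 'b, 'y) linear_cat_scheme \<Rightarrow> ('o \<Rightarrow> 'o \<Rightarrow> 'p) \<Rightarrow> ('a \<Rightarrow> 'a \<Rightarrow> 'b) \<Rightarrow>
     ('o \<Rightarrow> 'o \<Rightarrow> 'p) \<Rightarrow> ('a \<Rightarrow> 'a \<Rightarrow> 'b) \<Rightarrow> ('o \<Rightarrow> 'o \<Rightarrow> 'b) \<Rightarrow> bool" where
  "bilinear_nat_trans K V W F\<^sub>0 F\<^sub>1 G\<^sub>0 G\<^sub>1 T \<longleftrightarrow>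
     bilinear_map K (Obj V) (Obj V) (Arr W) T \<and>
     (\<forall>x\<in>objs V. \<forall>y\<in>objs V. src W (T x y) = F\<^sub>0 x y \<and> tgt W (T x y) = G\<^sub>0 x y) \<and>
     (\<forall>f\<in>arrs V. \<forall>g\<in>arrs V.
        T (tgt V f) (tgt V g) \<bullet>\<^bsub>W\<^esub> F\<^sub>1 f g = G\<^sub>1 f g \<bullet>\<^bsub>W\<^esub> T (src V f) (src V g))"

definition trilinear_nat_trans ::
    "('k, 'm) ring_scheme \<Rightarrow> ('k, 'o, 'a, 'z) linear_cat_scheme \<Rightarrow>
     ('k, 'p, 'b, 'y) linear_cat_scheme \<Rightarrow> ('o \<Rightarrow> 'o \<Rightarrow> 'o \<Rightarrow> 'p) \<Rightarrow> ('a \<Rightarrow> 'a \<Rightarrow> 'a \<Rightarrow> 'b) \<Rightarrow>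
     ('o \<Rightarrow> 'o \<Rightarrow> 'o \<Rightarrow> 'p) \<Rightarrow> ('a \<Rightarrow> 'a \<Rightarrow> 'a \<Rightarrow> 'b) \<Rightarrow> ('o \<Rightarrow> 'o \<Rightarrow> 'o \<Rightarrow> 'b) \<Rightarrow> bool" where
  "trilinear_nat_trans K V W F\<^sub>0 F\<^sub>1 G\<^sub>0 G\<^sub>1 T \<longleftrightarrow>
     trilinear_map K (Obj V) (Obj V) (Obj V) (Arr W) T \<and>
     (\<forall>x\<in>objs V. \<forall>y\<in>objs V. \<forall>z\<in>objs V.
        src W (T x y z) = F\<^sub>0 x y z \<and> tgt W (T x y z) = G\<^sub>0 x y z) \<and>
     (\<forall>f\<in>arrs V. \<forall>g\<in>arrs V. \<forall>h\<in>arrs V.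
        T (tgt V f) (tgt V g) (tgt V h) \<bullet>\<^bsub>W\<^esub> F\<^sub>1 f g h =
        G\<^sub>1 f g h \<bullet>\<^bsub>W\<^esub> T (src V f) (src V g) (src V h))"


section \<open>Lie 2-algebras\<close>

record ('k, 'o, 'a) lie2 = "('k, 'o, 'a) linear_cat" +
  br0 :: "'o \<Rightarrow> 'o \<Rightarrow> 'o" (\<open>[_, _]\<^sub>0\<index>\<close>)
  br1 :: "'a \<Rightarrow> 'a \<Rightarrow> 'a" (\<open>[_, _]\<^sub>1\<index>\<close>)
  alternator :: "'o \<Rightarrow> 'o \<Rightarrow> 'a" (\<open>\<S>\<index>\<close>)
  jacobiator :: "'o \<Rightarrow> 'o \<Rightarrow> 'o \<Rightarrow> 'a" (\<open>\<J>\<index>\<close>)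

definition jac_hat :: "('k, 'o, 'a) lie2 \<Rightarrow> 'o \<Rightarrow> 'o \<Rightarrow> 'o \<Rightarrow> 'a" (\<open>\<JJ>\<index>\<close>) where
  "\<JJ>\<^bsub>L\<^esub> x y z = arr_inv L (\<J>\<^bsub>L\<^esub> x y z) \<ominus>\<^bsub>Arr L\<^esub> \<iota>\<^bsub>L\<^esub> [y, [x, z]\<^sub>0\<^bsub>L\<^esub>]\<^sub>0\<^bsub>L\<^esub>"

locale lie_2_algebra = linear_category K L
  for K and L :: "('k, 'o, 'a) lie2" (structure) +
  assumes bracket: "bilinear_functor K L L L (br0 L) (br1 L)"
    and alternator: "bilinear_nat_trans K L L
      (\<lambda>x y. [x, y]\<^sub>0) (\<lambda>f g. [f, g]\<^sub>1)
      (\<lambda>x y. \<ominus>\<^sub>0 [y, x]\<^sub>0) (\<lambda>f g. \<ominus>\<^sub>1 [g, f]\<^sub>1) \<S>"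
    and jacobiator: "trilinear_nat_trans K L L
      (\<lambda>x y z. [x, [y, z]\<^sub>0]\<^sub>0) (\<lambda>f g h. [f, [g, h]\<^sub>1]\<^sub>1)
      (\<lambda>x y z. [[x, y]\<^sub>0, z]\<^sub>0 \<oplus>\<^sub>0 [y, [x, z]\<^sub>0]\<^sub>0)
      (\<lambda>f g h. [[f, g]\<^sub>1, h]\<^sub>1 \<oplus>\<^sub>1 [g, [f, h]\<^sub>1]\<^sub>1) \<J>"
    and L1: "\<lbrakk>x \<in> objs L; y \<in> objs L; z \<in> objs L; w \<in> objs L\<rbrakk> \<Longrightarrow>
      ([\<J> x y z, \<iota> w]\<^sub>1 \<oplus>\<^sub>1 \<iota> [[y, z]\<^sub>0, [x, w]\<^sub>0]\<^sub>0 \<oplus>\<^sub>1 \<iota> [[x, z]\<^sub>0, [y, w]\<^sub>0]\<^sub>0 \<oplus>\<^sub>1 [\<iota> z, \<J> x y w]\<^sub>1)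
        \<bullet> (\<J> x [y, z]\<^sub>0 w \<oplus>\<^sub>1 \<J> x z [y, w]\<^sub>0)
        \<bullet> [\<iota> x, \<J> y z w]\<^sub>1
      = (\<iota> [[[x, y]\<^sub>0, z]\<^sub>0, w]\<^sub>0 \<oplus>\<^sub>1 \<iota> [z, [[x, y]\<^sub>0, w]\<^sub>0]\<^sub>0 \<oplus>\<^sub>1 \<J> y [x, z]\<^sub>0 w \<oplus>\<^sub>1 \<J> y z [x, w]\<^sub>0)
        \<bullet> (\<J> [x, y]\<^sub>0 z w \<oplus>\<^sub>1 [\<iota> y, \<J> x z w]\<^sub>1)
        \<bullet> \<J> x y [z, w]\<^sub>0"
    and L2: "\<lbrakk>x \<in> objs L; y \<in> objs L; z \<in> objs L\<rbrakk> \<Longrightarrow>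
      (\<ominus>\<^sub>1 \<JJ> y x z) \<bullet> [\<S> x y, \<iota> z]\<^sub>1 = \<JJ> x y z"
    and L3: "\<lbrakk>x \<in> objs L; y \<in> objs L; z \<in> objs L\<rbrakk> \<Longrightarrow>
      (\<ominus>\<^sub>1 \<J> x z y) \<bullet> [\<iota> x, \<S> y z]\<^sub>1 = (\<S> [x, y]\<^sub>0 z \<oplus>\<^sub>1 \<S> y [x, z]\<^sub>0) \<bullet> \<J> x y z"
    and L4: "\<lbrakk>x \<in> objs L; y \<in> objs L; z \<in> objs L\<rbrakk> \<Longrightarrow>
      (\<ominus>\<^sub>1 \<S> [y, z]\<^sub>0 x) \<bullet> \<S> x [y, z]\<^sub>0 = \<iota> [x, [y, z]\<^sub>0]\<^sub>0"

definition semistrict :: "('k, 'o, 'a) lie2 \<Rightarrow> bool" where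
  "semistrict L \<longleftrightarrow> (\<forall>x\<in>objs L. \<forall>y\<in>objs L. \<S>\<^bsub>L\<^esub> x y = \<iota>\<^bsub>L\<^esub> [x, y]\<^sub>0\<^bsub>L\<^esub>)"

record ('k, 'o, 'a) lie2_mor =
  mdom :: "('k, 'o, 'a) lie2"
  mcod :: "('k, 'o, 'a) lie2"
  mor0 :: "'o \<Rightarrow> 'o"
  mor1 :: "'a \<Rightarrow> 'a"
  mor2 :: "'o \<Rightarrow> 'o \<Rightarrow> 'a"

locale lie_2_morphism = L: lie_2_algebra K L + L': lie_2_algebra K L'
  for K and L :: "('k, 'o, 'a) lie2" (structure) and L' :: "('k, 'o, 'a) lie2" (structure) +
  fixes F\<^sub>0 :: "'o \<Rightarrow> 'o" and F\<^sub>1 :: "'a \<Rightarrow> 'a" and F2 :: "'o \<Rightarrow> 'o \<Rightarrow> 'a"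
  assumes linear_functor: "linear_functor K L L' F\<^sub>0 F\<^sub>1"
    and nat_trans: "bilinear_nat_trans K L L'
      (\<lambda>x y. [F\<^sub>0 x, F\<^sub>0 y]\<^sub>0\<^bsub>L'\<^esub>) (\<lambda>f g. [F\<^sub>1 f, F\<^sub>1 g]\<^sub>1\<^bsub>L'\<^esub>)
      (\<lambda>x y. F\<^sub>0 [x, y]\<^sub>0) (\<lambda>f g. F\<^sub>1 [f, g]\<^sub>1) F2"
    and preserves_alternator: "\<lbrakk>x \<in> objs L; y \<in> objs L\<rbrakk> \<Longrightarrow>
      F\<^sub>1 (\<S> x y) \<bullet>\<^bsub>L'\<^esub> F2 x y = (\<ominus>\<^sub>1\<^bsub>L'\<^esub> F2 y x) \<bullet>\<^bsub>L'\<^esub> \<S>\<^bsub>L'\<^esub> (F\<^sub>0 x) (F\<^sub>0 y)"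
    and preserves_jacobiator: "\<lbrakk>x \<in> objs L; y \<in> objs L; z \<in> objs L\<rbrakk> \<Longrightarrow>
      F\<^sub>1 (\<J> x y z) \<bullet>\<^bsub>L'\<^esub> F2 x [y, z]\<^sub>0 \<bullet>\<^bsub>L'\<^esub> [\<iota>\<^bsub>L'\<^esub> (F\<^sub>0 x), F2 y z]\<^sub>1\<^bsub>L'\<^esub>
      = (F2 [x, y]\<^sub>0 z \<oplus>\<^sub>1\<^bsub>L'\<^esub> F2 y [x, z]\<^sub>0)
        \<bullet>\<^bsub>L'\<^esub> ([F2 x y, \<iota>\<^bsub>L'\<^esub> (F\<^sub>0 z)]\<^sub>1\<^bsub>L'\<^esub> \<oplus>\<^sub>1\<^bsub>L'\<^esub> [\<iota>\<^bsub>L'\<^esub> (F\<^sub>0 y), F2 x z]\<^sub>1\<^bsub>L'\<^esub>)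
        \<bullet>\<^bsub>L'\<^esub> \<J>\<^bsub>L'\<^esub> (F\<^sub>0 x) (F\<^sub>0 y) (F\<^sub>0 z)"

definition is_lie2_mor :: "('k, 'm) ring_scheme \<Rightarrow> ('k, 'o, 'a) lie2_mor \<Rightarrow> bool" where
  "is_lie2_mor K F \<longleftrightarrow> lie_2_morphism K (mdom F) (mcod F) (mor0 F) (mor1 F) (mor2 F)"

record ('k, 'o, 'a) lie2_2mor =
  tdom :: "('k, 'o, 'a) lie2_mor"
  tcod :: "('k, 'o, 'a) lie2_mor"
  trafo :: "'o \<Rightarrow> 'a"

definition is_lie2_2mor :: "('k, 'm) ring_scheme \<Rightarrow> ('k, 'o, 'a) lie2_2mor \<Rightarrow> bool" where
  "is_lie2_2mor K T \<longleftrightarrow>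
     (let F = tdom T; G = tcod T; \<Theta> = trafo T; L = mdom F; L' = mcod F in
      is_lie2_mor K F \<and> is_lie2_mor K G \<and> mdom G = L \<and> mcod G = L' \<and>
      linear_nat_trans K L L' (mor0 F) (mor1 F) (mor0 G) (mor1 G) \<Theta> \<and>
      (\<forall>x\<in>objs L. \<forall>y\<in>objs L.
         \<Theta> [x, y]\<^sub>0\<^bsub>L\<^esub> \<bullet>\<^bsub>L'\<^esub> mor2 F x y = mor2 G x y \<bullet>\<^bsub>L'\<^esub> [\<Theta> x, \<Theta> y]\<^sub>1\<^bsub>L'\<^esub>))"

definition lie2_id_mor :: "('k, 'o, 'a) lie2 \<Rightarrow> ('k, 'o, 'a) lie2_mor" where
  "lie2_id_mor L = \<lparr>mdom = L, mcod = L,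
     mor0 = (\<lambda>x\<in>objs L. x), mor1 = (\<lambda>f\<in>arrs L. f),
     mor2 = restrict2 (\<lambda>x y. \<iota>\<^bsub>L\<^esub> [x, y]\<^sub>0\<^bsub>L\<^esub>) (objs L) (objs L)\<rparr>"

definition lie2_comp_mor ::
    "('k, 'o, 'a) lie2_mor \<Rightarrow> ('k, 'o, 'a) lie2_mor \<Rightarrow> ('k, 'o, 'a) lie2_mor" where
  "lie2_comp_mor G F = \<lparr>mdom = mdom F, mcod = mcod G,
     mor0 = compose (objs (mdom F)) (mor0 G) (mor0 F),
     mor1 = compose (arrs (mdom F)) (mor1 G) (mor1 F),
     mor2 = restrict2
       (\<lambda>x y. mor1 G (mor2 F x y) \<bullet>\<^bsub>mcod G\<^esub> mor2 G (mor0 F x) (mor0 F y))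
       (objs (mdom F)) (objs (mdom F))\<rparr>"

definition lie2_id_2mor :: "('k, 'o, 'a) lie2_mor \<Rightarrow> ('k, 'o, 'a) lie2_2mor" where
  "lie2_id_2mor F = \<lparr>tdom = F, tcod = F,
     trafo = (\<lambda>x\<in>objs (mdom F). \<iota>\<^bsub>mcod F\<^esub> (mor0 F x))\<rparr>"

definition lie2_vcomp ::
    "('k, 'o, 'a) lie2_2mor \<Rightarrow> ('k, 'o, 'a) lie2_2mor \<Rightarrow> ('k, 'o, 'a) lie2_2mor" where
  "lie2_vcomp T' T = \<lparr>tdom = tdom T, tcod = tcod T',
     trafo = (\<lambda>x\<in>objs (mdom (tdom T)). trafo T' x \<bullet>\<^bsub>mcod (tdom T)\<^esub> trafo T x)\<rparr>"

definition lie2_hcomp ::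
    "('k, 'o, 'a) lie2_2mor \<Rightarrow> ('k, 'o, 'a) lie2_2mor \<Rightarrow> ('k, 'o, 'a) lie2_2mor" where
  "lie2_hcomp T' T = \<lparr>tdom = lie2_comp_mor (tdom T') (tdom T), tcod = lie2_comp_mor (tcod T') (tcod T),
     trafo = (\<lambda>x\<in>objs (mdom (tdom T)).
       trafo T' (mor0 (tcod T) x) \<bullet>\<^bsub>mcod (tdom T')\<^esub> mor1 (tdom T') (trafo T x))\<rparr>"


section \<open>Strict 2-categories and 2-functors\<close>

record ('x, 'y, 'z) two_cat =
  cells0 :: "'x set"
  cells1 :: "'y set"
  cells2 :: "'z set"
  src1 :: "'y \<Rightarrow> 'x"
  tgt1 :: "'y \<Rightarrow> 'x"
  src2 :: "'z \<Rightarrow> 'y"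
  tgt2 :: "'z \<Rightarrow> 'y"
  id1 :: "'x \<Rightarrow> 'y"
  comp1 :: "'y \<Rightarrow> 'y \<Rightarrow> 'y"
  id2 :: "'y \<Rightarrow> 'z"
  vcomp :: "'z \<Rightarrow> 'z \<Rightarrow> 'z"
  hcomp :: "'z \<Rightarrow> 'z \<Rightarrow> 'z"

definition comp1_able :: "('x, 'y, 'z) two_cat \<Rightarrow> ('y \<times> 'y) set" where
  "comp1_able C = {(g, f). g \<in> cells1 C \<and> f \<in> cells1 C \<and> src1 C g = tgt1 C f}"

definition vcomp_able :: "('x, 'y, 'z) two_cat \<Rightarrow> ('z \<times> 'z) set" where
  "vcomp_able C = {(b, a). b \<in> cells2 C \<and> a \<in> cells2 C \<and> src2 C b = tgt2 C a}"

definition hcomp_able :: "('x, 'y, 'z) two_cat \<Rightarrow> ('z \<times> 'z) set" where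
  "hcomp_able C = {(b, a). b \<in> cells2 C \<and> a \<in> cells2 C \<and>
     src1 C (src2 C b) = tgt1 C (src2 C a)}"

locale strict_2_category =
  fixes C :: "('x, 'y, 'z) two_cat"
  assumes src1_closed: "f \<in> cells1 C \<Longrightarrow> src1 C f \<in> cells0 C"
    and tgt1_closed: "f \<in> cells1 C \<Longrightarrow> tgt1 C f \<in> cells0 C"
    and src2_closed: "a \<in> cells2 C \<Longrightarrow> src2 C a \<in> cells1 C"
    and tgt2_closed: "a \<in> cells2 C \<Longrightarrow> tgt2 C a \<in> cells1 C"
    and globular_src: "a \<in> cells2 C \<Longrightarrow> src1 C (src2 C a) = src1 C (tgt2 C a)"
    and globular_tgt: "a \<in> cells2 C \<Longrightarrow> tgt1 C (src2 C a) = tgt1 C (tgt2 C a)"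
    and id1_cell: "X \<in> cells0 C \<Longrightarrow>
      id1 C X \<in> cells1 C \<and> src1 C (id1 C X) = X \<and> tgt1 C (id1 C X) = X"
    and comp1_cell: "(g, f) \<in> comp1_able C \<Longrightarrow>
      comp1 C g f \<in> cells1 C \<and> src1 C (comp1 C g f) = src1 C f \<and> tgt1 C (comp1 C g f) = tgt1 C g"
    and comp1_id_right: "f \<in> cells1 C \<Longrightarrow> comp1 C f (id1 C (src1 C f)) = f"
    and comp1_id_left: "f \<in> cells1 C \<Longrightarrow> comp1 C (id1 C (tgt1 C f)) f = f"
    and comp1_assoc: "\<lbrakk>(h, g) \<in> comp1_able C; (g, f) \<in> comp1_able C\<rbrakk> \<Longrightarrow>
      comp1 C (comp1 C h g) f = comp1 C h (comp1 C g f)"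
    and id2_cell: "f \<in> cells1 C \<Longrightarrow>
      id2 C f \<in> cells2 C \<and> src2 C (id2 C f) = f \<and> tgt2 C (id2 C f) = f"
    and vcomp_cell: "(b, a) \<in> vcomp_able C \<Longrightarrow>
      vcomp C b a \<in> cells2 C \<and> src2 C (vcomp C b a) = src2 C a \<and> tgt2 C (vcomp C b a) = tgt2 C b"
    and vcomp_id_right: "a \<in> cells2 C \<Longrightarrow> vcomp C a (id2 C (src2 C a)) = a"
    and vcomp_id_left: "a \<in> cells2 C \<Longrightarrow> vcomp C (id2 C (tgt2 C a)) a = a"
    and vcomp_assoc: "\<lbrakk>(c, b) \<in> vcomp_able C; (b, a) \<in> vcomp_able C\<rbrakk> \<Longrightarrow>
      vcomp C (vcomp C c b) a = vcomp C c (vcomp C b a)"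
    and hcomp_cell: "(b, a) \<in> hcomp_able C \<Longrightarrow>
      hcomp C b a \<in> cells2 C \<and>
      src2 C (hcomp C b a) = comp1 C (src2 C b) (src2 C a) \<and>
      tgt2 C (hcomp C b a) = comp1 C (tgt2 C b) (tgt2 C a)"
    and hcomp_id_right: "a \<in> cells2 C \<Longrightarrow> hcomp C a (id2 C (id1 C (src1 C (src2 C a)))) = a"
    and hcomp_id_left: "a \<in> cells2 C \<Longrightarrow> hcomp C (id2 C (id1 C (tgt1 C (src2 C a)))) a = a"
    and hcomp_assoc: "\<lbrakk>(c, b) \<in> hcomp_able C; (b, a) \<in> hcomp_able C\<rbrakk> \<Longrightarrow>
      hcomp C (hcomp C c b) a = hcomp C c (hcomp C b a)"
    and hcomp_id2: "(g, f) \<in> comp1_able C \<Longrightarrow>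
      hcomp C (id2 C g) (id2 C f) = id2 C (comp1 C g f)"
    and interchange: "\<lbrakk>(b', b) \<in> vcomp_able C; (a', a) \<in> vcomp_able C; (b, a) \<in> hcomp_able C\<rbrakk> \<Longrightarrow>
      hcomp C (vcomp C b' b) (vcomp C a' a) = vcomp C (hcomp C b' a') (hcomp C b a)"

record ('x, 'y, 'z, 'x1, 'y1, 'z1) two_fun =
  fun0 :: "'x \<Rightarrow> 'x1"
  fun1 :: "'y \<Rightarrow> 'y1"
  fun2 :: "'z \<Rightarrow> 'z1"

locale strict_2_functor = C: strict_2_category C + D: strict_2_category D
  for C :: "('x, 'y, 'z) two_cat" and D :: "('x1, 'y1, 'z1) two_cat" +
  fixes P :: "('x, 'y, 'z, 'x1, 'y1, 'z1) two_fun"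
  assumes fun0_cell: "X \<in> cells0 C \<Longrightarrow> fun0 P X \<in> cells0 D"
    and fun1_cell: "f \<in> cells1 C \<Longrightarrow> fun1 P f \<in> cells1 D \<and>
      src1 D (fun1 P f) = fun0 P (src1 C f) \<and> tgt1 D (fun1 P f) = fun0 P (tgt1 C f)"
    and fun2_cell: "a \<in> cells2 C \<Longrightarrow> fun2 P a \<in> cells2 D \<and>
      src2 D (fun2 P a) = fun1 P (src2 C a) \<and> tgt2 D (fun2 P a) = fun1 P (tgt2 C a)"
    and fun_id1: "X \<in> cells0 C \<Longrightarrow> fun1 P (id1 C X) = id1 D (fun0 P X)"
    and fun_comp1: "(g, f) \<in> comp1_able C \<Longrightarrow>
      fun1 P (comp1 C g f) = comp1 D (fun1 P g) (fun1 P f)"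
    and fun_id2: "f \<in> cells1 C \<Longrightarrow> fun2 P (id2 C f) = id2 D (fun1 P f)"
    and fun_vcomp: "(b, a) \<in> vcomp_able C \<Longrightarrow>
      fun2 P (vcomp C b a) = vcomp D (fun2 P b) (fun2 P a)"
    and fun_hcomp: "(b, a) \<in> hcomp_able C \<Longrightarrow>
      fun2 P (hcomp C b a) = hcomp D (fun2 P b) (fun2 P a)"

definition full_sub_2_category :: "('x, 'y, 'z) two_cat \<Rightarrow> ('x \<Rightarrow> bool) \<Rightarrow> ('x, 'y, 'z) two_cat" where
  "full_sub_2_category C Q = C\<lparr>
     cells0 := {X \<in> cells0 C. Q X},
     cells1 := {f \<in> cells1 C. Q (src1 C f) \<and> Q (tgt1 C f)},
     cells2 := {a \<in> cells2 C. Q (src1 C (src2 C a)) \<and> Q (tgt1 C (src2 C a))}\<rparr>"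

text \<open>A projection of \<open>C\<close> onto a sub-2-category \<open>D\<close> is a 2-functor \<open>C \<rightarrow> D\<close> whose restriction to
  \<open>D\<close> is the identity.\<close>

definition projection_2_functor ::
    "('x, 'y, 'z) two_cat \<Rightarrow> ('x, 'y, 'z) two_cat \<Rightarrow> ('x, 'y, 'z, 'x, 'y, 'z) two_fun \<Rightarrow> bool" where
  "projection_2_functor C D P \<longleftrightarrow>
     cells0 D \<subseteq> cells0 C \<and> cells1 D \<subseteq> cells1 C \<and> cells2 D \<subseteq> cells2 C \<and>
     strict_2_functor C D P \<and>
     (\<forall>X\<in>cells0 D. fun0 P X = X) \<and> (\<forall>f\<in>cells1 D. fun1 P f = f) \<and> (\<forall>a\<in>cells2 D. fun2 P a = a)"

definition Lie2 ::
    "('k, 'm) ring_scheme \<Rightarrow>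
     (('k, 'o, 'a) lie2, ('k, 'o, 'a) lie2_mor, ('k, 'o, 'a) lie2_2mor) two_cat" where
  "Lie2 K = \<lparr>
     cells0 = {L. lie_2_algebra K L}, cells1 = {F. is_lie2_mor K F}, cells2 = {T. is_lie2_2mor K T},
     src1 = mdom, tgt1 = mcod, src2 = tdom, tgt2 = tcod,
     id1 = lie2_id_mor, comp1 = lie2_comp_mor,
     id2 = lie2_id_2mor, vcomp = lie2_vcomp, hcomp = lie2_hcomp\<rparr>"

definition SSLie2 ::
    "('k, 'm) ring_scheme \<Rightarrow>
     (('k, 'o, 'a) lie2, ('k, 'o, 'a) lie2_mor, ('k, 'o, 'a) lie2_2mor) two_cat" where
  "SSLie2 K = full_sub_2_category (Lie2 K) semistrict"


section \<open>Skew-symmetrization\<close>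

definition arr_part :: "('k, 'o, 'a, 'z) linear_cat_scheme \<Rightarrow> 'a \<Rightarrow> 'a" where
  "arr_part V f = f \<ominus>\<^bsub>Arr V\<^esub> \<iota>\<^bsub>V\<^esub> (src V f)"

text \<open>\<open>(x, a)\<close> with \<open>a\<close> in the kernel of the source map, regarded as an arrow.\<close>

definition mk_arr :: "('k, 'o, 'a, 'z) linear_cat_scheme \<Rightarrow> 'o \<Rightarrow> 'a \<Rightarrow> 'a" where
  "mk_arr V x a = \<iota>\<^bsub>V\<^esub> x \<oplus>\<^bsub>Arr V\<^esub> a"

text \<open>
  The operations of a 2-term \<open>EL\<^sub>\<infinity>\<close>-algebra on the complex \<open>ker s \<rightarrow> V\<^sub>0\<close> with differential the target
  map: the three components of the bracket, \<open>\<langle>x, y\<rangle>\<close> and \<open>\<langle>x, y, z\<rangle>\<close>.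
\<close>

record ('o, 'a) el_data =
  b00 :: "'o \<Rightarrow> 'o \<Rightarrow> 'o"
  b01 :: "'o \<Rightarrow> 'a \<Rightarrow> 'a"
  b10 :: "'a \<Rightarrow> 'o \<Rightarrow> 'a"
  ang2 :: "'o \<Rightarrow> 'o \<Rightarrow> 'a"
  ang3 :: "'o \<Rightarrow> 'o \<Rightarrow> 'o \<Rightarrow> 'a"

definition data_of_lie2 :: "('k, 'o, 'a) lie2 \<Rightarrow> ('o, 'a) el_data" where
  "data_of_lie2 L = \<lparr>
     b00 = (\<lambda>x y. [x, y]\<^sub>0\<^bsub>L\<^esub>),
     b01 = (\<lambda>x a. [\<iota>\<^bsub>L\<^esub> x, a]\<^sub>1\<^bsub>L\<^esub>),
     b10 = (\<lambda>a x. [a, \<iota>\<^bsub>L\<^esub> x]\<^sub>1\<^bsub>L\<^esub>),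
     ang2 = (\<lambda>x y. \<ominus>\<^sub>1\<^bsub>L\<^esub> (arr_part L (\<S>\<^bsub>L\<^esub> x y))),
     ang3 = (\<lambda>x y z. \<ominus>\<^sub>1\<^bsub>L\<^esub> (arr_part L (\<J>\<^bsub>L\<^esub> x y z)))\<rparr>"

text \<open>Only the underlying linear category of \<open>L\<close> is used here.\<close>

definition lie2_of_data :: "('k, 'o, 'a) lie2 \<Rightarrow> ('o, 'a) el_data \<Rightarrow> ('k, 'o, 'a) lie2" where
  "lie2_of_data L E = L\<lparr>
     br0 := restrict2 (b00 E) (objs L) (objs L),
     br1 := restrict2 (\<lambda>f g.
       let x = src L f; a = arr_part L f; y = src L g; b = arr_part L g in
       mk_arr L (b00 E x y) (b01 E x b \<oplus>\<^sub>1\<^bsub>L\<^esub> b10 E a y \<oplus>\<^sub>1\<^bsub>L\<^esub> b01 E (tgt L a) b)) (arrs L) (arrs L),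
     alternator := restrict2 (\<lambda>x y. mk_arr L (b00 E x y) (\<ominus>\<^sub>1\<^bsub>L\<^esub> (ang2 E x y))) (objs L) (objs L),
     jacobiator := restrict3 (\<lambda>x y z. mk_arr L (b00 E x (b00 E y z)) (\<ominus>\<^sub>1\<^bsub>L\<^esub> (ang3 E x y z)))
       (objs L) (objs L) (objs L)\<rparr>"

text \<open>The sum of \<open>(-1)\<^sup>\<sigma> f x\<^bsub>\<sigma>(1)\<^esub> x\<^bsub>\<sigma>(2)\<^esub> x\<^bsub>\<sigma>(3)\<^esub>\<close> over the six permutations \<open>\<sigma>\<close>.\<close>

definition alt_sum3 :: "('k, 'v) module \<Rightarrow> ('o \<Rightarrow> 'o \<Rightarrow> 'o \<Rightarrow> 'v) \<Rightarrow> 'o \<Rightarrow> 'o \<Rightarrow> 'o \<Rightarrow> 'v" where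
  "alt_sum3 V f x y z =
     (f x y z \<oplus>\<^bsub>V\<^esub> f y z x \<oplus>\<^bsub>V\<^esub> f z x y) \<ominus>\<^bsub>V\<^esub> (f y x z \<oplus>\<^bsub>V\<^esub> f x z y \<oplus>\<^bsub>V\<^esub> f z y x)"

definition skew_data ::
    "('k, 'm) ring_scheme \<Rightarrow> ('k, 'o, 'a) lie2 \<Rightarrow> ('o, 'a) el_data \<Rightarrow> ('o, 'a) el_data" where
  "skew_data K L E = \<lparr>
     b00 = (\<lambda>x y. recip K 2 \<odot>\<^bsub>Obj L\<^esub> (b00 E x y \<ominus>\<^bsub>Obj L\<^esub> b00 E y x)),
     b01 = (\<lambda>x a. recip K 2 \<odot>\<^bsub>Arr L\<^esub> (b01 E x a \<ominus>\<^bsub>Arr L\<^esub> b10 E a x)),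
     b10 = (\<lambda>a x. \<ominus>\<^sub>1\<^bsub>L\<^esub> (recip K 2 \<odot>\<^bsub>Arr L\<^esub> (b01 E x a \<ominus>\<^bsub>Arr L\<^esub> b10 E a x))),
     ang2 = (\<lambda>x y. \<zero>\<^bsub>Arr L\<^esub>),
     ang3 = (\<lambda>x y z.
       recip K 6 \<odot>\<^bsub>Arr L\<^esub> alt_sum3 (Arr L) (ang3 E) x y z \<ominus>\<^bsub>Arr L\<^esub>
       recip K 12 \<odot>\<^bsub>Arr L\<^esub> alt_sum3 (Arr L) (\<lambda>x y z. ang2 E (b00 E x y) z) x y z)\<rparr>"

definition skew_lie2 :: "('k, 'm) ring_scheme \<Rightarrow> ('k, 'o, 'a) lie2 \<Rightarrow> ('k, 'o, 'a) lie2" where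
  "skew_lie2 K L = lie2_of_data L (skew_data K L (data_of_lie2 L))"

text \<open>
  On morphisms \<open>F\<^sup>2\<close> is replaced by its skew part.  Writing \<open>F\<^sup>2 x y = ([F x, F y], \<phi> x y)\<close>, the arrow
  below is \<open>({F x, F y}, (\<phi> x y - \<phi> y x) / 2)\<close>.
\<close>

definition skew_mor :: "('k, 'm) ring_scheme \<Rightarrow> ('k, 'o, 'a) lie2_mor \<Rightarrow> ('k, 'o, 'a) lie2_mor" where
  "skew_mor K F = F\<lparr>
     mdom := skew_lie2 K (mdom F), mcod := skew_lie2 K (mcod F),
     mor2 := restrict2
       (\<lambda>x y. recip K 2 \<odot>\<^bsub>Arr (mcod F)\<^esub> (mor2 F x y \<ominus>\<^bsub>Arr (mcod F)\<^esub> mor2 F y x))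
       (objs (mdom F)) (objs (mdom F))\<rparr>"

definition skew_2mor :: "('k, 'm) ring_scheme \<Rightarrow> ('k, 'o, 'a) lie2_2mor \<Rightarrow> ('k, 'o, 'a) lie2_2mor" where
  "skew_2mor K T = T\<lparr>tdom := skew_mor K (tdom T), tcod := skew_mor K (tcod T)\<rparr>"

definition SS ::
    "('k, 'm) ring_scheme \<Rightarrow>
     (('k, 'o, 'a) lie2, ('k, 'o, 'a) lie2_mor, ('k, 'o, 'a) lie2_2mor,
      ('k, 'o, 'a) lie2, ('k, 'o, 'a) lie2_mor, ('k, 'o, 'a) lie2_2mor) two_fun" where
  "SS K = \<lparr>fun0 = skew_lie2 K, fun1 = skew_mor K, fun2 = skew_2mor K\<rparr>"

end

theory Submission
  imports Defs "HOL.Rat"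
begin

text \<open>
  An arrow \<open>f\<close> of a linear category is determined by its source and its arrow part \<open>f - 1\<^bsub>s f\<^esub>\<close>, and
  composition adds arrow parts.  Hence all coherence laws of Lie 2-algebras, morphisms and 2-morphisms are
  linear identities between arrow parts.  The brackets of the skew-symmetrization of \<open>L\<close> are, on objects
  and on arrows, the skew parts of those of \<open>L\<close>, so the target and the naturality of its Jacobiator both
  follow from one identity valid in every algebra: the alternating sum of
  \<open>([x, [y, z]] - [[x, y], z] - [y, [x, z]]) / 6 - ([[x, y], z] + [z, [x, y]]) / 12\<close> is the defect of the
  Jacobi identity for the commutator \<open>([x, y] - [y, x]) / 2\<close>.  The law (L1) of the skew-symmetrization is
  skew in all four arguments.  It is therefore a linear relation between alternating sums over \<open>S\<^sub>4\<close>,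
  and it is a consequence of the alternating sums of (L1), (L2), (L3) and of the naturality of the alternator
  along the Jacobiator.  Morphisms are treated in the same way over \<open>S\<^sub>3\<close>.
\<close>

section \<open>Linear arithmetic in modules\<close>

text \<open>The obstacle is that alternating \<langle>x, y, z\<rangle> alone gives no Jacobiator for
  the commutator. The bracket of L satisfies the Jacobi identity in its Leibniz form, and
  skew-symmetry, each only up to an arrow, so the alternated Leibniz defect is not the Jacobi defect
  of the commutator. The term with 1/12 corrects exactly this. All denominators are products of 2
  and 3, and this is how the characteristic enters. The laws have to be restated for the
  skew-symmetrization before they are known to hold there. Hence the locales
  \<open>pre_lie_2_algebra\<close> and \<open>pre_lie_2_morphism\<close>: they carry the data with
  its naturality, and in them each law is shown equivalent to an equation between arrow parts. The
  2-functor is strict because the arrow part of \<open>F2\<close> enters composites and the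
  condition on 2-morphisms linearly. Taking skew parts therefore commutes with composition, while
  functors and transformations stay as they are. A projection has to fix semistrict cells literally,
  so equality of records is proved, not isomorphism.\<close>

definition int_scalar :: "('k, 'm) ring_scheme \<Rightarrow> int \<Rightarrow> 'k" where
  "int_scalar K k = [k] \<cdot>\<^bsub>K\<^esub> \<one>\<^bsub>K\<^esub>"

lemma (in cring) int_scalar_closed [simp]: "int_scalar R k \<in> carrier R"
  by (simp add: int_scalar_def)

lemma (in cring) int_scalar_add: "int_scalar R (j + k) = int_scalar R j \<oplus> int_scalar R k"
  by (simp add: int_scalar_def add.int_pow_mult)

lemma (in cring) int_scalar_mult: "int_scalar R (j * k) = int_scalar R j \<otimes> int_scalar R k"
proof -
  have "[(j * k)] \<cdot>\<^bsub>R\<^esub> \<one> = [j] \<cdot>\<^bsub>R\<^esub> ([k] \<cdot>\<^bsub>R\<^esub> \<one>)"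
    using add.int_pow_pow[OF one_closed, of j k] by (simp add: mult.commute)
  also have "\<dots> = [j] \<cdot>\<^bsub>R\<^esub> \<one> \<otimes> [k] \<cdot>\<^bsub>R\<^esub> \<one>"
    using add_pow_ldistr_int[of \<one> "[k] \<cdot>\<^bsub>R\<^esub> \<one>" j] by simp
  finally show ?thesis by (simp add: int_scalar_def)
qed

lemma (in cring) int_scalar_neg: "int_scalar R (- k) = \<ominus> int_scalar R k"
  by (simp add: int_scalar_def add.int_pow_neg)

lemma (in cring) int_scalar_0: "int_scalar R 0 = \<zero>"
  by (simp add: int_scalar_def add_pow_int_ge)

lemma (in cring) int_scalar_1: "int_scalar R 1 = \<one>"
  by (simp add: int_scalar_def add.int_pow_1)

lemma int_scalar_of_nat: "int_scalar K (int n) = [n] \<cdot>\<^bsub>K\<^esub> \<one>\<^bsub>K\<^esub>"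
  by (simp add: int_scalar_def add_pow_int_ge)

text \<open>Two kinds of division are meant: \<open>n > 0\<close> permits division by n in the
  rational coefficients, the unit condition permits it in K. Over a commutative ring, which is all
  that a module presupposes, neither implies the other: in the zero ring 0 is a unit.\<close>

definition invertible_nat :: "('k, 'm) ring_scheme \<Rightarrow> nat \<Rightarrow> bool" where
  "invertible_nat K n \<longleftrightarrow> n > 0 \<and> [n] \<cdot>\<^bsub>K\<^esub> \<one>\<^bsub>K\<^esub> \<in> Units K"

lemma (in cring) invertible_nat_mult:
  "\<lbrakk>invertible_nat R m; invertible_nat R n\<rbrakk> \<Longrightarrow> invertible_nat R (m * n)"
  using int_scalar_mult[of "int m" "int n"]
  by (simp add: invertible_nat_def flip: int_scalar_of_nat)

lemma (in cring) recip_closed [simp]: "invertible_nat R n \<Longrightarrow> recip R n \<in> carrier R"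
  by (simp add: recip_def invertible_nat_def)

text \<open>The coefficient function of a single vector. Vectors are their own indeterminates, so
  two terms that happen to denote the same vector need no case distinction.\<close>

definition dirac :: "'v \<Rightarrow> 'v \<Rightarrow> rat" where
  "dirac x u = (if u = x then 1 else 0)"

text \<open>
  \<open>lin_comb K V P x\<close> says that \<open>x\<close> is the linear combination \<open>\<Sum>u. P u \<cdot> u\<close> of elements of \<open>V\<close>, whose
  rational coefficients have a common denominator that is invertible in \<open>K\<close>.  Since linear arithmetic
  is not available for carrier-based modules, an equation between two terms is reduced to
  the equality of their rational coefficient functions.
\<close>

definition lin_comb :: "('k, 'm) ring_scheme \<Rightarrow> ('k, 'v, 'n) module_scheme \<Rightarrow> ('v \<Rightarrow> rat) \<Rightarrow> 'v \<Rightarrow> bool" where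
  "lin_comb K V P x \<longleftrightarrow> x \<in> carrier V \<and>
     (\<exists>n q A. invertible_nat K n \<and> (\<forall>u. rat_of_int (q u) = of_nat n * P u) \<and>
        finite A \<and> A \<subseteq> carrier V \<and> (\<forall>u. u \<notin> A \<longrightarrow> q u = 0) \<and>
        int_scalar K (int n) \<odot>\<^bsub>V\<^esub> x = (\<Oplus>\<^bsub>V\<^esub>u\<in>A. int_scalar K (q u) \<odot>\<^bsub>V\<^esub> u))"

section \<open>Reduction of vector identities to rational coefficient functions\<close>

context module
begin

lemma smult_a_minus:
  "\<lbrakk>a \<in> carrier R; x \<in> carrier M; y \<in> carrier M\<rbrakk>
    \<Longrightarrow> a \<odot>\<^bsub>M\<^esub> (x \<ominus>\<^bsub>M\<^esub> y) = a \<odot>\<^bsub>M\<^esub> x \<ominus>\<^bsub>M\<^esub> a \<odot>\<^bsub>M\<^esub> y"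
  by (simp add: a_minus_def smult_r_distr smult_r_minus)

lemma invertible_nat_cancel:
  assumes "invertible_nat R n" "x \<in> carrier M" "y \<in> carrier M"
    and "int_scalar R (int n) \<odot>\<^bsub>M\<^esub> x = int_scalar R (int n) \<odot>\<^bsub>M\<^esub> y"
  shows "x = y"
proof -
  have *: "recip R n \<otimes> int_scalar R (int n) = \<one>"
    using assms(1) by (simp add: invertible_nat_def recip_def int_scalar_of_nat)
  have "(recip R n \<otimes> int_scalar R (int n)) \<odot>\<^bsub>M\<^esub> x = (recip R n \<otimes> int_scalar R (int n)) \<odot>\<^bsub>M\<^esub> y"
    using assms by (simp add: smult_assoc1)
  then show ?thesis using assms by (simp add: *)
qed

lemma recip_cancel:
  assumes "invertible_nat R n" "x \<in> carrier M"
  shows "int_scalar R (int n) \<odot>\<^bsub>M\<^esub> (recip R n \<odot>\<^bsub>M\<^esub> x) = x"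
proof -
  have "int_scalar R (int n) \<otimes> recip R n = \<one>"
    using assms(1) by (simp add: invertible_nat_def recip_def int_scalar_of_nat)
  then show ?thesis using assms by (simp flip: smult_assoc1)
qed

lemma lin_comb_closed: "lin_comb R M P x \<Longrightarrow> x \<in> carrier M"
  by (simp add: lin_comb_def)

lemma lin_combE:
  assumes "lin_comb R M P x"
  obtains n q A where "invertible_nat R n" "\<And>u. rat_of_int (q u) = of_nat n * P u"
    "finite A" "A \<subseteq> carrier M" "\<And>u. u \<notin> A \<Longrightarrow> q u = 0"
    "int_scalar R (int n) \<odot>\<^bsub>M\<^esub> x = (\<Oplus>\<^bsub>M\<^esub>u\<in>A. int_scalar R (q u) \<odot>\<^bsub>M\<^esub> u)"
  using assms unfolding lin_comb_def by blast

text \<open>Coefficients vanish off \<open>A\<close>, so the support may grow to \<open>B\<close>,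
  and the factor m can be moved into the sum. This brings two combinations to a common support and a
  common denominator.\<close>

lemma lin_comb_rescale:
  assumes A: "finite A" "A \<subseteq> carrier M" "finite B" "A \<subseteq> B" "B \<subseteq> carrier M"
    and q: "\<And>u. u \<notin> A \<Longrightarrow> q u = 0" and x: "x \<in> carrier M"
    and eq: "int_scalar R n \<odot>\<^bsub>M\<^esub> x = (\<Oplus>\<^bsub>M\<^esub>u\<in>A. int_scalar R (q u) \<odot>\<^bsub>M\<^esub> u)"
  shows "int_scalar R (m * n) \<odot>\<^bsub>M\<^esub> x = (\<Oplus>\<^bsub>M\<^esub>u\<in>B. int_scalar R (m * q u) \<odot>\<^bsub>M\<^esub> u)"
proof -
  have "(\<Oplus>\<^bsub>M\<^esub>u\<in>B. int_scalar R (m * q u) \<odot>\<^bsub>M\<^esub> u)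
      = (\<Oplus>\<^bsub>M\<^esub>u\<in>A. int_scalar R (m * q u) \<odot>\<^bsub>M\<^esub> u)"
    using A q by (intro M.add.finprod_mono_neutral_cong_right) (auto simp: int_scalar_0 subset_iff)
  also have "\<dots> = (\<Oplus>\<^bsub>M\<^esub>u\<in>A. int_scalar R m \<odot>\<^bsub>M\<^esub> (int_scalar R (q u) \<odot>\<^bsub>M\<^esub> u))"
    using A by (intro M.add.finprod_cong') (auto simp: int_scalar_mult smult_assoc1 subset_iff)
  also have "\<dots> = int_scalar R m \<odot>\<^bsub>M\<^esub> (\<Oplus>\<^bsub>M\<^esub>u\<in>A. int_scalar R (q u) \<odot>\<^bsub>M\<^esub> u)"
    using A by (intro finsum_smult_ldistr[symmetric]) (auto simp: subset_iff)
  finally show ?thesis using x by (simp add: int_scalar_mult smult_assoc1 eq)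
qed

text \<open>After clearing denominators both vectors are the same integer combination, and the
  common denominator can be cancelled. Only this direction is valid: linearly dependent vectors give
  several coefficient functions to one vector.\<close>

lemma lin_comb_unique:
  assumes "lin_comb R M P x" "lin_comb R M Q y" "\<And>u. P u = Q u"
  shows "x = y"
proof -
  from assms(1) obtain n q A where 1: "invertible_nat R n" "\<And>u. rat_of_int (q u) = of_nat n * P u"
    "finite A" "A \<subseteq> carrier M" "\<And>u. u \<notin> A \<Longrightarrow> q u = 0"
    "int_scalar R (int n) \<odot>\<^bsub>M\<^esub> x = (\<Oplus>\<^bsub>M\<^esub>u\<in>A. int_scalar R (q u) \<odot>\<^bsub>M\<^esub> u)" by (rule lin_combE) blast
  from assms(2) obtain m r B where 2: "invertible_nat R m" "\<And>u. rat_of_int (r u) = of_nat m * Q u"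
    "finite B" "B \<subseteq> carrier M" "\<And>u. u \<notin> B \<Longrightarrow> r u = 0"
    "int_scalar R (int m) \<odot>\<^bsub>M\<^esub> y = (\<Oplus>\<^bsub>M\<^esub>u\<in>B. int_scalar R (r u) \<odot>\<^bsub>M\<^esub> u)" by (rule lin_combE) blast
  note xy = lin_comb_closed[OF assms(1)] lin_comb_closed[OF assms(2)]
  have "rat_of_int (int m * q u) = rat_of_int (int n * r u)" for u
    using 1(2) 2(2) assms(3) by simp
  then have "int m * q u = int n * r u" for u
    using of_int_eq_iff by blast
  moreover have "int_scalar R (int m * int n) \<odot>\<^bsub>M\<^esub> x
      = (\<Oplus>\<^bsub>M\<^esub>u\<in>A\<union>B. int_scalar R (int m * q u) \<odot>\<^bsub>M\<^esub> u)"
    using 1 2 xy by (intro lin_comb_rescale[of A]) auto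
  moreover have "int_scalar R (int n * int m) \<odot>\<^bsub>M\<^esub> y
      = (\<Oplus>\<^bsub>M\<^esub>u\<in>A\<union>B. int_scalar R (int n * r u) \<odot>\<^bsub>M\<^esub> u)"
    using 1 2 xy by (intro lin_comb_rescale[of B]) auto
  ultimately show ?thesis
    using invertible_nat_cancel[OF invertible_nat_mult[OF 2(1) 1(1)] xy] by (simp add: mult.commute)
qed

lemma lin_comb_add:
  assumes "lin_comb R M P x" "lin_comb R M Q y"
  shows "lin_comb R M (\<lambda>u. P u + Q u) (x \<oplus>\<^bsub>M\<^esub> y)"
proof -
  from assms(1) obtain n q A where 1: "invertible_nat R n" "\<And>u. rat_of_int (q u) = of_nat n * P u"
    "finite A" "A \<subseteq> carrier M" "\<And>u. u \<notin> A \<Longrightarrow> q u = 0"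
    "int_scalar R (int n) \<odot>\<^bsub>M\<^esub> x = (\<Oplus>\<^bsub>M\<^esub>u\<in>A. int_scalar R (q u) \<odot>\<^bsub>M\<^esub> u)" by (rule lin_combE) blast
  from assms(2) obtain m r B where 2: "invertible_nat R m" "\<And>u. rat_of_int (r u) = of_nat m * Q u"
    "finite B" "B \<subseteq> carrier M" "\<And>u. u \<notin> B \<Longrightarrow> r u = 0"
    "int_scalar R (int m) \<odot>\<^bsub>M\<^esub> y = (\<Oplus>\<^bsub>M\<^esub>u\<in>B. int_scalar R (r u) \<odot>\<^bsub>M\<^esub> u)" by (rule lin_combE) blast
  note xy = lin_comb_closed[OF assms(1)] lin_comb_closed[OF assms(2)]
  have "int_scalar R (int m * int n) \<odot>\<^bsub>M\<^esub> x
      = (\<Oplus>\<^bsub>M\<^esub>u\<in>A\<union>B. int_scalar R (int m * q u) \<odot>\<^bsub>M\<^esub> u)"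
    using 1 2 xy by (intro lin_comb_rescale[of A]) auto
  moreover have "int_scalar R (int n * int m) \<odot>\<^bsub>M\<^esub> y
      = (\<Oplus>\<^bsub>M\<^esub>u\<in>A\<union>B. int_scalar R (int n * r u) \<odot>\<^bsub>M\<^esub> u)"
    using 1 2 xy by (intro lin_comb_rescale[of B]) auto
  ultimately have "int_scalar R (int (m * n)) \<odot>\<^bsub>M\<^esub> (x \<oplus>\<^bsub>M\<^esub> y)
      = (\<Oplus>\<^bsub>M\<^esub>u\<in>A\<union>B. int_scalar R (int m * q u) \<odot>\<^bsub>M\<^esub> u)
        \<oplus>\<^bsub>M\<^esub> (\<Oplus>\<^bsub>M\<^esub>u\<in>A\<union>B. int_scalar R (int n * r u) \<odot>\<^bsub>M\<^esub> u)"
    using xy by (simp add: smult_r_distr mult.commute)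
  also have "\<dots> = (\<Oplus>\<^bsub>M\<^esub>u\<in>A\<union>B. int_scalar R (int m * q u) \<odot>\<^bsub>M\<^esub> u
      \<oplus>\<^bsub>M\<^esub> int_scalar R (int n * r u) \<odot>\<^bsub>M\<^esub> u)"
    using 1 2 by (intro M.finsum_addf[symmetric]) auto
  also have "\<dots> = (\<Oplus>\<^bsub>M\<^esub>u\<in>A\<union>B. int_scalar R (int m * q u + int n * r u) \<odot>\<^bsub>M\<^esub> u)"
    using 1 2 by (intro M.add.finprod_cong') (auto simp: int_scalar_add smult_l_distr subset_iff)
  finally have *: "int_scalar R (int (m * n)) \<odot>\<^bsub>M\<^esub> (x \<oplus>\<^bsub>M\<^esub> y)
      = (\<Oplus>\<^bsub>M\<^esub>u\<in>A\<union>B. int_scalar R (int m * q u + int n * r u) \<odot>\<^bsub>M\<^esub> u)" .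
  show ?thesis unfolding lin_comb_def
    apply (intro conjI exI[of _ "m * n"] exI[of _ "\<lambda>u. int m * q u + int n * r u"] exI[of _ "A \<union> B"])
    using 1 2 xy * by (auto simp: invertible_nat_mult algebra_simps)
qed

lemma lin_comb_neg:
  assumes "lin_comb R M P x"
  shows "lin_comb R M (\<lambda>u. - P u) (\<ominus>\<^bsub>M\<^esub> x)"
proof -
  from assms(1) obtain n q A where 1: "invertible_nat R n" "\<And>u. rat_of_int (q u) = of_nat n * P u"
    "finite A" "A \<subseteq> carrier M" "\<And>u. u \<notin> A \<Longrightarrow> q u = 0"
    "int_scalar R (int n) \<odot>\<^bsub>M\<^esub> x = (\<Oplus>\<^bsub>M\<^esub>u\<in>A. int_scalar R (q u) \<odot>\<^bsub>M\<^esub> u)" by (rule lin_combE) blast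
  note x = lin_comb_closed[OF assms]
  have "int_scalar R (- 1 * int n) \<odot>\<^bsub>M\<^esub> x = (\<Oplus>\<^bsub>M\<^esub>u\<in>A. int_scalar R (- 1 * q u) \<odot>\<^bsub>M\<^esub> u)"
    using 1 x by (intro lin_comb_rescale[of A]) auto
  then have "int_scalar R (int n) \<odot>\<^bsub>M\<^esub> (\<ominus>\<^bsub>M\<^esub> x) = (\<Oplus>\<^bsub>M\<^esub>u\<in>A. int_scalar R (- q u) \<odot>\<^bsub>M\<^esub> u)"
    using x by (simp add: smult_r_minus smult_l_minus int_scalar_neg)
  then show ?thesis unfolding lin_comb_def
    using 1 x by (intro conjI exI[of _ n] exI[of _ "\<lambda>u. - q u"] exI[of _ A]) auto
qed

lemma lin_comb_minus:
  "\<lbrakk>lin_comb R M P x; lin_comb R M Q y\<rbrakk> \<Longrightarrow> lin_comb R M (\<lambda>u. P u - Q u) (x \<ominus>\<^bsub>M\<^esub> y)"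
  using lin_comb_add[OF _ lin_comb_neg, of P x Q y] by (simp add: a_minus_def)

lemma lin_comb_recip:
  assumes k: "invertible_nat R k" and x: "lin_comb R M P x"
  shows "lin_comb R M (\<lambda>u. P u / of_nat k) (recip R k \<odot>\<^bsub>M\<^esub> x)"
proof -
  from x obtain n q A where 1: "invertible_nat R n" "\<And>u. rat_of_int (q u) = of_nat n * P u"
    "finite A" "A \<subseteq> carrier M" "\<And>u. u \<notin> A \<Longrightarrow> q u = 0"
    "int_scalar R (int n) \<odot>\<^bsub>M\<^esub> x = (\<Oplus>\<^bsub>M\<^esub>u\<in>A. int_scalar R (q u) \<odot>\<^bsub>M\<^esub> u)" by (rule lin_combE) blast
  note x = lin_comb_closed[OF x]
  have "int_scalar R (int (n * k)) \<odot>\<^bsub>M\<^esub> (recip R k \<odot>\<^bsub>M\<^esub> x) = (\<Oplus>\<^bsub>M\<^esub>u\<in>A. int_scalar R (q u) \<odot>\<^bsub>M\<^esub> u)"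
    using 1 x k recip_cancel[OF k x] by (simp add: int_scalar_mult smult_assoc1)
  then show ?thesis unfolding lin_comb_def
    using 1 x k by (intro conjI exI[of _ "n * k"] exI[of _ q] exI[of _ A])
      (auto simp: invertible_nat_mult invertible_nat_def[of _ k])
qed

lemma invertible_nat_1 [simp]: "invertible_nat R 1" "invertible_nat R (Suc 0)"
  using R.int_scalar_1 int_scalar_of_nat[of R 1] by (auto simp: invertible_nat_def)

lemma lin_comb_dirac: "x \<in> carrier M \<Longrightarrow> lin_comb R M (dirac x) x"
  unfolding lin_comb_def
  by (intro conjI exI[of _ 1] exI[of _ "\<lambda>u. if u = x then 1 else 0"] exI[of _ "{x}"])
    (auto simp: dirac_def)

lemma lin_comb_zero: "lin_comb R M (\<lambda>u. 0) \<zero>\<^bsub>M\<^esub>"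
  unfolding lin_comb_def
  by (intro conjI exI[of _ 1] exI[of _ "\<lambda>u. 0"] exI[of _ "{}"]) auto

lemma lin_comb_int:
  assumes "lin_comb R M P x"
  shows "lin_comb R M (\<lambda>u. of_int k * P u) (int_scalar R k \<odot>\<^bsub>M\<^esub> x)"
proof -
  from assms(1) obtain n q A where 1: "invertible_nat R n" "\<And>u. rat_of_int (q u) = of_nat n * P u"
    "finite A" "A \<subseteq> carrier M" "\<And>u. u \<notin> A \<Longrightarrow> q u = 0"
    "int_scalar R (int n) \<odot>\<^bsub>M\<^esub> x = (\<Oplus>\<^bsub>M\<^esub>u\<in>A. int_scalar R (q u) \<odot>\<^bsub>M\<^esub> u)" by (rule lin_combE) blast
  note x = lin_comb_closed[OF assms(1)]
  have "int_scalar R (k * int n) \<odot>\<^bsub>M\<^esub> x = (\<Oplus>\<^bsub>M\<^esub>u\<in>A. int_scalar R (k * q u) \<odot>\<^bsub>M\<^esub> u)"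
    using 1 x by (intro lin_comb_rescale[of A]) auto
  then have "int_scalar R (int n) \<odot>\<^bsub>M\<^esub> (int_scalar R k \<odot>\<^bsub>M\<^esub> x) = (\<Oplus>\<^bsub>M\<^esub>u\<in>A. int_scalar R (k * q u) \<odot>\<^bsub>M\<^esub> u)"
    using x by (simp add: mult.commute[of k] flip: smult_assoc1 int_scalar_mult)
  then show ?thesis unfolding lin_comb_def
    using 1 x by (intro conjI exI[of _ n] exI[of _ "\<lambda>u. k * q u"] exI[of _ A]) auto
qed

text \<open>The vector r' + c (l - r) has the coefficients of l' and, as l = r, is equal to r'. The
  integer c is the factor by which the given equation has to be multiplied; in all applications it
  is 1 or -1.\<close>

lemma lin_comb_transfer:
  assumes eq: "l = r"
    and l: "lin_comb R M P l" and r: "lin_comb R M Q r"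
    and l': "lin_comb R M P' l'" and r': "lin_comb R M Q' r'"
    and diff: "\<And>u. P' u - Q' u = of_int c * (P u - Q u)"
  shows "l' = r'"
proof -
  have "lin_comb R M (\<lambda>u. Q' u + of_int c * (P u - Q u)) (r' \<oplus>\<^bsub>M\<^esub> int_scalar R c \<odot>\<^bsub>M\<^esub> (l \<ominus>\<^bsub>M\<^esub> r))"
    by (intro lin_comb_add lin_comb_int lin_comb_minus l r r')
  moreover have "r' \<oplus>\<^bsub>M\<^esub> int_scalar R c \<odot>\<^bsub>M\<^esub> (l \<ominus>\<^bsub>M\<^esub> r) = r'"
    using lin_comb_closed[OF r] lin_comb_closed[OF r'] by (simp add: eq a_minus_def M.r_neg)
  ultimately show ?thesis using lin_comb_unique[OF l', of _ r'] diff by (simp add: algebra_simps)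
qed

lemma lin_comb_iff:
  assumes "lin_comb R M P l" "lin_comb R M Q r" "lin_comb R M P' l'" "lin_comb R M Q' r'"
    and "\<And>u. P u - Q u = P' u - Q' u"
  shows "l = r \<longleftrightarrow> l' = r'"
  using lin_comb_transfer[OF _ assms(1-4), of 1] lin_comb_transfer[OF _ assms(3,4,1,2), of 1] assms(5) by auto

lemma lin_comb_iff_neg:
  assumes "lin_comb R M P l" "lin_comb R M Q r" "lin_comb R M P' l'" "lin_comb R M Q' r'"
    and "\<And>u. P u - Q u = Q' u - P' u"
  shows "l = r \<longleftrightarrow> l' = r'"
  using lin_comb_iff[OF assms(1,2,4,3,5)] by auto

text \<open>The order matters: \<open>lin_comb_dirac\<close> matches every vector and comes last, so
  that a term is taken as an atom only if no module operation stands at its head.\<close>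

lemmas lin_comb_intros = lin_comb_zero lin_comb_add lin_comb_minus lin_comb_neg lin_comb_recip
  lin_comb_int lin_comb_dirac

end

text \<open>These rules distribute products and quotients over sums and differences. What remains is
  a linear equation over the rationals in the values of \<open>dirac\<close>, which linear
  arithmetic decides.\<close>

lemmas coeff_simps = of_nat_numeral of_int_numeral of_int_1 of_int_minus
  ring_distribs add_divide_distrib diff_divide_distrib div_0 diff_zero minus_zero

text \<open>The least positive n with n 1 = 0 is not 1. If 2 vanished it would be 2; with 2
  excluded, if 3 vanished it would be 3. Either case contradicts the characteristic, and nonzero
  elements of a field are units.\<close>

lemma (in field) invertible_nat_2_3:
  assumes "ring_char R \<noteq> 2" "ring_char R \<noteq> 3"
  shows "invertible_nat R 2" "invertible_nat R 3"
proof -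
  let ?P = "\<lambda>n::nat. n > 0 \<and> [n] \<cdot>\<^bsub>R\<^esub> \<one> = \<zero>"
  have 1: "\<not> ?P 1" by simp
  have 2: "\<not> ?P 2"
  proof
    assume P2: "?P 2"
    then have "(LEAST n. ?P n) \<le> 2" "?P (LEAST n. ?P n)"
      by (rule Least_le, rule LeastI)
    then have "(LEAST n. ?P n) = 2"
      using 1 by (cases "(LEAST n. ?P n) = 1") auto
    moreover have "ring_char R = (LEAST n. ?P n)"
      unfolding ring_char_def using P2 by (subst if_P) blast+
    ultimately show False using assms(1) by simp
  qed
  have 3: "\<not> ?P 3"
  proof
    assume P3: "?P 3"
    then have "(LEAST n. ?P n) \<le> 3" "?P (LEAST n. ?P n)"
      by (rule Least_le, rule LeastI)
    moreover have "(LEAST n. ?P n) \<noteq> 1" "(LEAST n. ?P n) \<noteq> 2"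
      using 1 2 calculation(2) by metis+
    ultimately have "(LEAST n. ?P n) = 3" by auto
    moreover have "ring_char R = (LEAST n. ?P n)"
      unfolding ring_char_def using P3 by (subst if_P) blast+
    ultimately show False using assms(2) by simp
  qed
  show "invertible_nat R 2" "invertible_nat R 3"
    using 2 3 by (simp_all add: invertible_nat_def field_Units)
qed

section \<open>Linear and multilinear maps\<close>

text \<open>Linearity without the convention on values outside the carrier, which pointwise sums and
  composites written as plain lambda terms do not obey. The convention is restored at the end, when
  a structure map is assembled.\<close>

definition linear_on ::
    "('k, 'm) ring_scheme \<Rightarrow> ('k, 'v) module \<Rightarrow> ('k, 'w) module \<Rightarrow> ('v \<Rightarrow> 'w) \<Rightarrow> bool" where
  "linear_on K V W f \<longleftrightarrow>
     (\<forall>x\<in>carrier V. f x \<in> carrier W) \<and>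
     (\<forall>x\<in>carrier V. \<forall>y\<in>carrier V. f (x \<oplus>\<^bsub>V\<^esub> y) = f x \<oplus>\<^bsub>W\<^esub> f y) \<and>
     (\<forall>c\<in>carrier K. \<forall>x\<in>carrier V. f (c \<odot>\<^bsub>V\<^esub> x) = c \<odot>\<^bsub>W\<^esub> f x)"

lemma linear_map_iff: "linear_map K V W f \<longleftrightarrow> f \<in> extensional (carrier V) \<and> linear_on K V W f"
  by (auto simp: linear_map_def linear_on_def PiE_def)

lemma linear_on_closed: "\<lbrakk>linear_on K V W f; x \<in> carrier V\<rbrakk> \<Longrightarrow> f x \<in> carrier W"
  and linear_on_add: "\<lbrakk>linear_on K V W f; x \<in> carrier V; y \<in> carrier V\<rbrakk>
    \<Longrightarrow> f (x \<oplus>\<^bsub>V\<^esub> y) = f x \<oplus>\<^bsub>W\<^esub> f y"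
  and linear_on_smult: "\<lbrakk>linear_on K V W f; c \<in> carrier K; x \<in> carrier V\<rbrakk>
    \<Longrightarrow> f (c \<odot>\<^bsub>V\<^esub> x) = c \<odot>\<^bsub>W\<^esub> f x"
  by (auto simp: linear_on_def)

lemma linear_on_cong:
  assumes "module K V" "linear_on K V W f" "\<And>x. x \<in> carrier V \<Longrightarrow> f x = g x"
  shows "linear_on K V W g"
proof -
  interpret module K V by fact
  show ?thesis using assms(2,3) by (auto simp: linear_on_def)
qed

locale module_pair = V: module K V + W: module K W
  for K :: "('k, 'm) ring_scheme" and V :: "('k, 'v) module" and W :: "('k, 'w) module"
begin

lemma linear_on_zero: "linear_on K V W f \<Longrightarrow> f \<zero>\<^bsub>V\<^esub> = \<zero>\<^bsub>W\<^esub>"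
  using linear_on_smult[of K V W f "\<zero>\<^bsub>K\<^esub>" "\<zero>\<^bsub>V\<^esub>"] linear_on_closed[of K V W f "\<zero>\<^bsub>V\<^esub>"] by simp

lemma linear_on_neg:
  assumes "linear_on K V W f" "x \<in> carrier V" shows "f (\<ominus>\<^bsub>V\<^esub> x) = \<ominus>\<^bsub>W\<^esub> f x"
proof -
  have "f (\<ominus>\<^bsub>V\<^esub> x) \<oplus>\<^bsub>W\<^esub> f x = \<zero>\<^bsub>W\<^esub>"
    using linear_on_add[OF assms(1), of "\<ominus>\<^bsub>V\<^esub> x" x] assms linear_on_zero by (simp add: V.M.l_neg)
  then show ?thesis using assms linear_on_closed[OF assms(1)] W.M.minus_equality[of "f (\<ominus>\<^bsub>V\<^esub> x)" "f x"]
    by simp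
qed

lemma linear_on_minus:
  "\<lbrakk>linear_on K V W f; x \<in> carrier V; y \<in> carrier V\<rbrakk> \<Longrightarrow> f (x \<ominus>\<^bsub>V\<^esub> y) = f x \<ominus>\<^bsub>W\<^esub> f y"
  by (simp add: a_minus_def linear_on_add linear_on_neg)

lemmas linear_on_simps = linear_on_closed linear_on_add linear_on_smult linear_on_zero
  linear_on_neg linear_on_minus

lemma linear_on_sum:
  assumes "linear_on K V W f" "linear_on K V W g"
  shows "linear_on K V W (\<lambda>x. f x \<oplus>\<^bsub>W\<^esub> g x)"
  unfolding linear_on_def using assms[THEN linear_on_closed]
  by (simp add: assms[THEN linear_on_add] assms[THEN linear_on_smult] W.smult_r_distr W.M.a_ac)

lemma linear_on_uminus:
  assumes "linear_on K V W f"
  shows "linear_on K V W (\<lambda>x. \<ominus>\<^bsub>W\<^esub> f x)"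
  unfolding linear_on_def using assms[THEN linear_on_closed]
  by (simp add: linear_on_add[OF assms] linear_on_smult[OF assms] W.smult_r_minus W.M.minus_add)

lemma linear_on_diff:
  "\<lbrakk>linear_on K V W f; linear_on K V W g\<rbrakk> \<Longrightarrow> linear_on K V W (\<lambda>x. f x \<ominus>\<^bsub>W\<^esub> g x)"
  unfolding a_minus_def by (intro linear_on_sum linear_on_uminus)

lemma linear_on_scaled:
  assumes "linear_on K V W f" "c \<in> carrier K"
  shows "linear_on K V W (\<lambda>x. c \<odot>\<^bsub>W\<^esub> f x)"
  unfolding linear_on_def using assms(1)[THEN linear_on_closed] assms(2)
  by (simp add: linear_on_add[OF assms(1)] linear_on_smult[OF assms(1)] W.smult_r_distr
      V.m_comm flip: W.smult_assoc1)

lemmas linear_on_intros = linear_on_sum linear_on_diff linear_on_uminus linear_on_scaled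

end

lemma linear_on_compose:
  "\<lbrakk>linear_on K U V f; linear_on K V W g\<rbrakk> \<Longrightarrow> linear_on K U W (\<lambda>x. g (f x))"
  by (simp add: linear_on_def)

lemma linear_map_compose:
  assumes "module K U" "linear_map K U V f" "linear_map K V W g"
  shows "linear_map K U W (compose (carrier U) g f)"
  using assms linear_on_cong[OF assms(1) linear_on_compose[of K U V f W g]]
  by (simp add: linear_map_iff compose_def)

definition bilinear_on ::
    "('k, 'm) ring_scheme \<Rightarrow> ('k, 'u) module \<Rightarrow> ('k, 'v) module \<Rightarrow> ('k, 'w) module \<Rightarrow>
     ('u \<Rightarrow> 'v \<Rightarrow> 'w) \<Rightarrow> bool" where
  "bilinear_on K U V W f \<longleftrightarrow>
     (\<forall>x\<in>carrier U. linear_on K V W (\<lambda>y. f x y)) \<and> (\<forall>y\<in>carrier V. linear_on K U W (\<lambda>x. f x y))"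

lemma bilinear_mapD:
  assumes "bilinear_map K U V W f"
  shows "bilinear_on K U V W f" "\<And>x y. \<not> (x \<in> carrier U \<and> y \<in> carrier V) \<Longrightarrow> f x y = undefined"
  using assms by (auto simp: bilinear_map_def bilinear_on_def linear_map_iff extensional_def)

lemma bilinear_mapI:
  assumes "bilinear_on K U V W f" "\<And>x y. \<not> (x \<in> carrier U \<and> y \<in> carrier V) \<Longrightarrow> f x y = undefined"
  shows "bilinear_map K U V W f"
  using assms by (auto simp: bilinear_map_def bilinear_on_def linear_map_iff extensional_def)

lemma bilinear_onD:
  assumes "bilinear_on K U V W f"
  shows "x \<in> carrier U \<Longrightarrow> linear_on K V W (\<lambda>y. f x y)"
    and "y \<in> carrier V \<Longrightarrow> linear_on K U W (\<lambda>x. f x y)"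
  using assms by (auto simp: bilinear_on_def)

lemma bilinear_on_cong:
  assumes "module K U" "module K V" "bilinear_on K U V W f"
    "\<And>x y. \<lbrakk>x \<in> carrier U; y \<in> carrier V\<rbrakk> \<Longrightarrow> f x y = g x y"
  shows "bilinear_on K U V W g"
  unfolding bilinear_on_def
  using linear_on_cong[OF assms(2) bilinear_onD(1)[OF assms(3)]]
    linear_on_cong[OF assms(1) bilinear_onD(2)[OF assms(3)]] assms(4) by (auto cong: ball_cong)

lemma bilinear_map_restrict2:
  assumes "module K U" "module K V" "bilinear_on K U V W f"
  shows "bilinear_map K U V W (restrict2 f (carrier U) (carrier V))"
  by (intro bilinear_mapI bilinear_on_cong[OF assms]) (auto simp: restrict2_def)

definition trilinear_on ::
    "('k, 'm) ring_scheme \<Rightarrow> ('k, 't) module \<Rightarrow> ('k, 'u) module \<Rightarrow> ('k, 'v) module \<Rightarrow>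
     ('k, 'w) module \<Rightarrow> ('t \<Rightarrow> 'u \<Rightarrow> 'v \<Rightarrow> 'w) \<Rightarrow> bool" where
  "trilinear_on K T U V W f \<longleftrightarrow>
     (\<forall>x\<in>carrier T. \<forall>y\<in>carrier U. linear_on K V W (\<lambda>z. f x y z)) \<and>
     (\<forall>x\<in>carrier T. \<forall>z\<in>carrier V. linear_on K U W (\<lambda>y. f x y z)) \<and>
     (\<forall>y\<in>carrier U. \<forall>z\<in>carrier V. linear_on K T W (\<lambda>x. f x y z))"

lemma trilinear_mapD:
  assumes "trilinear_map K T U V W f"
  shows "trilinear_on K T U V W f"
    "\<And>x y z. \<not> (x \<in> carrier T \<and> y \<in> carrier U \<and> z \<in> carrier V) \<Longrightarrow> f x y z = undefined"
  using assms by (auto simp: trilinear_map_def trilinear_on_def linear_map_iff extensional_def)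

lemma trilinear_mapI:
  assumes "trilinear_on K T U V W f"
    "\<And>x y z. \<not> (x \<in> carrier T \<and> y \<in> carrier U \<and> z \<in> carrier V) \<Longrightarrow> f x y z = undefined"
  shows "trilinear_map K T U V W f"
  using assms by (auto simp: trilinear_map_def trilinear_on_def linear_map_iff extensional_def)

lemma trilinear_onD:
  assumes "trilinear_on K T U V W f"
  shows "\<lbrakk>x \<in> carrier T; y \<in> carrier U\<rbrakk> \<Longrightarrow> linear_on K V W (\<lambda>z. f x y z)"
    and "\<lbrakk>x \<in> carrier T; z \<in> carrier V\<rbrakk> \<Longrightarrow> linear_on K U W (\<lambda>y. f x y z)"
    and "\<lbrakk>y \<in> carrier U; z \<in> carrier V\<rbrakk> \<Longrightarrow> linear_on K T W (\<lambda>x. f x y z)"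
  using assms by (auto simp: trilinear_on_def)

lemma bilinear_on_closed:
  "\<lbrakk>bilinear_on K U V W f; x \<in> carrier U; y \<in> carrier V\<rbrakk> \<Longrightarrow> f x y \<in> carrier W"
  using linear_on_closed[OF bilinear_onD(1)] .

lemma trilinear_on_closed:
  "\<lbrakk>trilinear_on K T U V W f; x \<in> carrier T; y \<in> carrier U; z \<in> carrier V\<rbrakk>
    \<Longrightarrow> f x y z \<in> carrier W"
  using linear_on_closed[OF trilinear_onD(1)] .

lemma trilinear_on_cong:
  assumes "module K T" "module K U" "module K V" "trilinear_on K T U V W f"
    "\<And>x y z. \<lbrakk>x \<in> carrier T; y \<in> carrier U; z \<in> carrier V\<rbrakk> \<Longrightarrow> f x y z = g x y z"
  shows "trilinear_on K T U V W g"
  unfolding trilinear_on_def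
  using linear_on_cong[OF assms(3) trilinear_onD(1)[OF assms(4)]]
    linear_on_cong[OF assms(2) trilinear_onD(2)[OF assms(4)]]
    linear_on_cong[OF assms(1) trilinear_onD(3)[OF assms(4)]] assms(5) by (auto cong: ball_cong)

text \<open>The convention of being \<open>undefined\<close> off the carriers turns agreement on the
  carriers into equality of HOL functions. This is what makes a semistrict algebra equal to its
  skew-symmetrization.\<close>

lemma bilinear_map_eqI:
  assumes "bilinear_map K U V W f" "bilinear_map K U V W g"
    and "\<And>x y. \<lbrakk>x \<in> carrier U; y \<in> carrier V\<rbrakk> \<Longrightarrow> f x y = g x y"
  shows "f = g"
  using assms bilinear_mapD(2)[OF assms(1)] bilinear_mapD(2)[OF assms(2)] by (intro ext) metis

lemma trilinear_map_eqI:
  assumes "trilinear_map K T U V W f" "trilinear_map K T U V W g"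
    and "\<And>x y z. \<lbrakk>x \<in> carrier T; y \<in> carrier U; z \<in> carrier V\<rbrakk> \<Longrightarrow> f x y z = g x y z"
  shows "f = g"
  using assms trilinear_mapD(2)[OF assms(1)] trilinear_mapD(2)[OF assms(2)] by (intro ext) metis

section \<open>Linear categories\<close>

context linear_category
begin

sublocale AO: module_pair K "Arr V" "Obj V" ..
sublocale OA: module_pair K "Obj V" "Arr V" ..
sublocale AA: module_pair K "Arr V" "Arr V" ..
sublocale OO: module_pair K "Obj V" "Obj V" ..

lemma src_linear_on: "linear_on K (Arr V) (Obj V) (src V)"
  using src_linear by (simp add: linear_map_iff)

lemma tgt_linear_on: "linear_on K (Arr V) (Obj V) (tgt V)"
  using tgt_linear by (simp add: linear_map_iff)

lemma ident_linear_on: "linear_on K (Obj V) (Arr V) (ident V)"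
  using ident_linear by (simp add: linear_map_iff)

lemmas src_simps [simp] = AO.linear_on_simps[OF src_linear_on]
lemmas tgt_simps [simp] = AO.linear_on_simps[OF tgt_linear_on]
lemmas ident_simps [simp] = OA.linear_on_simps[OF ident_linear_on]
declare src_ident [simp] tgt_ident [simp]

lemma composable_iff [simp]:
  "(g, f) \<in> composable V \<longleftrightarrow> g \<in> arrs V \<and> f \<in> arrs V \<and> src V g = tgt V f"
  by (simp add: composable_def)

text \<open>Taking the arrow part is the linear projection of the arrows onto ker s along the
  identities.\<close>

lemma arr_part_linear_on: "linear_on K (Arr V) (Arr V) (arr_part V)"
proof -
  have "linear_on K (Arr V) (Arr V) (\<lambda>f. f)" by (simp add: linear_on_def)
  then show ?thesis
    unfolding arr_part_def
    by (intro AA.linear_on_diff linear_on_compose[OF src_linear_on ident_linear_on])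
qed

lemmas arr_part_simps [simp] = AA.linear_on_simps[OF arr_part_linear_on]

lemma src_arr_part [simp]: "f \<in> arrs V \<Longrightarrow> src V (arr_part V f) = \<zero>\<^bsub>Obj V\<^esub>"
  by (simp add: arr_part_def Ob.M.r_neg a_minus_def)

lemma tgt_arr_part [simp]: "f \<in> arrs V \<Longrightarrow> tgt V (arr_part V f) = tgt V f \<ominus>\<^bsub>Obj V\<^esub> src V f"
  by (simp add: arr_part_def)

lemma arr_part_ident [simp]: "x \<in> objs V \<Longrightarrow> arr_part V (\<iota> x) = \<zero>\<^bsub>Arr V\<^esub>"
  by (simp add: arr_part_def Ar.M.r_neg a_minus_def)

lemma arr_part_eq_self: "\<lbrakk>f \<in> arrs V; src V f = \<zero>\<^bsub>Obj V\<^esub>\<rbrakk> \<Longrightarrow> arr_part V f = f"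
  by (simp add: arr_part_def a_minus_def)

lemma arr_part_arr_part [simp]: "f \<in> arrs V \<Longrightarrow> arr_part V (arr_part V f) = arr_part V f"
  by (simp add: arr_part_eq_self)

lemma arr_decomp: "f \<in> arrs V \<Longrightarrow> f = \<iota> (src V f) \<oplus>\<^sub>1 arr_part V f"
  unfolding arr_part_def
  by (rule Ar.lin_comb_unique, ((rule Ar.lin_comb_intros)+, (simp; fail)?)+, simp only: coeff_simps)

lemma arr_eq_iff:
  "\<lbrakk>f \<in> arrs V; g \<in> arrs V; src V f = src V g\<rbrakk> \<Longrightarrow> f = g \<longleftrightarrow> arr_part V f = arr_part V g"
  using arr_decomp[of f] arr_decomp[of g] by metis

text \<open>Linearity of composition is an interchange law. With g = 1 + a and f = f + 0, where 0 is
  the identity of the zero object, it gives (1 + a) f = 1 f + a 0 = f + a.\<close>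

lemma cmp_eq:
  assumes "g \<in> arrs V" "f \<in> arrs V" "src V g = tgt V f"
  shows "g \<bullet> f = f \<oplus>\<^sub>1 arr_part V g"
proof -
  have zero: "\<iota> \<zero>\<^bsub>Obj V\<^esub> = \<zero>\<^bsub>Arr V\<^esub>" by simp
  have "arr_part V g \<bullet> \<zero>\<^bsub>Arr V\<^esub> = arr_part V g"
    using cmp_ident_right[of "arr_part V g"] assms(1) by simp
  moreover have "\<iota> (src V g) \<bullet> f = f"
    using cmp_ident_left[of f] assms by simp
  moreover have "(\<iota> (src V g) \<oplus>\<^sub>1 arr_part V g) \<bullet> (f \<oplus>\<^sub>1 \<zero>\<^bsub>Arr V\<^esub>)
      = (\<iota> (src V g) \<bullet> f) \<oplus>\<^sub>1 (arr_part V g \<bullet> \<zero>\<^bsub>Arr V\<^esub>)"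
    using assms by (intro cmp_add) auto
  ultimately show ?thesis using assms arr_decomp[of g] by simp
qed

lemma cmp_in_arrs [simp]: "\<lbrakk>g \<in> arrs V; f \<in> arrs V; src V g = tgt V f\<rbrakk> \<Longrightarrow> g \<bullet> f \<in> arrs V"
  by (simp add: cmp_eq)

lemma src_cmp' [simp]: "\<lbrakk>g \<in> arrs V; f \<in> arrs V; src V g = tgt V f\<rbrakk> \<Longrightarrow> src V (g \<bullet> f) = src V f"
  by (simp add: src_cmp)

lemma tgt_cmp' [simp]: "\<lbrakk>g \<in> arrs V; f \<in> arrs V; src V g = tgt V f\<rbrakk> \<Longrightarrow> tgt V (g \<bullet> f) = tgt V g"
  by (simp add: tgt_cmp)

lemma arr_part_cmp [simp]:
  "\<lbrakk>g \<in> arrs V; f \<in> arrs V; src V g = tgt V f\<rbrakk>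
    \<Longrightarrow> arr_part V (g \<bullet> f) = arr_part V f \<oplus>\<^sub>1 arr_part V g"
  by (simp add: cmp_eq)

text \<open>Arrow parts add under composition, so an inverse must start at the target of f and have
  the negated arrow part. This replaces the definite description in \<open>arr_inv\<close> by a
  formula.\<close>

lemma arr_inv_eq:
  assumes f: "f \<in> arrs V"
  shows "arr_inv V f = \<iota> (tgt V f) \<ominus>\<^bsub>Arr V\<^esub> arr_part V f" (is "_ = ?g")
  unfolding arr_inv_def
proof (rule the_equality)
  have src: "src V ?g = tgt V f" and tgt: "tgt V ?g = src V f"
    using f by (auto simp: a_minus_def Ob.M.minus_add Ob.M.a_assoc[symmetric] Ob.M.r_neg)
  have g: "?g \<in> arrs V" using f by simp
  moreover have "?g \<bullet> f = \<iota> (src V f)" "f \<bullet> ?g = \<iota> (tgt V f)"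
    using f src tgt g arr_eq_iff[of "?g \<bullet> f" "\<iota> (src V f)"] arr_eq_iff[of "f \<bullet> ?g" "\<iota> (tgt V f)"]
    by (simp_all add: Ar.M.l_neg Ar.M.r_neg a_minus_def)
  ultimately show "?g \<in> arrs V \<and> src V ?g = tgt V f \<and> tgt V ?g = src V f \<and>
      ?g \<bullet> f = \<iota> (src V f) \<and> f \<bullet> ?g = \<iota> (tgt V f)"
    using src tgt by blast
next
  fix g assume g: "g \<in> arrs V \<and> src V g = tgt V f \<and> tgt V g = src V f \<and>
      g \<bullet> f = \<iota> (src V f) \<and> f \<bullet> g = \<iota> (tgt V f)"
  have "arr_part V f \<oplus>\<^sub>1 arr_part V g = arr_part V (g \<bullet> f)"
    using f g by (intro arr_part_cmp[symmetric]) auto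
  also have "\<dots> = \<zero>\<^bsub>Arr V\<^esub>" using f g by simp
  finally have "arr_part V f \<oplus>\<^sub>1 arr_part V g = \<zero>\<^bsub>Arr V\<^esub>" .
  then have "arr_part V g = \<ominus>\<^sub>1 arr_part V f"
    using f g by (metis Ar.M.minus_equality Ar.M.a_comm arr_part_simps(1))
  then show "g = ?g" using f g arr_decomp[of g] by (simp add: a_minus_def)
qed

text \<open>Both composites start at the same object, so they agree when their arrow parts do. All
  naturality squares and compatibility conditions become linear through this equivalence.\<close>

lemma square_commutes_iff:
  assumes "T \<in> arrs V" "f \<in> arrs V" "g \<in> arrs V" "S \<in> arrs V"
    and "src V T = tgt V f" "src V g = tgt V S" "src V f = src V S"
  shows "T \<bullet> f = g \<bullet> S \<longleftrightarrow> arr_part V f \<oplus>\<^sub>1 arr_part V T = arr_part V S \<oplus>\<^sub>1 arr_part V g"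
  using assms arr_eq_iff[of "T \<bullet> f" "g \<bullet> S"] by simp

end

text \<open>Skew-symmetrization changes only the fields added to those of a linear category, so the
  axioms of the latter carry over.\<close>

lemma (in linear_category) linear_category_cong:
  assumes "Obj W = Obj V" "Arr W = Arr V" "src W = src V" "tgt W = tgt V"
    "ident W = ident V" "cmp W = cmp V"
  shows "linear_category K W"
proof -
  have composable: "composable W = composable V" using assms by (simp add: composable_def)
  show ?thesis
    using linear_category_axioms
    unfolding linear_category_def linear_category_axioms_def assms composable .
qed

section \<open>Lie 2-algebras in components\<close>

text \<open>The operations \<open>ang2\<close> and \<open>ang3\<close> of
  \<open>data_of_lie2\<close>, as notation. With this sign the target of \<langle>x, y\<rangle> is
  [x, y] + [y, x], the defect of skew-symmetry.\<close>

definition angle2 :: "('k, 'o, 'a) lie2 \<Rightarrow> 'o \<Rightarrow> 'o \<Rightarrow> 'a" (\<open>\<langle>_, _\<rangle>\<index>\<close>) where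
  "\<langle>x, y\<rangle>\<^bsub>L\<^esub> = \<ominus>\<^sub>1\<^bsub>L\<^esub> (arr_part L (\<S>\<^bsub>L\<^esub> x y))"

definition angle3 :: "('k, 'o, 'a) lie2 \<Rightarrow> 'o \<Rightarrow> 'o \<Rightarrow> 'o \<Rightarrow> 'a" (\<open>\<langle>_, _, _\<rangle>\<index>\<close>) where
  "\<langle>x, y, z\<rangle>\<^bsub>L\<^esub> = \<ominus>\<^sub>1\<^bsub>L\<^esub> (arr_part L (\<J>\<^bsub>L\<^esub> x y z))"

text \<open>The laws (L1) to (L4) are left out so that their reformulations below can be
  instantiated with the skew-symmetrization, for which these laws are still to be proved.\<close>

locale pre_lie_2_algebra = linear_category K L
  for K and L :: "('k, 'o, 'a) lie2" (structure) +
  assumes bracket: "bilinear_functor K L L L (br0 L) (br1 L)"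
    and alternator: "bilinear_nat_trans K L L
      (\<lambda>x y. [x, y]\<^sub>0) (\<lambda>f g. [f, g]\<^sub>1)
      (\<lambda>x y. \<ominus>\<^sub>0 [y, x]\<^sub>0) (\<lambda>f g. \<ominus>\<^sub>1 [g, f]\<^sub>1) \<S>"
    and jacobiator: "trilinear_nat_trans K L L
      (\<lambda>x y z. [x, [y, z]\<^sub>0]\<^sub>0) (\<lambda>f g h. [f, [g, h]\<^sub>1]\<^sub>1)
      (\<lambda>x y z. [[x, y]\<^sub>0, z]\<^sub>0 \<oplus>\<^sub>0 [y, [x, z]\<^sub>0]\<^sub>0)
      (\<lambda>f g h. [[f, g]\<^sub>1, h]\<^sub>1 \<oplus>\<^sub>1 [g, [f, h]\<^sub>1]\<^sub>1) \<J>"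
begin

lemma br0_bilinear: "bilinear_on K (Obj L) (Obj L) (Obj L) (br0 L)"
  and br1_bilinear: "bilinear_on K (Arr L) (Arr L) (Arr L) (br1 L)"
  using bracket by (simp_all add: bilinear_functor_def bilinear_mapD(1))

lemmas br0_simps [simp] =
  OO.linear_on_simps[OF bilinear_onD(1)[OF br0_bilinear]]
  OO.linear_on_simps[OF bilinear_onD(2)[OF br0_bilinear]]

lemmas br1_simps [simp] =
  AA.linear_on_simps[OF bilinear_onD(1)[OF br1_bilinear]]
  AA.linear_on_simps[OF bilinear_onD(2)[OF br1_bilinear]]

lemma src_br1 [simp]: "\<lbrakk>f \<in> arrs L; g \<in> arrs L\<rbrakk> \<Longrightarrow> src L [f, g]\<^sub>1 = [src L f, src L g]\<^sub>0"
  and tgt_br1 [simp]: "\<lbrakk>f \<in> arrs L; g \<in> arrs L\<rbrakk> \<Longrightarrow> tgt L [f, g]\<^sub>1 = [tgt L f, tgt L g]\<^sub>0"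
  and br1_ident [simp]: "\<lbrakk>x \<in> objs L; y \<in> objs L\<rbrakk> \<Longrightarrow> [\<iota> x, \<iota> y]\<^sub>1 = \<iota> [x, y]\<^sub>0"
  using bracket by (auto simp: bilinear_functor_def)

lemma br1_cmp:
  "\<lbrakk>f' \<in> arrs L; f \<in> arrs L; src L f' = tgt L f; g' \<in> arrs L; g \<in> arrs L; src L g' = tgt L g\<rbrakk>
    \<Longrightarrow> [f' \<bullet> f, g' \<bullet> g]\<^sub>1 = [f', g']\<^sub>1 \<bullet> [f, g]\<^sub>1"
  using bracket unfolding bilinear_functor_def by force

text \<open>Factor f as 1 after f, with 1 the identity of its target, and g as g after 0.
  Functoriality gives [f, g] = [1, g] after [f, 0], and [f, 0] = 0. With a and b in ker s this reads
  [da, b] = [a, b].\<close>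

lemma br1_tgt_left:
  assumes "f \<in> arrs L" "g \<in> arrs L" "src L f = \<zero>\<^bsub>Obj L\<^esub>" "src L g = \<zero>\<^bsub>Obj L\<^esub>"
  shows "[\<iota> (tgt L f), g]\<^sub>1 = [f, g]\<^sub>1"
proof -
  have "[\<iota> (tgt L f) \<bullet> f, g \<bullet> \<iota> (src L g)]\<^sub>1 = [\<iota> (tgt L f), g]\<^sub>1 \<bullet> [f, \<iota> (src L g)]\<^sub>1"
    using assms by (intro br1_cmp) auto
  moreover have "\<iota> (tgt L f) \<bullet> f = f" "g \<bullet> \<iota> (src L g) = g"
    using assms(1,2) by (auto simp: cmp_ident_left cmp_ident_right)
  ultimately show ?thesis using assms by (simp add: cmp_eq arr_part_eq_self)
qed

lemma br1_tgt_right: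
  assumes "f \<in> arrs L" "g \<in> arrs L" "src L f = \<zero>\<^bsub>Obj L\<^esub>" "src L g = \<zero>\<^bsub>Obj L\<^esub>"
  shows "[f, \<iota> (tgt L g)]\<^sub>1 = [f, g]\<^sub>1"
proof -
  have "[f \<bullet> \<iota> (src L f), \<iota> (tgt L g) \<bullet> g]\<^sub>1 = [f, \<iota> (tgt L g)]\<^sub>1 \<bullet> [\<iota> (src L f), g]\<^sub>1"
    using assms by (intro br1_cmp) auto
  moreover have "\<iota> (tgt L g) \<bullet> g = g" "f \<bullet> \<iota> (src L f) = f"
    using assms(1,2) by (auto simp: cmp_ident_left cmp_ident_right)
  ultimately show ?thesis using assms by (simp add: cmp_eq arr_part_eq_self)
qed

lemma arr_part_br1_ident [simp]:
  "\<lbrakk>x \<in> objs L; f \<in> arrs L\<rbrakk> \<Longrightarrow> arr_part L [\<iota> x, f]\<^sub>1 = [\<iota> x, arr_part L f]\<^sub>1"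
  "\<lbrakk>x \<in> objs L; f \<in> arrs L\<rbrakk> \<Longrightarrow> arr_part L [f, \<iota> x]\<^sub>1 = [arr_part L f, \<iota> x]\<^sub>1"
  by (simp_all add: arr_part_def)

lemma alternator_simps [simp]:
  assumes "x \<in> objs L" "y \<in> objs L"
  shows "\<S> x y \<in> arrs L" "src L (\<S> x y) = [x, y]\<^sub>0" "tgt L (\<S> x y) = \<ominus>\<^sub>0 [y, x]\<^sub>0"
    "arr_part L (\<S> x y) = \<ominus>\<^sub>1 \<langle>x, y\<rangle>"
proof -
  show 1: "\<S> x y \<in> arrs L"
    using alternator assms unfolding bilinear_nat_trans_def
    by (auto intro: bilinear_on_closed[OF bilinear_mapD(1)])
  show "src L (\<S> x y) = [x, y]\<^sub>0" "tgt L (\<S> x y) = \<ominus>\<^sub>0 [y, x]\<^sub>0"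
    using alternator assms by (auto simp: bilinear_nat_trans_def)
  show "arr_part L (\<S> x y) = \<ominus>\<^sub>1 \<langle>x, y\<rangle>" using 1 by (simp add: angle2_def)
qed

lemma jacobiator_simps [simp]:
  assumes "x \<in> objs L" "y \<in> objs L" "z \<in> objs L"
  shows "\<J> x y z \<in> arrs L" "src L (\<J> x y z) = [x, [y, z]\<^sub>0]\<^sub>0"
    "tgt L (\<J> x y z) = [[x, y]\<^sub>0, z]\<^sub>0 \<oplus>\<^sub>0 [y, [x, z]\<^sub>0]\<^sub>0"
    "arr_part L (\<J> x y z) = \<ominus>\<^sub>1 \<langle>x, y, z\<rangle>"
proof -
  show 1: "\<J> x y z \<in> arrs L"
    using jacobiator assms unfolding trilinear_nat_trans_def
    by (auto intro: trilinear_on_closed[OF trilinear_mapD(1)])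
  show "src L (\<J> x y z) = [x, [y, z]\<^sub>0]\<^sub>0"
    "tgt L (\<J> x y z) = [[x, y]\<^sub>0, z]\<^sub>0 \<oplus>\<^sub>0 [y, [x, z]\<^sub>0]\<^sub>0"
    using jacobiator assms by (auto simp: trilinear_nat_trans_def)
  show "arr_part L (\<J> x y z) = \<ominus>\<^sub>1 \<langle>x, y, z\<rangle>" using 1 by (simp add: angle3_def)
qed

lemma neg_arr_part_linear_on: "linear_on K (Arr L) (Arr L) (\<lambda>f. \<ominus>\<^sub>1 arr_part L f)"
  by (intro AA.linear_on_uminus arr_part_linear_on)

lemma angle2_bilinear: "bilinear_on K (Obj L) (Obj L) (Arr L) (\<lambda>x y. \<langle>x, y\<rangle>)"
  using alternator unfolding bilinear_nat_trans_def bilinear_on_def angle2_def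
  by (blast intro: linear_on_compose[OF bilinear_onD(1)[OF bilinear_mapD(1)] neg_arr_part_linear_on]
    linear_on_compose[OF bilinear_onD(2)[OF bilinear_mapD(1)] neg_arr_part_linear_on])

lemma angle3_trilinear: "trilinear_on K (Obj L) (Obj L) (Obj L) (Arr L) (\<lambda>x y z. \<langle>x, y, z\<rangle>)"
  using jacobiator unfolding trilinear_nat_trans_def trilinear_on_def angle3_def
  by (blast intro: linear_on_compose[OF trilinear_onD(1)[OF trilinear_mapD(1)] neg_arr_part_linear_on]
    linear_on_compose[OF trilinear_onD(2)[OF trilinear_mapD(1)] neg_arr_part_linear_on]
    linear_on_compose[OF trilinear_onD(3)[OF trilinear_mapD(1)] neg_arr_part_linear_on])

lemmas angle2_simps [simp] =
  OA.linear_on_simps[OF bilinear_onD(1)[OF angle2_bilinear]]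
  OA.linear_on_simps[OF bilinear_onD(2)[OF angle2_bilinear]]

lemmas angle3_simps [simp] =
  OA.linear_on_simps[OF trilinear_onD(1)[OF angle3_trilinear]]
  OA.linear_on_simps[OF trilinear_onD(2)[OF angle3_trilinear]]
  OA.linear_on_simps[OF trilinear_onD(3)[OF angle3_trilinear]]

lemma src_angle2 [simp]: "\<lbrakk>x \<in> objs L; y \<in> objs L\<rbrakk> \<Longrightarrow> src L \<langle>x, y\<rangle> = \<zero>\<^bsub>Obj L\<^esub>"
  by (simp add: angle2_def del: alternator_simps(4))

lemma arr_part_angle2 [simp]: "\<lbrakk>x \<in> objs L; y \<in> objs L\<rbrakk> \<Longrightarrow> arr_part L \<langle>x, y\<rangle> = \<langle>x, y\<rangle>"
  by (simp add: arr_part_eq_self)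

lemma tgt_angle2: "\<lbrakk>x \<in> objs L; y \<in> objs L\<rbrakk> \<Longrightarrow> tgt L \<langle>x, y\<rangle> = [x, y]\<^sub>0 \<oplus>\<^sub>0 [y, x]\<^sub>0"
  by (simp add: angle2_def Ob.M.minus_add Ob.M.a_comm del: alternator_simps(4))
    (simp add: a_minus_def Ob.M.minus_add Ob.M.a_comm)

lemma src_angle3 [simp]:
  "\<lbrakk>x \<in> objs L; y \<in> objs L; z \<in> objs L\<rbrakk> \<Longrightarrow> src L \<langle>x, y, z\<rangle> = \<zero>\<^bsub>Obj L\<^esub>"
  by (simp add: angle3_def del: jacobiator_simps(4))

lemma arr_part_angle3 [simp]:
  "\<lbrakk>x \<in> objs L; y \<in> objs L; z \<in> objs L\<rbrakk> \<Longrightarrow> arr_part L \<langle>x, y, z\<rangle> = \<langle>x, y, z\<rangle>"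
  by (simp add: arr_part_eq_self)

text \<open>The naturality square of the alternator, read in arrow parts: the increment of
  \<langle>x, y\<rangle> along two arrows is the failure of the bracket on arrow parts to be
  skew.\<close>

lemma angle2_natural:
  assumes "f \<in> arrs L" "g \<in> arrs L"
  shows "\<langle>tgt L f, tgt L g\<rangle> \<ominus>\<^bsub>Arr L\<^esub> \<langle>src L f, src L g\<rangle>
    = arr_part L [f, g]\<^sub>1 \<oplus>\<^sub>1 arr_part L [g, f]\<^sub>1"
proof -
  have "\<S> (tgt L f) (tgt L g) \<bullet> [f, g]\<^sub>1 = (\<ominus>\<^sub>1 [g, f]\<^sub>1) \<bullet> \<S> (src L f) (src L g)"
    using alternator assms by (auto simp: bilinear_nat_trans_def)
  then have "arr_part L [f, g]\<^sub>1 \<oplus>\<^sub>1 \<ominus>\<^sub>1 \<langle>tgt L f, tgt L g\<rangle>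
      = \<ominus>\<^sub>1 \<langle>src L f, src L g\<rangle> \<oplus>\<^sub>1 \<ominus>\<^sub>1 arr_part L [g, f]\<^sub>1"
    by (subst (asm) square_commutes_iff) (use assms in auto)
  from this assms show ?thesis
    by - (rule Ar.lin_comb_transfer[where c = "-1"], assumption,
      ((rule Ar.lin_comb_intros)+, (simp; fail)?)+, simp only: coeff_simps)
qed

text \<open>The naturality square of the Jacobiator in the same form: the increment of the 3-bracket
  along arrows is the Leibniz defect of the bracket on arrows.\<close>

lemma angle3_natural:
  assumes "f \<in> arrs L" "g \<in> arrs L" "h \<in> arrs L"
  shows "\<langle>tgt L f, tgt L g, tgt L h\<rangle> \<ominus>\<^bsub>Arr L\<^esub> \<langle>src L f, src L g, src L h\<rangle>
    = arr_part L ([f, [g, h]\<^sub>1]\<^sub>1 \<ominus>\<^bsub>Arr L\<^esub> [[f, g]\<^sub>1, h]\<^sub>1 \<ominus>\<^bsub>Arr L\<^esub> [g, [f, h]\<^sub>1]\<^sub>1)"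
proof -
  have "\<J> (tgt L f) (tgt L g) (tgt L h) \<bullet> [f, [g, h]\<^sub>1]\<^sub>1
      = ([[f, g]\<^sub>1, h]\<^sub>1 \<oplus>\<^sub>1 [g, [f, h]\<^sub>1]\<^sub>1) \<bullet> \<J> (src L f) (src L g) (src L h)"
    using jacobiator assms by (auto simp: trilinear_nat_trans_def)
  then have "arr_part L [f, [g, h]\<^sub>1]\<^sub>1 \<oplus>\<^sub>1 \<ominus>\<^sub>1 \<langle>tgt L f, tgt L g, tgt L h\<rangle>
      = \<ominus>\<^sub>1 \<langle>src L f, src L g, src L h\<rangle> \<oplus>\<^sub>1 (arr_part L [[f, g]\<^sub>1, h]\<^sub>1 \<oplus>\<^sub>1 arr_part L [g, [f, h]\<^sub>1]\<^sub>1)"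
    by (subst (asm) square_commutes_iff) (use assms in auto)
  moreover have split: "arr_part L ([f, [g, h]\<^sub>1]\<^sub>1 \<ominus>\<^bsub>Arr L\<^esub> [[f, g]\<^sub>1, h]\<^sub>1 \<ominus>\<^bsub>Arr L\<^esub> [g, [f, h]\<^sub>1]\<^sub>1)
      = arr_part L [f, [g, h]\<^sub>1]\<^sub>1 \<ominus>\<^bsub>Arr L\<^esub> arr_part L [[f, g]\<^sub>1, h]\<^sub>1 \<ominus>\<^bsub>Arr L\<^esub> arr_part L [g, [f, h]\<^sub>1]\<^sub>1"
    using assms by simp
  ultimately show ?thesis unfolding split using assms
    by - (rule Ar.lin_comb_transfer[where c = "-1"], assumption,
      ((rule Ar.lin_comb_intros)+, (simp; fail)?)+, simp only: coeff_simps)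
qed

text \<open>Identity summands have arrow part zero, so each threefold composite contributes the sum
  of its five brackets. Every one of them carries the minus sign from the definition of the
  3-bracket, hence the use of \<open>lin_comb_iff_neg\<close>.\<close>

lemma L1_iff:
  assumes "x \<in> objs L" "y \<in> objs L" "z \<in> objs L" "w \<in> objs L"
  shows "([\<J> x y z, \<iota> w]\<^sub>1 \<oplus>\<^sub>1 \<iota> [[y, z]\<^sub>0, [x, w]\<^sub>0]\<^sub>0 \<oplus>\<^sub>1 \<iota> [[x, z]\<^sub>0, [y, w]\<^sub>0]\<^sub>0 \<oplus>\<^sub>1 [\<iota> z, \<J> x y w]\<^sub>1)
        \<bullet> (\<J> x [y, z]\<^sub>0 w \<oplus>\<^sub>1 \<J> x z [y, w]\<^sub>0)
        \<bullet> [\<iota> x, \<J> y z w]\<^sub>1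
      = (\<iota> [[[x, y]\<^sub>0, z]\<^sub>0, w]\<^sub>0 \<oplus>\<^sub>1 \<iota> [z, [[x, y]\<^sub>0, w]\<^sub>0]\<^sub>0 \<oplus>\<^sub>1 \<J> y [x, z]\<^sub>0 w \<oplus>\<^sub>1 \<J> y z [x, w]\<^sub>0)
        \<bullet> (\<J> [x, y]\<^sub>0 z w \<oplus>\<^sub>1 [\<iota> y, \<J> x z w]\<^sub>1)
        \<bullet> \<J> x y [z, w]\<^sub>0
    \<longleftrightarrow> [\<langle>x, y, z\<rangle>, \<iota> w]\<^sub>1 \<oplus>\<^sub>1 [\<iota> z, \<langle>x, y, w\<rangle>]\<^sub>1 \<oplus>\<^sub>1 \<langle>x, [y, z]\<^sub>0, w\<rangle> \<oplus>\<^sub>1 \<langle>x, z, [y, w]\<^sub>0\<rangle> \<oplus>\<^sub>1 [\<iota> x, \<langle>y, z, w\<rangle>]\<^sub>1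
      = \<langle>y, [x, z]\<^sub>0, w\<rangle> \<oplus>\<^sub>1 \<langle>y, z, [x, w]\<^sub>0\<rangle> \<oplus>\<^sub>1 \<langle>[x, y]\<^sub>0, z, w\<rangle> \<oplus>\<^sub>1 [\<iota> y, \<langle>x, z, w\<rangle>]\<^sub>1 \<oplus>\<^sub>1 \<langle>x, y, [z, w]\<^sub>0\<rangle>"
    (is "?f3 \<bullet> ?f2 \<bullet> ?f1 = ?g3 \<bullet> ?g2 \<bullet> ?g1 \<longleftrightarrow> ?l = ?r")
proof -
  have "?f1 \<in> arrs L" "?f2 \<in> arrs L" "?f3 \<in> arrs L" "?g1 \<in> arrs L" "?g2 \<in> arrs L" "?g3 \<in> arrs L"
    using assms by simp_all
  moreover have "src L ?f2 = tgt L ?f1" "src L ?g2 = tgt L ?g1" "src L ?f1 = src L ?g1"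
    using assms by simp_all
  \<comment> \<open>Here and for \<open>?g3\<close>, source and target agree only after the summands
    are rearranged, so linear arithmetic in the objects is required before the arrows may be
    composed.\<close>
  moreover have "src L ?f3 = tgt L ?f2"
    using assms by simp
      (rule Ob.lin_comb_unique, ((rule Ob.lin_comb_intros)+, (simp; fail)?)+,
        simp only: coeff_simps)
  moreover have "src L ?g3 = tgt L ?g2"
    using assms by simp
      (rule Ob.lin_comb_unique, ((rule Ob.lin_comb_intros)+, (simp; fail)?)+,
        simp only: coeff_simps)
  ultimately have *: "?f3 \<bullet> ?f2 \<bullet> ?f1 = ?g3 \<bullet> ?g2 \<bullet> ?g1 \<longleftrightarrow>
      arr_part L ?f1 \<oplus>\<^sub>1 arr_part L ?f2 \<oplus>\<^sub>1 arr_part L ?f3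
        = arr_part L ?g1 \<oplus>\<^sub>1 arr_part L ?g2 \<oplus>\<^sub>1 arr_part L ?g3"
    using arr_eq_iff[of "?f3 \<bullet> ?f2 \<bullet> ?f1" "?g3 \<bullet> ?g2 \<bullet> ?g1"] by simp
  show ?thesis unfolding *
    using assms by simp
      (rule Ar.lin_comb_iff_neg, ((rule Ar.lin_comb_intros)+, (simp; fail)?)+,
        simp only: coeff_simps)
qed

text \<open>Inverting J negates its arrow part, so \<open>jac_hat\<close> has arrow part
  +\<langle>x, y, z\<rangle>. Subtracting the identity of [y, [x, z]] leaves the source [[x, y], z],
  which makes the composite in (L2) meaningful.\<close>

lemma L2_iff:
  assumes "x \<in> objs L" "y \<in> objs L" "z \<in> objs L"
  shows "(\<ominus>\<^sub>1 \<JJ> y x z) \<bullet> [\<S> x y, \<iota> z]\<^sub>1 = \<JJ> x y z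
    \<longleftrightarrow> \<langle>x, y, z\<rangle> \<oplus>\<^sub>1 \<langle>y, x, z\<rangle> = \<ominus>\<^sub>1 [\<langle>x, y\<rangle>, \<iota> z]\<^sub>1"
  (is "?f \<bullet> ?g = ?h \<longleftrightarrow> ?l = ?r")
proof -
  have hat: "\<JJ> x y z \<in> arrs L \<and> src L (\<JJ> x y z) = [[x, y]\<^sub>0, z]\<^sub>0 \<and> arr_part L (\<JJ> x y z) = \<langle>x, y, z\<rangle>"
    if "x \<in> objs L" "y \<in> objs L" "z \<in> objs L" for x y z
    using that by (simp add: jac_hat_def arr_inv_eq)
       (simp add: a_minus_def Ob.M.a_assoc Ob.M.r_neg)
  have "?f \<bullet> ?g = ?h \<longleftrightarrow> arr_part L ?g \<oplus>\<^sub>1 arr_part L ?f = arr_part L ?h"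
    using assms hat arr_eq_iff[of "?f \<bullet> ?g" ?h] by simp
  also have "\<dots> \<longleftrightarrow> ?l = ?r"
    using assms hat by simp
      (rule Ar.lin_comb_iff_neg, ((rule Ar.lin_comb_intros)+, (simp; fail)?)+,
        simp only: coeff_simps)
  finally show ?thesis .
qed

lemma L3_iff:
  assumes "x \<in> objs L" "y \<in> objs L" "z \<in> objs L"
  shows "(\<ominus>\<^sub>1 \<J> x z y) \<bullet> [\<iota> x, \<S> y z]\<^sub>1 = (\<S> [x, y]\<^sub>0 z \<oplus>\<^sub>1 \<S> y [x, z]\<^sub>0) \<bullet> \<J> x y z
    \<longleftrightarrow> \<langle>x, y, z\<rangle> \<oplus>\<^sub>1 \<langle>x, z, y\<rangle> = [\<iota> x, \<langle>y, z\<rangle>]\<^sub>1 \<ominus>\<^bsub>Arr L\<^esub> \<langle>[x, y]\<^sub>0, z\<rangle> \<ominus>\<^bsub>Arr L\<^esub> \<langle>y, [x, z]\<^sub>0\<rangle>"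
  (is "?f \<bullet> ?g = ?f' \<bullet> ?g' \<longleftrightarrow> ?l = ?r")
proof -
  have "src L ?f' = tgt L ?g'"
    using assms by simp
  moreover have "src L ?f = tgt L ?g"
    using assms by simp
  ultimately have *: "?f \<bullet> ?g = ?f' \<bullet> ?g'
      \<longleftrightarrow> arr_part L ?g \<oplus>\<^sub>1 arr_part L ?f = arr_part L ?g' \<oplus>\<^sub>1 arr_part L ?f'"
    using assms arr_eq_iff[of "?f \<bullet> ?g" "?f' \<bullet> ?g'"] by simp
  show ?thesis unfolding * using assms by simp
    (rule Ar.lin_comb_iff, ((rule Ar.lin_comb_intros)+, (simp; fail)?)+,
      simp only: coeff_simps)
qed

lemma L4_iff:
  assumes "x \<in> objs L" "y \<in> objs L" "z \<in> objs L"
  shows "(\<ominus>\<^sub>1 \<S> [y, z]\<^sub>0 x) \<bullet> \<S> x [y, z]\<^sub>0 = \<iota> [x, [y, z]\<^sub>0]\<^sub>0 \<longleftrightarrow> \<langle>x, [y, z]\<^sub>0\<rangle> = \<langle>[y, z]\<^sub>0, x\<rangle>"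
  (is "?f \<bullet> ?g = ?h \<longleftrightarrow> ?l = ?r")
proof -
  have *: "?f \<bullet> ?g = ?h \<longleftrightarrow> arr_part L ?g \<oplus>\<^sub>1 arr_part L ?f = arr_part L ?h"
    using assms arr_eq_iff[of "?f \<bullet> ?g" ?h] by simp
  show ?thesis unfolding * using assms by simp
    (rule Ar.lin_comb_iff_neg, ((rule Ar.lin_comb_intros)+, (simp; fail)?)+,
      simp only: coeff_simps)
qed

end

sublocale lie_2_algebra \<subseteq> pre_lie_2_algebra K L
  by unfold_locales (fact bracket alternator jacobiator)+

context lie_2_algebra
begin

lemma angle3_L1:
  assumes "x \<in> objs L" "y \<in> objs L" "z \<in> objs L" "w \<in> objs L"
  shows "[\<langle>x, y, z\<rangle>, \<iota> w]\<^sub>1 \<oplus>\<^sub>1 [\<iota> z, \<langle>x, y, w\<rangle>]\<^sub>1 \<oplus>\<^sub>1 \<langle>x, [y, z]\<^sub>0, w\<rangle> \<oplus>\<^sub>1 \<langle>x, z, [y, w]\<^sub>0\<rangle> \<oplus>\<^sub>1 [\<iota> x, \<langle>y, z, w\<rangle>]\<^sub>1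
      = \<langle>y, [x, z]\<^sub>0, w\<rangle> \<oplus>\<^sub>1 \<langle>y, z, [x, w]\<^sub>0\<rangle> \<oplus>\<^sub>1 \<langle>[x, y]\<^sub>0, z, w\<rangle> \<oplus>\<^sub>1 [\<iota> y, \<langle>x, z, w\<rangle>]\<^sub>1 \<oplus>\<^sub>1 \<langle>x, y, [z, w]\<^sub>0\<rangle>"
  using L1[OF assms] unfolding L1_iff[OF assms] .

lemma angle3_L2:
  assumes "x \<in> objs L" "y \<in> objs L" "z \<in> objs L"
  shows "\<langle>x, y, z\<rangle> \<oplus>\<^sub>1 \<langle>y, x, z\<rangle> = \<ominus>\<^sub>1 [\<langle>x, y\<rangle>, \<iota> z]\<^sub>1"
  using L2[OF assms] unfolding L2_iff[OF assms] .

lemma angle3_L3: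
  assumes "x \<in> objs L" "y \<in> objs L" "z \<in> objs L"
  shows "\<langle>x, y, z\<rangle> \<oplus>\<^sub>1 \<langle>x, z, y\<rangle> = [\<iota> x, \<langle>y, z\<rangle>]\<^sub>1 \<ominus>\<^bsub>Arr L\<^esub> \<langle>[x, y]\<^sub>0, z\<rangle> \<ominus>\<^bsub>Arr L\<^esub> \<langle>y, [x, z]\<^sub>0\<rangle>"
  using L3[OF assms] unfolding L3_iff[OF assms] .

lemma tgt_angle3:
  assumes "x \<in> objs L" "y \<in> objs L" "z \<in> objs L"
  shows "tgt L \<langle>x, y, z\<rangle> = [x, [y, z]\<^sub>0]\<^sub>0 \<ominus>\<^bsub>Obj L\<^esub> [[x, y]\<^sub>0, z]\<^sub>0 \<ominus>\<^bsub>Obj L\<^esub> [y, [x, z]\<^sub>0]\<^sub>0"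
  using assms by (simp add: angle3_def del: jacobiator_simps(4))
    (rule Ob.lin_comb_unique, ((rule Ob.lin_comb_intros)+, (simp; fail)?)+,
      simp only: coeff_simps)

end

section \<open>Alternating sums\<close>

text \<open>Expansion by the first argument, as for a determinant: moving the k-th argument to the
  front costs k - 1 transpositions. The shape matches the left side of
  \<open>skew_L1\<close>.\<close>

definition alt_sum4 ::
    "('k, 'v) module \<Rightarrow> ('o \<Rightarrow> 'o \<Rightarrow> 'o \<Rightarrow> 'o \<Rightarrow> 'v) \<Rightarrow> 'o \<Rightarrow> 'o \<Rightarrow> 'o \<Rightarrow> 'o \<Rightarrow> 'v" where
  "alt_sum4 V f x y z w =
     alt_sum3 V (f x) y z w \<ominus>\<^bsub>V\<^esub> alt_sum3 V (f y) x z w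
       \<oplus>\<^bsub>V\<^esub> alt_sum3 V (f z) x y w \<ominus>\<^bsub>V\<^esub> alt_sum3 V (f w) x y z"

lemma alt_sum3_cong:
  assumes "\<And>a b c. \<lbrakk>a \<in> {x, y, z}; b \<in> {x, y, z}; c \<in> {x, y, z}\<rbrakk> \<Longrightarrow> f a b c = g a b c"
  shows "alt_sum3 V f x y z = alt_sum3 V g x y z"
  by (simp add: alt_sum3_def assms)

lemma alt_sum4_cong:
  assumes "\<And>a b c d. \<lbrakk>a \<in> {x, y, z, w}; b \<in> {x, y, z, w}; c \<in> {x, y, z, w}; d \<in> {x, y, z, w}\<rbrakk>
    \<Longrightarrow> f a b c d = g a b c d"
  shows "alt_sum4 V f x y z w = alt_sum4 V g x y z w"
  by (simp add: alt_sum4_def alt_sum3_def assms)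

locale alternation = module K V
  for K :: "('k, 'm) ring_scheme" and V :: "('k, 'v) module" and X :: "'o set" and x y z w :: 'o +
  assumes args [simp]: "x \<in> X" "y \<in> X" "z \<in> X" "w \<in> X"
begin

abbreviation closed4 :: "('o \<Rightarrow> 'o \<Rightarrow> 'o \<Rightarrow> 'o \<Rightarrow> 'v) \<Rightarrow> bool" where
  "closed4 f \<equiv> (\<forall>a\<in>X. \<forall>b\<in>X. \<forall>c\<in>X. \<forall>d\<in>X. f a b c d \<in> carrier V)"

abbreviation alt :: "('o \<Rightarrow> 'o \<Rightarrow> 'o \<Rightarrow> 'o \<Rightarrow> 'v) \<Rightarrow> 'v" where
  "alt f \<equiv> alt_sum4 V f x y z w"

lemma alt_closed [simp]: "closed4 f \<Longrightarrow> alt f \<in> carrier V"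
  by (simp add: alt_sum4_def alt_sum3_def)

lemma alt_cong:
  "(\<And>a b c d. \<lbrakk>a \<in> X; b \<in> X; c \<in> X; d \<in> X\<rbrakk> \<Longrightarrow> f a b c d = g a b c d) \<Longrightarrow> alt f = alt g"
  using args by (intro alt_sum4_cong) blast

lemma alt_add:
  assumes "closed4 f" "closed4 g"
  shows "alt (\<lambda>a b c d. f a b c d \<oplus>\<^bsub>V\<^esub> g a b c d) = alt f \<oplus>\<^bsub>V\<^esub> alt g"
  unfolding alt_sum4_def alt_sum3_def using assms
  by - (rule lin_comb_unique, ((rule lin_comb_intros)+, (simp; fail)?)+, simp only: coeff_simps)

lemma alt_neg:
  assumes "closed4 f"
  shows "alt (\<lambda>a b c d. \<ominus>\<^bsub>V\<^esub> f a b c d) = \<ominus>\<^bsub>V\<^esub> alt f"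
  unfolding alt_sum4_def alt_sum3_def using assms
  by - (rule lin_comb_unique, ((rule lin_comb_intros)+, (simp; fail)?)+, simp only: coeff_simps)

lemma alt_minus:
  assumes "closed4 f" "closed4 g"
  shows "alt (\<lambda>a b c d. f a b c d \<ominus>\<^bsub>V\<^esub> g a b c d) = alt f \<ominus>\<^bsub>V\<^esub> alt g"
  using assms by (simp add: a_minus_def alt_add alt_neg)

lemma alt_recip:
  assumes "closed4 f" "invertible_nat K n"
  shows "alt (\<lambda>a b c d. recip K n \<odot>\<^bsub>V\<^esub> f a b c d) = recip K n \<odot>\<^bsub>V\<^esub> alt f"
  unfolding alt_sum4_def alt_sum3_def using assms
  by (simp add: smult_r_distr smult_a_minus)

text \<open>Relabelling the arguments permutes the 24 summands and multiplies the sum by the sign of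
  the permutation. The list contains the relabellings that occur in \<open>skew_L1\<close>.\<close>

lemma alt_permute:
  assumes "closed4 f"
  shows "alt (\<lambda>a b c d. f b a c d) = \<ominus>\<^bsub>V\<^esub> alt f"
    and "alt (\<lambda>a b c d. f a c b d) = \<ominus>\<^bsub>V\<^esub> alt f"
    and "alt (\<lambda>a b c d. f d a b c) = \<ominus>\<^bsub>V\<^esub> alt f"
    and "alt (\<lambda>a b c d. f b d a c) = \<ominus>\<^bsub>V\<^esub> alt f"
    and "alt (\<lambda>a b c d. f c a b d) = alt f"
    and "alt (\<lambda>a b c d. f b c a d) = alt f"
    and "alt (\<lambda>a b c d. f a d b c) = alt f"
    and "alt (\<lambda>a b c d. f c d a b) = alt f"
  unfolding alt_sum4_def alt_sum3_def using assms
  by - ((rule lin_comb_unique, ((rule lin_comb_intros)+, (simp; fail)?)+, simp only: coeff_simps))+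

text \<open>The 24 permutations are the 6 shuffles of two pairs times the 4 exchanges inside the
  pairs. The function p performs the exchanges, and the left side runs over the shuffles with their
  signs.\<close>

lemma alt_pairs:
  assumes "closed4 f"
    and "\<And>a b c d. \<lbrakk>a \<in> X; b \<in> X; c \<in> X; d \<in> X\<rbrakk> \<Longrightarrow> p a b c d = f a b c d \<ominus>\<^bsub>V\<^esub> f b a c d \<ominus>\<^bsub>V\<^esub> f a b d c \<oplus>\<^bsub>V\<^esub> f b a d c"
  shows "p x y z w \<ominus>\<^bsub>V\<^esub> p x z y w \<oplus>\<^bsub>V\<^esub> p x w y z \<oplus>\<^bsub>V\<^esub> p y z x w \<ominus>\<^bsub>V\<^esub> p y w x z \<oplus>\<^bsub>V\<^esub> p z w x y = alt f"
  unfolding alt_sum4_def alt_sum3_def using assms(1)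
  apply (simp only: assms(2) args)
  by (rule lin_comb_unique, ((rule lin_comb_intros)+, (simp; fail)?)+, simp only: coeff_simps)

end

text \<open>No law is imposed on the product. The locale is instantiated with the bracket on objects
  and with the bracket on arrows, so one computation serves for targets and for naturality.\<close>

locale bilinear_algebra = module_pair K V V
  for K :: "('k, 'm) ring_scheme" and V :: "('k, 'v) module" +
  fixes br :: "'v \<Rightarrow> 'v \<Rightarrow> 'v"
  assumes br_bilinear: "bilinear_on K V V V br"
    and invertible_2 [simp]: "invertible_nat K 2" and invertible_3 [simp]: "invertible_nat K 3"
begin

lemmas br_simps [simp] =
  linear_on_simps[OF bilinear_onD(1)[OF br_bilinear]]
  linear_on_simps[OF bilinear_onD(2)[OF br_bilinear]]

lemma invertible_6 [simp]: "invertible_nat K 6" and invertible_12 [simp]: "invertible_nat K 12"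
  using V.invertible_nat_mult[of 2 3] V.invertible_nat_mult[of 2 6] by simp_all

definition skew_br :: "'v \<Rightarrow> 'v \<Rightarrow> 'v" where
  "skew_br x y = recip K 2 \<odot>\<^bsub>V\<^esub> (br x y \<ominus>\<^bsub>V\<^esub> br y x)"

lemma skew_br_bilinear: "bilinear_on K V V V skew_br"
  unfolding bilinear_on_def skew_br_def
  by (auto intro!: linear_on_intros bilinear_onD[OF br_bilinear])

lemma skew_br_closed [simp]: "\<lbrakk>x \<in> carrier V; y \<in> carrier V\<rbrakk> \<Longrightarrow> skew_br x y \<in> carrier V"
  by (simp add: skew_br_def)

lemma skew_br_skew: "\<lbrakk>x \<in> carrier V; y \<in> carrier V\<rbrakk> \<Longrightarrow> skew_br y x = \<ominus>\<^bsub>V\<^esub> skew_br x y"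
  unfolding skew_br_def by
    (rule V.lin_comb_unique, ((rule V.lin_comb_intros)+, (simp; fail)?)+,
      simp only: coeff_simps)

text \<open>Let P and Q be the alternating sums of x(yz) and (xy)z. As y(xz) alternates to -P and
  z(xy) to P, the left side is (2P - Q)/6 - (Q + P)/12 = (P - Q)/4, which is the Jacobi defect of
  half the commutator. The coefficient 1/12 is the one for which P and Q occur with opposite
  coefficients.\<close>

lemma skew_jacobi:
  assumes "x \<in> carrier V" "y \<in> carrier V" "z \<in> carrier V"
  shows "recip K 6 \<odot>\<^bsub>V\<^esub> alt_sum3 V (\<lambda>x y z. br x (br y z) \<ominus>\<^bsub>V\<^esub> br (br x y) z \<ominus>\<^bsub>V\<^esub> br y (br x z)) x y z
      \<ominus>\<^bsub>V\<^esub> recip K 12 \<odot>\<^bsub>V\<^esub> alt_sum3 V (\<lambda>x y z. br (br x y) z \<oplus>\<^bsub>V\<^esub> br z (br x y)) x y z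
    = skew_br x (skew_br y z) \<ominus>\<^bsub>V\<^esub> skew_br (skew_br x y) z \<ominus>\<^bsub>V\<^esub> skew_br y (skew_br x z)"
  unfolding alt_sum3_def skew_br_def using assms
  by simp
    (rule V.lin_comb_unique, ((rule V.lin_comb_intros)+, (simp; fail)?)+,
      simp only: coeff_simps)

end

section \<open>The skew-symmetrization of a Lie 2-algebra\<close>

lemma skew_lie2_simps [simp]:
  "Obj (skew_lie2 K L) = Obj L" "Arr (skew_lie2 K L) = Arr L"
  "src (skew_lie2 K L) = src L" "tgt (skew_lie2 K L) = tgt L"
  "ident (skew_lie2 K L) = ident L" "cmp (skew_lie2 K L) = cmp L"
  by (simp_all add: skew_lie2_def lie2_of_data_def)

lemma skew_lie2_category_simps [simp]:
  "composable (skew_lie2 K L) = composable L" "arr_part (skew_lie2 K L) = arr_part L"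
  by (simp_all add: composable_def arr_part_def fun_eq_iff)

locale skewable_lie_2_algebra = lie_2_algebra K L for K and L :: "('k, 'o, 'a) lie2" (structure) +
  assumes invertible_2: "invertible_nat K 2" and invertible_3: "invertible_nat K 3"
begin

sublocale O: bilinear_algebra K "Obj L" "br0 L"
  by (intro bilinear_algebra.intro bilinear_algebra_axioms.intro OO.module_pair_axioms
    br0_bilinear invertible_2 invertible_3)

sublocale A: bilinear_algebra K "Arr L" "br1 L"
  by (intro bilinear_algebra.intro bilinear_algebra_axioms.intro AA.module_pair_axioms
    br1_bilinear invertible_2 invertible_3)

definition skew3 :: "'o \<Rightarrow> 'o \<Rightarrow> 'o \<Rightarrow> 'a" where
  "skew3 x y z =
     recip K 6 \<odot>\<^bsub>Arr L\<^esub> alt_sum3 (Arr L) (\<lambda>x y z. \<langle>x, y, z\<rangle>) x y z \<ominus>\<^bsub>Arr L\<^esub>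
     recip K 12 \<odot>\<^bsub>Arr L\<^esub> alt_sum3 (Arr L) (\<lambda>x y z. \<langle>[x, y]\<^sub>0, z\<rangle>) x y z"

lemma alternator_skew:
  "\<lbrakk>x \<in> objs L; y \<in> objs L\<rbrakk> \<Longrightarrow> alternator (skew_lie2 K L) x y = \<iota> (O.skew_br x y)"
  by (simp add: skew_lie2_def lie2_of_data_def restrict2_def skew_data_def data_of_lie2_def
      mk_arr_def O.skew_br_def)

lemma jacobiator_skew:
  "\<lbrakk>x \<in> objs L; y \<in> objs L; z \<in> objs L\<rbrakk> \<Longrightarrow>
    jacobiator (skew_lie2 K L) x y z = \<iota> (O.skew_br x (O.skew_br y z)) \<oplus>\<^sub>1 \<ominus>\<^sub>1 skew3 x y z"
  by (simp add: skew_lie2_def lie2_of_data_def restrict3_def skew_data_def data_of_lie2_def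
      mk_arr_def O.skew_br_def skew3_def angle2_def angle3_def)

lemma br0_skew: "\<lbrakk>x \<in> objs L; y \<in> objs L\<rbrakk> \<Longrightarrow> br0 (skew_lie2 K L) x y = O.skew_br x y"
  by (simp add: skew_lie2_def lie2_of_data_def restrict2_def skew_data_def data_of_lie2_def O.skew_br_def)

text \<open>The bracket rebuilt from the skew data contains the unsymmetric term {da, b}. Since
  [da, b] = [a, b] and [b, da] = [b, a], it equals {a, b}, and the four terms are the expansion of
  {1 + a, 1 + b}, with the two identities at the sources.\<close>

lemma br1_skew:
  assumes f: "f \<in> arrs L" and g: "g \<in> arrs L"
  shows "br1 (skew_lie2 K L) f g = A.skew_br f g"
proof -
  have "br1 (skew_lie2 K L) f g = \<iota> (O.skew_br (src L f) (src L g)) \<oplus>\<^sub>1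
     (A.skew_br (\<iota> (src L f)) (arr_part L g)
       \<oplus>\<^sub>1 \<ominus>\<^sub>1 A.skew_br (\<iota> (src L g)) (arr_part L f)
       \<oplus>\<^sub>1 A.skew_br (\<iota> (tgt L (arr_part L f))) (arr_part L g))"
    using assms by (simp add: skew_lie2_def lie2_of_data_def restrict2_def skew_data_def data_of_lie2_def
      Let_def mk_arr_def O.skew_br_def A.skew_br_def del: tgt_arr_part)
  also have "A.skew_br (\<iota> (tgt L (arr_part L f))) (arr_part L g)
      = A.skew_br (arr_part L f) (arr_part L g)"
    using f g br1_tgt_left[of "arr_part L f" "arr_part L g"] br1_tgt_right[of "arr_part L g" "arr_part L f"]
    by (simp add: A.skew_br_def del: tgt_arr_part)
  also have "\<iota> (O.skew_br (src L f) (src L g)) = A.skew_br (\<iota> (src L f)) (\<iota> (src L g))"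
    using f g by (simp add: A.skew_br_def O.skew_br_def)
  also have "A.skew_br (\<iota> (src L f)) (\<iota> (src L g)) \<oplus>\<^sub>1
     (A.skew_br (\<iota> (src L f)) (arr_part L g)
       \<oplus>\<^sub>1 \<ominus>\<^sub>1 A.skew_br (\<iota> (src L g)) (arr_part L f)
       \<oplus>\<^sub>1 A.skew_br (arr_part L f) (arr_part L g))
     = A.skew_br (\<iota> (src L f) \<oplus>\<^sub>1 arr_part L f) (\<iota> (src L g) \<oplus>\<^sub>1 arr_part L g)"
    unfolding A.skew_br_def using f g by (simp del: br1_ident)
      (rule Ar.lin_comb_unique, ((rule Ar.lin_comb_intros)+, (simp; fail)?)+,
        simp only: coeff_simps)
  finally show ?thesis using f g by (simp flip: arr_decomp)
qed

lemma src_skew_br [simp]: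
  "\<lbrakk>f \<in> arrs L; g \<in> arrs L\<rbrakk> \<Longrightarrow> src L (A.skew_br f g) = O.skew_br (src L f) (src L g)"
  and tgt_skew_br [simp]:
  "\<lbrakk>f \<in> arrs L; g \<in> arrs L\<rbrakk> \<Longrightarrow> tgt L (A.skew_br f g) = O.skew_br (tgt L f) (tgt L g)"
  and skew_br_ident [simp]:
  "\<lbrakk>x \<in> objs L; y \<in> objs L\<rbrakk> \<Longrightarrow> A.skew_br (\<iota> x) (\<iota> y) = \<iota> (O.skew_br x y)"
  by (simp_all add: A.skew_br_def O.skew_br_def)

text \<open>The bracket is functorial in either order of its arguments, and composition adds arrow
  parts; the difference of the two functorial expressions is therefore again compatible with
  composition.\<close>

lemma skew_br_cmp:
  assumes "f' \<in> arrs L" "f \<in> arrs L" "src L f' = tgt L f" "g' \<in> arrs L" "g \<in> arrs L" "src L g' = tgt L g"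
  shows "A.skew_br (f' \<bullet> f) (g' \<bullet> g) = A.skew_br f' g' \<bullet> A.skew_br f g"
proof -
  have "A.skew_br f' g' \<bullet> A.skew_br f g = A.skew_br f g \<oplus>\<^sub>1 arr_part L (A.skew_br f' g')"
    using assms by (intro cmp_eq) auto
  moreover have "[f' \<bullet> f, g' \<bullet> g]\<^sub>1 = [f, g]\<^sub>1 \<oplus>\<^sub>1 arr_part L [f', g']\<^sub>1"
    using assms by (subst br1_cmp) (auto intro!: cmp_eq)
  moreover have "[g' \<bullet> g, f' \<bullet> f]\<^sub>1 = [g, f]\<^sub>1 \<oplus>\<^sub>1 arr_part L [g', f']\<^sub>1"
    using assms by (subst br1_cmp) (auto intro!: cmp_eq)
  ultimately show ?thesis unfolding A.skew_br_def using assms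
    by simp
      (rule Ar.lin_comb_unique, ((rule Ar.lin_comb_intros)+, (simp; fail)?)+,
        simp only: coeff_simps)
qed

lemma skew_bracket:
  "bilinear_functor K (skew_lie2 K L) (skew_lie2 K L) (skew_lie2 K L) (br0 (skew_lie2 K L)) (br1 (skew_lie2 K L))"
proof -
  have "bilinear_map K (Obj L) (Obj L) (Obj L) (br0 (skew_lie2 K L))"
  proof (rule bilinear_mapI)
    show "bilinear_on K (Obj L) (Obj L) (Obj L) (br0 (skew_lie2 K L))"
      by (rule bilinear_on_cong[OF Ob.module_axioms Ob.module_axioms O.skew_br_bilinear]) (simp add: br0_skew)
  qed (auto simp: skew_lie2_def lie2_of_data_def restrict2_def)
  moreover have "bilinear_map K (Arr L) (Arr L) (Arr L) (br1 (skew_lie2 K L))"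
  proof (rule bilinear_mapI)
    show "bilinear_on K (Arr L) (Arr L) (Arr L) (br1 (skew_lie2 K L))"
      by (rule bilinear_on_cong[OF Ar.module_axioms Ar.module_axioms A.skew_br_bilinear]) (simp add: br1_skew)
  qed (auto simp: skew_lie2_def lie2_of_data_def restrict2_def)
  ultimately show ?thesis
    unfolding bilinear_functor_def by (auto simp: br0_skew br1_skew skew_br_cmp)
qed

text \<open>The components are identities, so naturality says that the two functors agree on arrows,
  which is skewness of the commutator there.\<close>

lemma skew_alternator:
  "bilinear_nat_trans K (skew_lie2 K L) (skew_lie2 K L)
    (br0 (skew_lie2 K L)) (br1 (skew_lie2 K L))
    (\<lambda>x y. \<ominus>\<^bsub>Obj L\<^esub> br0 (skew_lie2 K L) y x) (\<lambda>f g. \<ominus>\<^bsub>Arr L\<^esub> br1 (skew_lie2 K L) g f)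
    (alternator (skew_lie2 K L))"
proof -
  have "bilinear_map K (Obj L) (Obj L) (Arr L) (alternator (skew_lie2 K L))"
  proof (rule bilinear_mapI)
    have "bilinear_on K (Obj L) (Obj L) (Arr L) (\<lambda>x y. \<iota> (O.skew_br x y))"
      unfolding bilinear_on_def
      by (blast intro: linear_on_compose[OF bilinear_onD(1)[OF O.skew_br_bilinear] ident_linear_on]
        linear_on_compose[OF bilinear_onD(2)[OF O.skew_br_bilinear] ident_linear_on])
    then show "bilinear_on K (Obj L) (Obj L) (Arr L) (alternator (skew_lie2 K L))"
      by (rule bilinear_on_cong[OF Ob.module_axioms Ob.module_axioms]) (simp add: alternator_skew)
  qed (auto simp: skew_lie2_def lie2_of_data_def restrict2_def)
  moreover have "\<iota> (O.skew_br (tgt L f) (tgt L g)) \<bullet> A.skew_br f g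
    = (\<ominus>\<^sub>1 A.skew_br g f) \<bullet> \<iota> (O.skew_br (src L f) (src L g))"
    if "f \<in> arrs L" "g \<in> arrs L" for f g
    using that cmp_ident_left[of "A.skew_br f g"] cmp_ident_right[of "A.skew_br f g"]
    by (simp add: A.skew_br_skew[of f g])
  ultimately show ?thesis
    unfolding bilinear_nat_trans_def
    by (auto simp: br0_skew br1_skew alternator_skew O.skew_br_skew[symmetric])
qed

section \<open>The skew 3-bracket and the Jacobiator built from it\<close>

lemma skew3_closed [simp]:
  "\<lbrakk>x \<in> objs L; y \<in> objs L; z \<in> objs L\<rbrakk> \<Longrightarrow> skew3 x y z \<in> arrs L"
  by (simp add: skew3_def alt_sum3_def)

lemma skew3_swap:
  assumes "x \<in> objs L" "y \<in> objs L" "z \<in> objs L"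
  shows "skew3 y x z = \<ominus>\<^sub>1 skew3 x y z" "skew3 x z y = \<ominus>\<^sub>1 skew3 x y z"
  unfolding skew3_def alt_sum3_def using assms
  by - (rule Ar.lin_comb_unique, ((rule Ar.lin_comb_intros)+, (simp; fail)?)+,
    simp only: coeff_simps)+

lemma skew3_rotate:
  assumes "x \<in> objs L" "y \<in> objs L" "z \<in> objs L"
  shows "skew3 x y z = skew3 y z x"
  using assms by (simp add: skew3_swap(2)[of y x z] skew3_swap(1)[of x y z])

text \<open>The last argument suffices: rotations are even and fix \<open>skew3\<close>, so the
  other two arguments can be rotated to the last place.\<close>

lemma skew3_linear:
  assumes "x \<in> objs L" "y \<in> objs L"
  shows "linear_on K (Obj L) (Arr L) (skew3 x y)"
proof -
  have "linear_on K (Obj L) (Arr L) (\<lambda>z. skew3 x y z)"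
    unfolding skew3_def alt_sum3_def using assms
    by (intro OA.linear_on_intros trilinear_onD[OF angle3_trilinear] bilinear_onD(1)[OF angle2_bilinear]
      linear_on_compose[OF bilinear_onD(1)[OF br0_bilinear] bilinear_onD(2)[OF angle2_bilinear]]
      linear_on_compose[OF bilinear_onD(2)[OF br0_bilinear] bilinear_onD(2)[OF angle2_bilinear]]) simp_all
  then show ?thesis .
qed

lemma skew3_trilinear: "trilinear_on K (Obj L) (Obj L) (Obj L) (Arr L) skew3"
  unfolding trilinear_on_def
proof (intro conjI ballI)
  fix x y assume xy: "x \<in> objs L" "y \<in> objs L"
  show "linear_on K (Obj L) (Arr L) (\<lambda>z. skew3 x y z)"
    using skew3_linear[OF xy] .
  show "linear_on K (Obj L) (Arr L) (\<lambda>z. skew3 x z y)"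
    using linear_on_cong[OF Ob.module_axioms skew3_linear[OF xy(2,1)]] xy
    by (metis skew3_rotate)
  show "linear_on K (Obj L) (Arr L) (\<lambda>z. skew3 z x y)"
    using linear_on_cong[OF Ob.module_axioms skew3_linear[OF xy]] xy
    by (metis skew3_rotate)
qed

lemma src_skew3 [simp]:
  "\<lbrakk>x \<in> objs L; y \<in> objs L; z \<in> objs L\<rbrakk> \<Longrightarrow> src L (skew3 x y z) = \<zero>\<^bsub>Obj L\<^esub>"
  by (simp add: skew3_def alt_sum3_def)
    (rule Ob.lin_comb_unique, ((rule Ob.lin_comb_intros)+, (simp; fail)?)+,
      (simp only: coeff_simps)?)

text \<open>Taking targets turns \<langle>x, y, z\<rangle> into the Leibniz defect and
  \<langle>[x, y], z\<rangle> into [[x, y], z] + [z, [x, y]]; what results is the left side of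
  \<open>skew_jacobi\<close> for objects.\<close>

lemma tgt_skew3:
  assumes [simp]: "x \<in> objs L" "y \<in> objs L" "z \<in> objs L"
  shows "tgt L (skew3 x y z) = O.skew_br x (O.skew_br y z) \<ominus>\<^bsub>Obj L\<^esub> O.skew_br (O.skew_br x y) z
    \<ominus>\<^bsub>Obj L\<^esub> O.skew_br y (O.skew_br x z)"
  unfolding O.skew_jacobi[OF assms, symmetric]
  by (simp add: skew3_def alt_sum3_def tgt_angle2 tgt_angle3)

lemma skew3_natural:
  assumes [simp]: "f \<in> arrs L" "g \<in> arrs L" "h \<in> arrs L"
  shows "skew3 (tgt L f) (tgt L g) (tgt L h) \<ominus>\<^bsub>Arr L\<^esub> skew3 (src L f) (src L g) (src L h)
    = arr_part L (A.skew_br f (A.skew_br g h) \<ominus>\<^bsub>Arr L\<^esub> A.skew_br (A.skew_br f g) h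
        \<ominus>\<^bsub>Arr L\<^esub> A.skew_br g (A.skew_br f h))"
proof -
  \<comment> \<open>The increments are regarded as functions of arrows. The alternating sums then
    range over f, g, h, naturality can be inserted term by term, and \<open>skew_jacobi\<close>
    applies to the algebra of arrows.\<close>
  define d2 where "d2 f g = \<langle>tgt L f, tgt L g\<rangle> \<ominus>\<^bsub>Arr L\<^esub> \<langle>src L f, src L g\<rangle>" for f g
  define d3 where "d3 f g h = \<langle>tgt L f, tgt L g, tgt L h\<rangle> \<ominus>\<^bsub>Arr L\<^esub> \<langle>src L f, src L g, src L h\<rangle>" for f g h
  have "skew3 (tgt L f) (tgt L g) (tgt L h) \<ominus>\<^bsub>Arr L\<^esub> skew3 (src L f) (src L g) (src L h)
    = recip K 6 \<odot>\<^bsub>Arr L\<^esub> alt_sum3 (Arr L) d3 f g h \<ominus>\<^bsub>Arr L\<^esub>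
      recip K 12 \<odot>\<^bsub>Arr L\<^esub> alt_sum3 (Arr L) (\<lambda>f g h. d2 [f, g]\<^sub>1 h) f g h"
    unfolding skew3_def alt_sum3_def d2_def d3_def
    by simp
      (rule Ar.lin_comb_unique, ((rule Ar.lin_comb_intros)+, (simp; fail)?)+,
        simp only: coeff_simps)
  also have "alt_sum3 (Arr L) d3 f g h
      = alt_sum3 (Arr L) (\<lambda>f g h. arr_part L ([f, [g, h]\<^sub>1]\<^sub>1 \<ominus>\<^bsub>Arr L\<^esub> [[f, g]\<^sub>1, h]\<^sub>1 \<ominus>\<^bsub>Arr L\<^esub> [g, [f, h]\<^sub>1]\<^sub>1)) f g h"
    by (intro alt_sum3_cong) (auto simp only: d3_def angle3_natural assms)
  also have "alt_sum3 (Arr L) (\<lambda>f g h. d2 [f, g]\<^sub>1 h) f g h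
      = alt_sum3 (Arr L) (\<lambda>f g h. arr_part L ([[f, g]\<^sub>1, h]\<^sub>1 \<oplus>\<^sub>1 [h, [f, g]\<^sub>1]\<^sub>1)) f g h"
    by (intro alt_sum3_cong) (auto simp: d2_def angle2_natural simp del: tgt_br1 src_br1)
  finally show ?thesis
    unfolding A.skew_jacobi[OF assms, symmetric]
    by (simp add: alt_sum3_def)
qed

lemma skew_jacobiator:
  "trilinear_nat_trans K (skew_lie2 K L) (skew_lie2 K L)
    (\<lambda>x y z. br0 (skew_lie2 K L) x (br0 (skew_lie2 K L) y z))
    (\<lambda>f g h. br1 (skew_lie2 K L) f (br1 (skew_lie2 K L) g h))
    (\<lambda>x y z. br0 (skew_lie2 K L) (br0 (skew_lie2 K L) x y) z \<oplus>\<^sub>0 br0 (skew_lie2 K L) y (br0 (skew_lie2 K L) x z))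
    (\<lambda>f g h. br1 (skew_lie2 K L) (br1 (skew_lie2 K L) f g) h \<oplus>\<^sub>1 br1 (skew_lie2 K L) g (br1 (skew_lie2 K L) f h))
    (jacobiator (skew_lie2 K L))"
proof -
  have "trilinear_map K (Obj L) (Obj L) (Obj L) (Arr L) (jacobiator (skew_lie2 K L))"
  proof (rule trilinear_mapI)
    have "trilinear_on K (Obj L) (Obj L) (Obj L) (Arr L) (\<lambda>x y z. \<iota> (O.skew_br x (O.skew_br y z)) \<oplus>\<^sub>1 \<ominus>\<^sub>1 skew3 x y z)"
      (is "trilinear_on _ _ _ _ _ ?J")
      unfolding trilinear_on_def
      by (intro conjI ballI OA.linear_on_sum OA.linear_on_uminus trilinear_onD[OF skew3_trilinear]
        linear_on_compose[OF _ ident_linear_on]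
        linear_on_compose[OF bilinear_onD(1)[OF O.skew_br_bilinear] bilinear_onD(1)[OF O.skew_br_bilinear]]
        linear_on_compose[OF bilinear_onD(2)[OF O.skew_br_bilinear] bilinear_onD(1)[OF O.skew_br_bilinear]]
        bilinear_onD(2)[OF O.skew_br_bilinear]) simp_all
    then show "trilinear_on K (Obj L) (Obj L) (Obj L) (Arr L) (jacobiator (skew_lie2 K L))"
      by (rule trilinear_on_cong[OF Ob.module_axioms Ob.module_axioms Ob.module_axioms]) (simp add: jacobiator_skew)
  qed (auto simp: skew_lie2_def lie2_of_data_def restrict3_def)
  moreover have tgt: "tgt L (\<iota> (O.skew_br x (O.skew_br y z)) \<oplus>\<^sub>1 \<ominus>\<^sub>1 skew3 x y z)
      = O.skew_br (O.skew_br x y) z \<oplus>\<^sub>0 O.skew_br y (O.skew_br x z)"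
    if "x \<in> objs L" "y \<in> objs L" "z \<in> objs L" for x y z
    using that by (simp add: tgt_skew3)
      (rule Ob.lin_comb_unique, ((rule Ob.lin_comb_intros)+, (simp; fail)?)+,
        simp only: coeff_simps)
  moreover have "(\<iota> (O.skew_br (tgt L f) (O.skew_br (tgt L g) (tgt L h))) \<oplus>\<^sub>1 \<ominus>\<^sub>1 skew3 (tgt L f) (tgt L g) (tgt L h))
      \<bullet> A.skew_br f (A.skew_br g h)
    = (A.skew_br (A.skew_br f g) h \<oplus>\<^sub>1 A.skew_br g (A.skew_br f h))
      \<bullet> (\<iota> (O.skew_br (src L f) (O.skew_br (src L g) (src L h))) \<oplus>\<^sub>1 \<ominus>\<^sub>1 skew3 (src L f) (src L g) (src L h))"
    if fgh: "f \<in> arrs L" "g \<in> arrs L" "h \<in> arrs L" for f g h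
  proof (subst square_commutes_iff)
    show "arr_part L (A.skew_br f (A.skew_br g h)) \<oplus>\<^sub>1 arr_part L
        (\<iota> (O.skew_br (tgt L f) (O.skew_br (tgt L g) (tgt L h))) \<oplus>\<^sub>1 \<ominus>\<^sub>1 skew3 (tgt L f) (tgt L g) (tgt L h))
      = arr_part L (\<iota> (O.skew_br (src L f) (O.skew_br (src L g) (src L h))) \<oplus>\<^sub>1 \<ominus>\<^sub>1 skew3 (src L f) (src L g) (src L h))
        \<oplus>\<^sub>1 arr_part L (A.skew_br (A.skew_br f g) h \<oplus>\<^sub>1 A.skew_br g (A.skew_br f h))"
      using skew3_natural[OF fgh] fgh
      apply (simp add: arr_part_eq_self)
      by - (rule Ar.lin_comb_transfer[where c = "-1"], assumption,
        ((rule Ar.lin_comb_intros)+, (simp; fail)?)+, simp only: coeff_simps)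
  qed (use fgh tgt in simp_all)
  ultimately show ?thesis
    unfolding trilinear_nat_trans_def
    by (auto simp: br0_skew br1_skew jacobiator_skew)
qed

end

section \<open>The coherence law (L1) and the other laws for the skew-symmetrization\<close>

context skewable_lie_2_algebra
begin

text \<open>
  Alternated over the four arguments, the terms fall into ten classes \<open>A1, \<dots>, D3\<close>, and the claim reads
  \<open>2 A1 - 2 A2 - B1 + B2 = 2 (C1 - C2 + C3) - (D1 - D2 + D3)\<close>.  It follows from
  \<open>3 A1 - A2 + 2 C2 - 3 C3 - C1 = 0\<close> (L1), \<open>C1 + C2 = B2\<close> (L2), \<open>C2 + C3 = B1 - D2 - D3\<close> (L3) and
  \<open>2 D2 - D1 = - A1 - A2\<close> (naturality of the alternator).
\<close>

lemma skew_L1: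
  assumes [simp]: "x \<in> objs L" "y \<in> objs L" "z \<in> objs L" "w \<in> objs L"
  shows "A.skew_br (\<iota> x) (skew3 y z w) \<ominus>\<^bsub>Arr L\<^esub> A.skew_br (\<iota> y) (skew3 x z w)
      \<oplus>\<^sub>1 A.skew_br (\<iota> z) (skew3 x y w) \<ominus>\<^bsub>Arr L\<^esub> A.skew_br (\<iota> w) (skew3 x y z)
    = skew3 (O.skew_br x y) z w \<ominus>\<^bsub>Arr L\<^esub> skew3 (O.skew_br x z) y w \<oplus>\<^sub>1 skew3 (O.skew_br x w) y z
      \<oplus>\<^sub>1 skew3 (O.skew_br y z) x w \<ominus>\<^bsub>Arr L\<^esub> skew3 (O.skew_br y w) x z \<oplus>\<^sub>1 skew3 (O.skew_br z w) x y"
    (is "?lhs = ?rhs")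
proof -
  interpret X: alternation K "Arr L" "objs L" x y z w
    by unfold_locales simp_all
  define A1 where "A1 = X.alt (\<lambda>a b c d. [\<iota> a, \<langle>b, c, d\<rangle>]\<^sub>1)"
  define A2 where "A2 = X.alt (\<lambda>a b c d. [\<langle>b, c, d\<rangle>, \<iota> a]\<^sub>1)"
  define B1 where "B1 = X.alt (\<lambda>a b c d. [\<iota> a, \<langle>[b, c]\<^sub>0, d\<rangle>]\<^sub>1)"
  define B2 where "B2 = X.alt (\<lambda>a b c d. [\<langle>[b, c]\<^sub>0, d\<rangle>, \<iota> a]\<^sub>1)"
  define C1 where "C1 = X.alt (\<lambda>a b c d. \<langle>[a, b]\<^sub>0, c, d\<rangle>)"
  define C2 where "C2 = X.alt (\<lambda>a b c d. \<langle>c, [a, b]\<^sub>0, d\<rangle>)"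
  define C3 where "C3 = X.alt (\<lambda>a b c d. \<langle>c, d, [a, b]\<^sub>0\<rangle>)"
  define D1 where "D1 = X.alt (\<lambda>a b c d. \<langle>[[a, b]\<^sub>0, c]\<^sub>0, d\<rangle>)"
  define D2 where "D2 = X.alt (\<lambda>a b c d. \<langle>[c, [a, b]\<^sub>0]\<^sub>0, d\<rangle>)"
  define D3 where "D3 = X.alt (\<lambda>a b c d. \<langle>[c, d]\<^sub>0, [a, b]\<^sub>0\<rangle>)"
  note defs = A1_def A2_def B1_def B2_def C1_def C2_def C3_def D1_def D2_def D3_def
  have [simp]: "A1 \<in> arrs L" "A2 \<in> arrs L" "B1 \<in> arrs L" "B2 \<in> arrs L" "C1 \<in> arrs L" "C2 \<in> arrs L"
    "C3 \<in> arrs L" "D1 \<in> arrs L" "D2 \<in> arrs L" "D3 \<in> arrs L"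
    by (simp_all add: defs)
  \<comment> \<open>Both alternating sums in \<open>skew3\<close> are combined into one: the factor
    1/6 in front and 1/2 inside reproduce the coefficient 1/12.\<close>
  define g where "g a b c = \<langle>a, b, c\<rangle> \<ominus>\<^bsub>Arr L\<^esub> recip K 2 \<odot>\<^bsub>Arr L\<^esub> \<langle>[a, b]\<^sub>0, c\<rangle>" for a b c
  have g_closed [simp]: "g a b c \<in> arrs L" if "a \<in> objs L" "b \<in> objs L" "c \<in> objs L" for a b c
    using that by (simp add: g_def)
  have skew3_eq: "skew3 a b c = recip K 6 \<odot>\<^bsub>Arr L\<^esub> alt_sum3 (Arr L) g a b c"
    if "a \<in> objs L" "b \<in> objs L" "c \<in> objs L" for a b c
    unfolding skew3_def alt_sum3_def g_def using that by -
      (rule Ar.lin_comb_unique, ((rule Ar.lin_comb_intros)+, (simp; fail)?)+,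
        simp only: coeff_simps)

  \<comment> \<open>The inner alternating sum is kept closed as \<open>T\<close>, so that only the
    outer expansion of \<open>alt_sum4\<close> has to be compared with the left side.\<close>
  define T where "T a b c d = alt_sum3 (Arr L) (\<lambda>b c d. A.skew_br (\<iota> a) (g b c d)) b c d" for a b c d
  have T_closed [simp]: "T a b c d \<in> arrs L"
    if "a \<in> objs L" "b \<in> objs L" "c \<in> objs L" "d \<in> objs L" for a b c d
    using that by (simp add: T_def alt_sum3_def)
  have skew_br_skew3: "A.skew_br (\<iota> a) (skew3 b c d) = recip K 6 \<odot>\<^bsub>Arr L\<^esub> T a b c d"
    if "a \<in> objs L" "b \<in> objs L" "c \<in> objs L" "d \<in> objs L" for a b c d
    using that AA.linear_on_simps[OF bilinear_onD(1)[OF A.skew_br_bilinear, of "\<iota> a"]]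
    by (simp add: skew3_eq T_def alt_sum3_def)
  have "?lhs = recip K 6 \<odot>\<^bsub>Arr L\<^esub> X.alt (\<lambda>a b c d. A.skew_br (\<iota> a) (g b c d))"
    unfolding alt_sum4_def T_def[symmetric]
    by (simp add: skew_br_skew3)
      (rule Ar.lin_comb_unique, ((rule Ar.lin_comb_intros)+, (simp; fail)?)+,
        simp only: coeff_simps)
  also have "X.alt (\<lambda>a b c d. A.skew_br (\<iota> a) (g b c d)) = X.alt (\<lambda>a b c d. recip K 2 \<odot>\<^bsub>Arr L\<^esub>
      ([\<iota> a, \<langle>b, c, d\<rangle>]\<^sub>1 \<ominus>\<^bsub>Arr L\<^esub> [\<langle>b, c, d\<rangle>, \<iota> a]\<^sub>1 \<ominus>\<^bsub>Arr L\<^esub> recip K 2 \<odot>\<^bsub>Arr L\<^esub>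
        ([\<iota> a, \<langle>[b, c]\<^sub>0, d\<rangle>]\<^sub>1 \<ominus>\<^bsub>Arr L\<^esub> [\<langle>[b, c]\<^sub>0, d\<rangle>, \<iota> a]\<^sub>1)))"
    by (rule X.alt_cong, simp add: A.skew_br_def g_def)
      (rule Ar.lin_comb_unique, ((rule Ar.lin_comb_intros)+, (simp; fail)?)+,
        simp only: coeff_simps)
  also have "\<dots> = recip K 2 \<odot>\<^bsub>Arr L\<^esub> (A1 \<ominus>\<^bsub>Arr L\<^esub> A2 \<ominus>\<^bsub>Arr L\<^esub> recip K 2 \<odot>\<^bsub>Arr L\<^esub> (B1 \<ominus>\<^bsub>Arr L\<^esub> B2))"
    by (simp add: defs X.alt_recip X.alt_minus)
  finally have lhs: "?lhs = recip K 6 \<odot>\<^bsub>Arr L\<^esub> (recip K 2 \<odot>\<^bsub>Arr L\<^esub>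
      (A1 \<ominus>\<^bsub>Arr L\<^esub> A2 \<ominus>\<^bsub>Arr L\<^esub> recip K 2 \<odot>\<^bsub>Arr L\<^esub> (B1 \<ominus>\<^bsub>Arr L\<^esub> B2)))" .

  \<comment> \<open>The compound argument [a, b] can stand in three places, with signs +, -, +; the
    exchanges of a with b and of c with d are left to \<open>alt_pairs\<close>. The coefficient 1/12
    is 1/6 from \<open>skew3\<close> times 1/2 from the commutator.\<close>
  define f where "f a b c d = recip K 12 \<odot>\<^bsub>Arr L\<^esub> (\<langle>[a, b]\<^sub>0, c, d\<rangle> \<ominus>\<^bsub>Arr L\<^esub> \<langle>c, [a, b]\<^sub>0, d\<rangle> \<oplus>\<^sub>1 \<langle>c, d, [a, b]\<^sub>0\<rangle>
    \<ominus>\<^bsub>Arr L\<^esub> recip K 2 \<odot>\<^bsub>Arr L\<^esub> (\<langle>[[a, b]\<^sub>0, c]\<^sub>0, d\<rangle> \<ominus>\<^bsub>Arr L\<^esub> \<langle>[c, [a, b]\<^sub>0]\<^sub>0, d\<rangle> \<oplus>\<^sub>1 \<langle>[c, d]\<^sub>0, [a, b]\<^sub>0\<rangle>))"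
    for a b c d
  have "?rhs = X.alt f"
  proof (rule X.alt_pairs)
    show "X.closed4 f" by (simp add: f_def)
    show "skew3 (O.skew_br a b) c d
        = f a b c d \<ominus>\<^bsub>Arr L\<^esub> f b a c d \<ominus>\<^bsub>Arr L\<^esub> f a b d c \<oplus>\<^sub>1 f b a d c"
      if "a \<in> objs L" "b \<in> objs L" "c \<in> objs L" "d \<in> objs L" for a b c d
      using that unfolding skew3_def alt_sum3_def f_def O.skew_br_def by simp
        (rule Ar.lin_comb_unique, ((rule Ar.lin_comb_intros)+, (simp; fail)?)+,
          simp only: coeff_simps)
  qed
  also have "\<dots> = recip K 12 \<odot>\<^bsub>Arr L\<^esub> (C1 \<ominus>\<^bsub>Arr L\<^esub> C2 \<oplus>\<^sub>1 C3
      \<ominus>\<^bsub>Arr L\<^esub> recip K 2 \<odot>\<^bsub>Arr L\<^esub> (D1 \<ominus>\<^bsub>Arr L\<^esub> D2 \<oplus>\<^sub>1 D3))"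
    by (simp add: f_def[abs_def] defs X.alt_recip X.alt_minus X.alt_add)
  finally have rhs: "?rhs = recip K 12 \<odot>\<^bsub>Arr L\<^esub> (C1 \<ominus>\<^bsub>Arr L\<^esub> C2 \<oplus>\<^sub>1 C3
      \<ominus>\<^bsub>Arr L\<^esub> recip K 2 \<odot>\<^bsub>Arr L\<^esub> (D1 \<ominus>\<^bsub>Arr L\<^esub> D2 \<oplus>\<^sub>1 D3))" .

  \<comment> \<open>Every term of the laws used below is a relabelling of one of the ten
    representatives, so its alternating sum is that representative up to the sign of the
    relabelling.\<close>
  have perm1: "X.alt (\<lambda>a b c d. [\<langle>a, b, c\<rangle>, \<iota> d]\<^sub>1) = \<ominus>\<^sub>1 A2"
    unfolding A2_def by (rule X.alt_permute(3)) simp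
  have perm2: "X.alt (\<lambda>a b c d. [\<iota> c, \<langle>a, b, d\<rangle>]\<^sub>1) = A1"
    unfolding A1_def by (rule X.alt_permute(5)) simp
  have perm3: "X.alt (\<lambda>a b c d. \<langle>a, [b, c]\<^sub>0, d\<rangle>) = C2"
    unfolding C2_def by (rule X.alt_permute(6)) simp
  have perm4: "X.alt (\<lambda>a b c d. \<langle>a, c, [b, d]\<^sub>0\<rangle>) = \<ominus>\<^sub>1 C3"
    unfolding C3_def by (rule X.alt_permute(4)) simp
  have perm5: "X.alt (\<lambda>a b c d. \<langle>b, [a, c]\<^sub>0, d\<rangle>) = \<ominus>\<^sub>1 C2"
    unfolding C2_def by (rule X.alt_permute(2)) simp
  have perm6: "X.alt (\<lambda>a b c d. \<langle>b, c, [a, d]\<^sub>0\<rangle>) = C3"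
    unfolding C3_def by (rule X.alt_permute(7)) simp
  have perm7: "X.alt (\<lambda>a b c d. [\<iota> b, \<langle>a, c, d\<rangle>]\<^sub>1) = \<ominus>\<^sub>1 A1"
    unfolding A1_def by (rule X.alt_permute(1)) simp
  have perm8: "X.alt (\<lambda>a b c d. \<langle>a, b, [c, d]\<^sub>0\<rangle>) = C3"
    unfolding C3_def by (rule X.alt_permute(8)) simp
  have perm9: "X.alt (\<lambda>a b c d. [\<langle>[a, b]\<^sub>0, c\<rangle>, \<iota> d]\<^sub>1) = \<ominus>\<^sub>1 B2"
    unfolding B2_def by (rule X.alt_permute(3)) simp
  have perm10: "X.alt (\<lambda>a b c d. [\<iota> c, \<langle>[a, b]\<^sub>0, d\<rangle>]\<^sub>1) = B1"
    unfolding B1_def by (rule X.alt_permute(5)) simp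
  have perm11: "X.alt (\<lambda>a b c d. \<langle>[a, b]\<^sub>0, [c, d]\<^sub>0\<rangle>) = D3"
    unfolding D3_def by (rule X.alt_permute(8)) simp
  have perm12: "X.alt (\<lambda>a b c d. \<langle>[b, [a, c]\<^sub>0]\<^sub>0, d\<rangle>) = \<ominus>\<^sub>1 D2"
    unfolding D2_def by (rule X.alt_permute(2)) simp
  have perm13: "X.alt (\<lambda>a b c d. \<langle>[a, [b, c]\<^sub>0]\<^sub>0, d\<rangle>) = D2"
    unfolding D2_def by (rule X.alt_permute(6)) simp
  have perm14: "X.alt (\<lambda>a b c d. [\<iota> d, \<langle>a, b, c\<rangle>]\<^sub>1) = \<ominus>\<^sub>1 A1"
    unfolding A1_def by (rule X.alt_permute(3)) simp
  note perms = perm1 perm2 perm3 perm4 perm5 perm6 perm7 perm8 perm9 perm10 perm11 perm12 perm13 perm14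
    defs[symmetric]

  have "X.alt (\<lambda>x y z w. [\<langle>x, y, z\<rangle>, \<iota> w]\<^sub>1 \<oplus>\<^sub>1 [\<iota> z, \<langle>x, y, w\<rangle>]\<^sub>1 \<oplus>\<^sub>1 \<langle>x, [y, z]\<^sub>0, w\<rangle> \<oplus>\<^sub>1 \<langle>x, z, [y, w]\<^sub>0\<rangle>
        \<oplus>\<^sub>1 [\<iota> x, \<langle>y, z, w\<rangle>]\<^sub>1)
      = X.alt (\<lambda>x y z w. \<langle>y, [x, z]\<^sub>0, w\<rangle> \<oplus>\<^sub>1 \<langle>y, z, [x, w]\<^sub>0\<rangle> \<oplus>\<^sub>1 \<langle>[x, y]\<^sub>0, z, w\<rangle> \<oplus>\<^sub>1 [\<iota> y, \<langle>x, z, w\<rangle>]\<^sub>1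
        \<oplus>\<^sub>1 \<langle>x, y, [z, w]\<^sub>0\<rangle>)"
    by (rule X.alt_cong) (rule angle3_L1)
  then have "\<ominus>\<^sub>1 A2 \<oplus>\<^sub>1 A1 \<oplus>\<^sub>1 C2 \<oplus>\<^sub>1 \<ominus>\<^sub>1 C3 \<oplus>\<^sub>1 A1 = \<ominus>\<^sub>1 C2 \<oplus>\<^sub>1 C3 \<oplus>\<^sub>1 C1 \<oplus>\<^sub>1 \<ominus>\<^sub>1 A1 \<oplus>\<^sub>1 C3"
    by (simp add: X.alt_add perms)
  then have A2: "A2 = A1 \<oplus>\<^sub>1 A1 \<oplus>\<^sub>1 A1 \<oplus>\<^sub>1 C2 \<oplus>\<^sub>1 C2 \<ominus>\<^bsub>Arr L\<^esub> C3 \<ominus>\<^bsub>Arr L\<^esub> C3 \<ominus>\<^bsub>Arr L\<^esub> C3 \<ominus>\<^bsub>Arr L\<^esub> C1"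
    by - (rule Ar.lin_comb_transfer[where c = "-1"], assumption,
      ((rule Ar.lin_comb_intros)+, (simp; fail)?)+, simp only: coeff_simps)
  \<comment> \<open>The laws (L2) and (L3) have three arguments; a fourth is created by substituting
    a bracket, here in the triple [a, b], c, d and for (L3) in the triple c, [a, b], d.\<close>
  have "X.alt (\<lambda>a b c d. \<langle>[a, b]\<^sub>0, c, d\<rangle> \<oplus>\<^sub>1 \<langle>c, [a, b]\<^sub>0, d\<rangle>) = X.alt (\<lambda>a b c d. \<ominus>\<^sub>1 [\<langle>[a, b]\<^sub>0, c\<rangle>, \<iota> d]\<^sub>1)"
    by (rule X.alt_cong) (rule angle3_L2; simp)
  then have B2: "B2 = C1 \<oplus>\<^sub>1 C2"
    by (simp add: X.alt_add X.alt_neg perms)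
  have "X.alt (\<lambda>a b c d. \<langle>c, [a, b]\<^sub>0, d\<rangle> \<oplus>\<^sub>1 \<langle>c, d, [a, b]\<^sub>0\<rangle>)
      = X.alt (\<lambda>a b c d. [\<iota> c, \<langle>[a, b]\<^sub>0, d\<rangle>]\<^sub>1 \<ominus>\<^bsub>Arr L\<^esub> \<langle>[c, [a, b]\<^sub>0]\<^sub>0, d\<rangle> \<ominus>\<^bsub>Arr L\<^esub> \<langle>[a, b]\<^sub>0, [c, d]\<^sub>0\<rangle>)"
    by (rule X.alt_cong) (rule angle3_L3; simp)
  then have "C2 \<oplus>\<^sub>1 C3 = B1 \<ominus>\<^bsub>Arr L\<^esub> D2 \<ominus>\<^bsub>Arr L\<^esub> D3"
    by (simp add: X.alt_add X.alt_minus perms)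
  then have B1: "B1 = C2 \<oplus>\<^sub>1 C3 \<oplus>\<^sub>1 D2 \<oplus>\<^sub>1 D3"
    by - (rule Ar.lin_comb_transfer[where c = "-1"], assumption,
      ((rule Ar.lin_comb_intros)+, (simp; fail)?)+, simp only: coeff_simps)
  have "X.alt (\<lambda>a b c d. \<langle>[[a, b]\<^sub>0, c]\<^sub>0, d\<rangle> \<oplus>\<^sub>1 \<langle>[b, [a, c]\<^sub>0]\<^sub>0, d\<rangle> \<ominus>\<^bsub>Arr L\<^esub> \<langle>[a, [b, c]\<^sub>0]\<^sub>0, d\<rangle>)
      = X.alt (\<lambda>a b c d. \<ominus>\<^sub>1 [\<langle>a, b, c\<rangle>, \<iota> d]\<^sub>1 \<oplus>\<^sub>1 \<ominus>\<^sub>1 [\<iota> d, \<langle>a, b, c\<rangle>]\<^sub>1)"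
  proof (rule X.alt_cong)
    fix a b c d assume "a \<in> objs L" "b \<in> objs L" "c \<in> objs L" "d \<in> objs L"
    then show "\<langle>[[a, b]\<^sub>0, c]\<^sub>0, d\<rangle> \<oplus>\<^sub>1 \<langle>[b, [a, c]\<^sub>0]\<^sub>0, d\<rangle> \<ominus>\<^bsub>Arr L\<^esub> \<langle>[a, [b, c]\<^sub>0]\<^sub>0, d\<rangle>
        = \<ominus>\<^sub>1 [\<langle>a, b, c\<rangle>, \<iota> d]\<^sub>1 \<oplus>\<^sub>1 \<ominus>\<^sub>1 [\<iota> d, \<langle>a, b, c\<rangle>]\<^sub>1"
      \<comment> \<open>The arrow \<open>\<J> a b c\<close> leads from [a, [b, c]] to [[a, b], c] +
        [b, [a, c]], so naturality along it relates the terms with doubly nested brackets to the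
        brackets of \<langle>a, b, c\<rangle> with d.\<close>
      using angle2_natural[of "\<J> a b c" "\<iota> d"] by simp
  qed
  then have "D1 \<oplus>\<^sub>1 \<ominus>\<^sub>1 D2 \<ominus>\<^bsub>Arr L\<^esub> D2 = A2 \<oplus>\<^sub>1 A1"
    by (simp add: X.alt_add X.alt_minus X.alt_neg perms)
  then have D1: "D1 = A2 \<oplus>\<^sub>1 A1 \<oplus>\<^sub>1 D2 \<oplus>\<^sub>1 D2"
    by - (rule Ar.lin_comb_transfer[where c = "1"], assumption,
      ((rule Ar.lin_comb_intros)+, (simp; fail)?)+, simp only: coeff_simps)
  \<comment> \<open>The four relations eliminate \<open>A2\<close>, \<open>B1\<close>,
    \<open>B2\<close> and \<open>D1\<close>. Both sides become 1/24 of -4 A1 + 3 C1 - 4 C2 + 5 C3 -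
    D2 - D3.\<close>
  show ?thesis unfolding lhs rhs B1 B2 D1 A2 by
    (rule Ar.lin_comb_unique, ((rule Ar.lin_comb_intros)+, (simp; fail)?)+,
      simp only: coeff_simps)
qed

lemma angle2_skew:
  "\<lbrakk>x \<in> objs L; y \<in> objs L\<rbrakk> \<Longrightarrow> \<langle>x, y\<rangle>\<^bsub>skew_lie2 K L\<^esub> = \<zero>\<^bsub>Arr L\<^esub>"
  by (simp add: angle2_def alternator_skew)

lemma angle3_skew:
  "\<lbrakk>x \<in> objs L; y \<in> objs L; z \<in> objs L\<rbrakk> \<Longrightarrow> \<langle>x, y, z\<rangle>\<^bsub>skew_lie2 K L\<^esub> = skew3 x y z"
  by (simp add: angle3_def jacobiator_skew arr_part_eq_self)

text \<open>The new \<langle>x, y\<rangle> is zero, so (L2) and (L3) reduce to the skewness of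
  \<open>skew3\<close> in neighbouring arguments and (L4) is trivial. Only (L1) has content; it is
  \<open>skew_L1\<close> after rearranging arguments.\<close>

theorem lie_2_algebra_skew: "lie_2_algebra K (skew_lie2 K L)"
proof -
  interpret S: pre_lie_2_algebra K "skew_lie2 K L"
  proof (intro pre_lie_2_algebra.intro pre_lie_2_algebra_axioms.intro)
    show "linear_category K (skew_lie2 K L)" by (rule linear_category_cong) simp_all
  qed (use skew_bracket skew_alternator skew_jacobiator in simp_all)
  note skew = angle2_skew angle3_skew br0_skew br1_skew
  have L1: "A.skew_br (skew3 x y z) (\<iota> w) \<oplus>\<^sub>1 A.skew_br (\<iota> z) (skew3 x y w)
      \<oplus>\<^sub>1 skew3 x (O.skew_br y z) w \<oplus>\<^sub>1 skew3 x z (O.skew_br y w) \<oplus>\<^sub>1 A.skew_br (\<iota> x) (skew3 y z w)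
    = skew3 y (O.skew_br x z) w \<oplus>\<^sub>1 skew3 y z (O.skew_br x w) \<oplus>\<^sub>1 skew3 (O.skew_br x y) z w
      \<oplus>\<^sub>1 A.skew_br (\<iota> y) (skew3 x z w) \<oplus>\<^sub>1 skew3 x y (O.skew_br z w)"
    if [simp]: "x \<in> objs L" "y \<in> objs L" "z \<in> objs L" "w \<in> objs L" for x y z w
    using skew_L1[OF that]
    \<comment> \<open>Skewness and rotation bring the terms of \<open>skew_L1\<close> and those of
      (L1) to common representatives, after which the two equations coincide up to the order of
      terms.\<close>
    unfolding A.skew_br_skew[of "\<iota> w" "skew3 x y z", simplified]
      skew3_swap(1)[of "O.skew_br y z" x w, simplified] skew3_swap(1)[of "O.skew_br x z" y w, simplified]
      skew3_rotate[of "O.skew_br y w" x z, simplified] skew3_rotate[of "O.skew_br x w" y z, simplified]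
      skew3_rotate[of "O.skew_br z w" x y, simplified]
      skew3_swap(2)[of x "O.skew_br y w" z, simplified]
    by - (rule Ar.lin_comb_transfer[where c = "1"], assumption,
      ((rule Ar.lin_comb_intros)+, (simp; fail)?)+, (simp only: coeff_simps)?)
  have L2: "skew3 x y z \<oplus>\<^sub>1 skew3 y x z = \<zero>\<^bsub>Arr L\<^esub>" and L3: "skew3 x y z \<oplus>\<^sub>1 skew3 x z y = \<zero>\<^bsub>Arr L\<^esub>"
    if "x \<in> objs L" "y \<in> objs L" "z \<in> objs L" for x y z
    using that by (simp_all add: skew3_swap(1)[of x y z] skew3_swap(2)[of x y z] Ar.M.r_neg)
  have "\<zero>\<^bsub>Arr L\<^esub> \<ominus>\<^bsub>Arr L\<^esub> \<zero>\<^bsub>Arr L\<^esub> = \<zero>\<^bsub>Arr L\<^esub>"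
    and "\<ominus>\<^sub>1 \<zero>\<^bsub>Arr L\<^esub> = \<zero>\<^bsub>Arr L\<^esub>"
    by (simp_all add: a_minus_def Ar.M.minus_equality)
  note zero = this AA.linear_on_zero[OF bilinear_onD(1)[OF A.skew_br_bilinear]]
    AA.linear_on_zero[OF bilinear_onD(2)[OF A.skew_br_bilinear]]
  show ?thesis
  proof (intro lie_2_algebra.intro lie_2_algebra_axioms.intro)
  qed (fact S.linear_category_axioms S.bracket S.alternator S.jacobiator
    | rule S.L1_iff[THEN iffD2] S.L2_iff[THEN iffD2] S.L3_iff[THEN iffD2] S.L4_iff[THEN iffD2]; simp add: skew L1 L2 L3 zero)+
qed

end

section \<open>Semistrict algebras are fixed\<close>

context skewable_lie_2_algebra
begin

lemma semistrict_skew: "semistrict (skew_lie2 K L)"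
  by (simp add: semistrict_def alternator_skew br0_skew)

text \<open>If \<langle>x, y\<rangle> vanishes, the bracket is skew on objects by the target of the
  alternator and on arrows by its naturality, so half the commutator is the bracket. The 3-bracket
  is skew as well, so its normalized alternating sum returns it and the correction is zero.\<close>

lemma skew_semistrict:
  assumes "semistrict L"
  shows "skew_lie2 K L = L"
proof -
  have S: "\<S> x y = \<iota> [x, y]\<^sub>0" if "x \<in> objs L" "y \<in> objs L" for x y
    using assms that by (simp add: semistrict_def)
  have neg_zero: "\<ominus>\<^sub>1 \<zero>\<^bsub>Arr L\<^esub> = \<zero>\<^bsub>Arr L\<^esub>" by (simp add: Ar.M.minus_equality)
  have angle2_zero: "\<langle>x, y\<rangle> = \<zero>\<^bsub>Arr L\<^esub>" if "x \<in> objs L" "y \<in> objs L" for x y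
    unfolding angle2_def S[OF that] using that neg_zero by simp
  have br0_sum: "[x, y]\<^sub>0 \<oplus>\<^sub>0 [y, x]\<^sub>0 = \<zero>\<^bsub>Obj L\<^esub>" if "x \<in> objs L" "y \<in> objs L" for x y
    using tgt_angle2[OF that] angle2_zero[OF that] by simp
  \<comment> \<open>Arrow part and source are treated separately: the arrow part vanishes by
    naturality of the alternator, the source by skewness on objects.\<close>
  have br1_sum: "[f, g]\<^sub>1 \<oplus>\<^sub>1 [g, f]\<^sub>1 = \<zero>\<^bsub>Arr L\<^esub>" if fg: "f \<in> arrs L" "g \<in> arrs L" for f g
  proof -
    have "arr_part L ([f, g]\<^sub>1 \<oplus>\<^sub>1 [g, f]\<^sub>1) = \<zero>\<^bsub>Arr L\<^esub>"
      using angle2_natural[OF fg] fg by (simp add: angle2_zero a_minus_def neg_zero)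
    then show ?thesis
      using fg arr_eq_iff[of "[f, g]\<^sub>1 \<oplus>\<^sub>1 [g, f]\<^sub>1" "\<zero>\<^bsub>Arr L\<^esub>"] by (simp add: br0_sum)
  qed
  have br0: "O.skew_br x y = [x, y]\<^sub>0" if xy: "x \<in> objs L" "y \<in> objs L" for x y
  proof -
    from br0_sum[OF xy] xy have neg: "[y, x]\<^sub>0 = \<ominus>\<^sub>0 [x, y]\<^sub>0"
      by - (rule Ob.lin_comb_transfer[where c = "1"], assumption,
        ((rule Ob.lin_comb_intros)+, (simp; fail)?)+, (simp only: coeff_simps)?)
    show ?thesis unfolding O.skew_br_def neg using xy by -
      (rule Ob.lin_comb_unique, ((rule Ob.lin_comb_intros)+, (simp; fail)?)+,
        (simp only: coeff_simps)?)
  qed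
  have br1: "A.skew_br f g = [f, g]\<^sub>1" if fg: "f \<in> arrs L" "g \<in> arrs L" for f g
  proof -
    from br1_sum[OF fg] fg have neg: "[g, f]\<^sub>1 = \<ominus>\<^sub>1 [f, g]\<^sub>1"
      by - (rule Ar.lin_comb_transfer[where c = "1"], assumption,
        ((rule Ar.lin_comb_intros)+, (simp; fail)?)+, (simp only: coeff_simps)?)
    show ?thesis unfolding A.skew_br_def neg using fg by -
      (rule Ar.lin_comb_unique, ((rule Ar.lin_comb_intros)+, (simp; fail)?)+,
        (simp only: coeff_simps)?)
  qed
  have angle3: "skew3 x y z = \<langle>x, y, z\<rangle>" if xyz: "x \<in> objs L" "y \<in> objs L" "z \<in> objs L" for x y z
  proof -
    \<comment> \<open>Without \<langle>x, y\<rangle> the law (L2) is skewness in the first two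
      arguments and (L3) in the last two; these transpositions generate all permutations.\<close>
    have swap: "\<langle>b, a, c\<rangle> = \<ominus>\<^sub>1 \<langle>a, b, c\<rangle>" "\<langle>a, c, b\<rangle> = \<ominus>\<^sub>1 \<langle>a, b, c\<rangle>"
      if abc: "a \<in> objs L" "b \<in> objs L" "c \<in> objs L" for a b c
    proof -
      have "\<langle>a, b, c\<rangle> \<oplus>\<^sub>1 \<langle>b, a, c\<rangle> = \<zero>\<^bsub>Arr L\<^esub>"
        using angle3_L2[OF abc] abc by (simp add: angle2_zero neg_zero)
      from this abc show "\<langle>b, a, c\<rangle> = \<ominus>\<^sub>1 \<langle>a, b, c\<rangle>"
        by - (rule Ar.lin_comb_transfer[where c = "1"], assumption,
          ((rule Ar.lin_comb_intros)+, (simp; fail)?)+, (simp only: coeff_simps)?)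
      have "\<langle>a, b, c\<rangle> \<oplus>\<^sub>1 \<langle>a, c, b\<rangle> = \<zero>\<^bsub>Arr L\<^esub>"
        using angle3_L3[OF abc] abc by (simp add: angle2_zero neg_zero a_minus_def)
      from this abc show "\<langle>a, c, b\<rangle> = \<ominus>\<^sub>1 \<langle>a, b, c\<rangle>"
        by - (rule Ar.lin_comb_transfer[where c = "1"], assumption,
          ((rule Ar.lin_comb_intros)+, (simp; fail)?)+, (simp only: coeff_simps)?)
    qed
    have perms: "\<langle>y, x, z\<rangle> = \<ominus>\<^sub>1 \<langle>x, y, z\<rangle>" "\<langle>x, z, y\<rangle> = \<ominus>\<^sub>1 \<langle>x, y, z\<rangle>" "\<langle>y, z, x\<rangle> = \<langle>x, y, z\<rangle>"
      "\<langle>z, x, y\<rangle> = \<langle>x, y, z\<rangle>" "\<langle>z, y, x\<rangle> = \<ominus>\<^sub>1 \<langle>x, y, z\<rangle>"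
      using xyz by (simp_all add: swap(1)[of x y z] swap(2)[of x y z] swap(2)[of y x z] swap(1)[of x z y]
        swap(1)[of y z x])
    show ?thesis
      unfolding skew3_def alt_sum3_def perms using xyz
      by (simp add: angle2_zero)
        (rule Ar.lin_comb_unique, ((rule Ar.lin_comb_intros)+, (simp; fail)?)+,
          (simp only: coeff_simps)?)
  qed
  have jac: "\<J> x y z = \<iota> [x, [y, z]\<^sub>0]\<^sub>0 \<oplus>\<^sub>1 \<ominus>\<^sub>1 \<langle>x, y, z\<rangle>" if "x \<in> objs L" "y \<in> objs L" "z \<in> objs L" for x y z
    using arr_decomp[of "\<J> x y z"] that by simp
  have "br0 (skew_lie2 K L) = br0 L"
    using skew_bracket bracket by (auto simp: bilinear_functor_def br0_skew br0 intro: bilinear_map_eqI)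
  moreover have "br1 (skew_lie2 K L) = br1 L"
    using skew_bracket bracket by (auto simp: bilinear_functor_def br1_skew br1 intro: bilinear_map_eqI)
  moreover have "alternator (skew_lie2 K L) = alternator L"
    using skew_alternator alternator
    by (auto simp: bilinear_nat_trans_def alternator_skew br0 S intro: bilinear_map_eqI)
  moreover have "jacobiator (skew_lie2 K L) = jacobiator L"
    using skew_jacobiator jacobiator
    by (auto simp: trilinear_nat_trans_def jacobiator_skew br0 angle3 jac intro: trilinear_map_eqI)
  ultimately show ?thesis by (intro lie2.equality) simp_all
qed

end

section \<open>Morphisms\<close>

text \<open>The two coherence conditions are left out, so that their linear forms can be applied to
  skew parts, identities and composites before these are known to be morphisms.\<close>

locale pre_lie_2_morphism = L: lie_2_algebra K L + L': lie_2_algebra K L'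
  for K and L :: "('k, 'o, 'a) lie2" (structure) and L' :: "('k, 'o, 'a) lie2" (structure) +
  fixes F\<^sub>0 :: "'o \<Rightarrow> 'o" and F\<^sub>1 :: "'a \<Rightarrow> 'a" and F2 :: "'o \<Rightarrow> 'o \<Rightarrow> 'a"
  assumes linear_functor: "linear_functor K L L' F\<^sub>0 F\<^sub>1"
    and nat_trans: "bilinear_nat_trans K L L'
      (\<lambda>x y. [F\<^sub>0 x, F\<^sub>0 y]\<^sub>0\<^bsub>L'\<^esub>) (\<lambda>f g. [F\<^sub>1 f, F\<^sub>1 g]\<^sub>1\<^bsub>L'\<^esub>)
      (\<lambda>x y. F\<^sub>0 [x, y]\<^sub>0) (\<lambda>f g. F\<^sub>1 [f, g]\<^sub>1) F2"
begin

sublocale OO: module_pair K "Obj L" "Obj L'" ..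
sublocale OA: module_pair K "Obj L" "Arr L'" ..
sublocale AA: module_pair K "Arr L" "Arr L'" ..

lemma F0_linear_on: "linear_on K (Obj L) (Obj L') F\<^sub>0"
  and F1_linear_on: "linear_on K (Arr L) (Arr L') F\<^sub>1"
  using linear_functor by (auto simp: linear_functor_def linear_map_iff)

lemmas F0_simps [simp] = OO.linear_on_simps[OF F0_linear_on]
lemmas F1_simps [simp] = AA.linear_on_simps[OF F1_linear_on]

lemma src_F1 [simp]: "f \<in> arrs L \<Longrightarrow> src L' (F\<^sub>1 f) = F\<^sub>0 (src L f)"
  and tgt_F1 [simp]: "f \<in> arrs L \<Longrightarrow> tgt L' (F\<^sub>1 f) = F\<^sub>0 (tgt L f)"
  and F1_ident [simp]: "x \<in> objs L \<Longrightarrow> F\<^sub>1 (\<iota> x) = \<iota>\<^bsub>L'\<^esub> (F\<^sub>0 x)"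
  using linear_functor by (auto simp: linear_functor_def)

lemma F1_cmp: "\<lbrakk>g \<in> arrs L; f \<in> arrs L; src L g = tgt L f\<rbrakk> \<Longrightarrow> F\<^sub>1 (g \<bullet> f) = F\<^sub>1 g \<bullet>\<^bsub>L'\<^esub> F\<^sub>1 f"
  using linear_functor unfolding linear_functor_def by force

lemma arr_part_F1 [simp]: "f \<in> arrs L \<Longrightarrow> arr_part L' (F\<^sub>1 f) = F\<^sub>1 (arr_part L f)"
  by (simp add: arr_part_def)

lemma F2_bilinear: "bilinear_on K (Obj L) (Obj L) (Arr L') F2"
  using nat_trans by (simp add: bilinear_nat_trans_def bilinear_mapD(1))

lemmas F2_simps [simp] =
  OA.linear_on_simps[OF bilinear_onD(1)[OF F2_bilinear]]
  OA.linear_on_simps[OF bilinear_onD(2)[OF F2_bilinear]]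

lemma src_F2 [simp]: "\<lbrakk>x \<in> objs L; y \<in> objs L\<rbrakk> \<Longrightarrow> src L' (F2 x y) = [F\<^sub>0 x, F\<^sub>0 y]\<^sub>0\<^bsub>L'\<^esub>"
  and tgt_F2 [simp]: "\<lbrakk>x \<in> objs L; y \<in> objs L\<rbrakk> \<Longrightarrow> tgt L' (F2 x y) = F\<^sub>0 [x, y]\<^sub>0"
  using nat_trans by (auto simp: bilinear_nat_trans_def)

lemma F2_eqI:
  "\<lbrakk>\<And>x y. \<lbrakk>x \<in> objs L; y \<in> objs L\<rbrakk> \<Longrightarrow> G x y = F2 x y;
    \<And>x y. \<not> (x \<in> objs L \<and> y \<in> objs L) \<Longrightarrow> G x y = undefined\<rbrakk> \<Longrightarrow> G = F2"
  using nat_trans bilinear_mapD(2)[of K "Obj L" "Obj L" "Arr L'" F2]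
  unfolding bilinear_nat_trans_def by (intro ext) metis

text \<open>The second component of F2 x y = ([F x, F y], \<phi> x y). The source is prescribed, so
  the coherence conditions are conditions on \<phi> alone.\<close>

definition \<phi> :: "'o \<Rightarrow> 'o \<Rightarrow> 'a" where
  "\<phi> x y = arr_part L' (F2 x y)"

lemma \<phi>_bilinear: "bilinear_on K (Obj L) (Obj L) (Arr L') \<phi>"
  unfolding bilinear_on_def \<phi>_def
  by (blast intro: linear_on_compose[OF bilinear_onD(1)[OF F2_bilinear] L'.arr_part_linear_on]
    linear_on_compose[OF bilinear_onD(2)[OF F2_bilinear] L'.arr_part_linear_on])

lemmas \<phi>_simps [simp] =
  OA.linear_on_simps[OF bilinear_onD(1)[OF \<phi>_bilinear]]
  OA.linear_on_simps[OF bilinear_onD(2)[OF \<phi>_bilinear]]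

lemma arr_part_F2 [simp]: "\<lbrakk>x \<in> objs L; y \<in> objs L\<rbrakk> \<Longrightarrow> arr_part L' (F2 x y) = \<phi> x y"
  by (simp add: \<phi>_def)

lemma arr_part_\<phi> [simp]: "\<lbrakk>x \<in> objs L; y \<in> objs L\<rbrakk> \<Longrightarrow> arr_part L' (\<phi> x y) = \<phi> x y"
  unfolding \<phi>_def by (rule L'.arr_part_arr_part) simp

text \<open>The naturality square in arrow parts. Applied along a component of another
  \<open>F2\<close> it moves an argument from [F y, F z] to F [y, z], as composition
  requires.\<close>

lemma \<phi>_natural:
  assumes "f \<in> arrs L" "g \<in> arrs L"
  shows "\<phi> (tgt L f) (tgt L g) \<ominus>\<^bsub>Arr L'\<^esub> \<phi> (src L f) (src L g)
    = F\<^sub>1 (arr_part L [f, g]\<^sub>1) \<ominus>\<^bsub>Arr L'\<^esub> arr_part L' [F\<^sub>1 f, F\<^sub>1 g]\<^sub>1\<^bsub>L'\<^esub>"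
proof -
  have "F2 (tgt L f) (tgt L g) \<bullet>\<^bsub>L'\<^esub> [F\<^sub>1 f, F\<^sub>1 g]\<^sub>1\<^bsub>L'\<^esub> = F\<^sub>1 [f, g]\<^sub>1 \<bullet>\<^bsub>L'\<^esub> F2 (src L f) (src L g)"
    using nat_trans assms by (auto simp: bilinear_nat_trans_def)
  then have "arr_part L' [F\<^sub>1 f, F\<^sub>1 g]\<^sub>1\<^bsub>L'\<^esub> \<oplus>\<^sub>1\<^bsub>L'\<^esub> \<phi> (tgt L f) (tgt L g)
      = \<phi> (src L f) (src L g) \<oplus>\<^sub>1\<^bsub>L'\<^esub> F\<^sub>1 (arr_part L [f, g]\<^sub>1)"
    by (subst (asm) L'.square_commutes_iff) (use assms in auto)
  from this assms show ?thesis
    by - (rule L'.Ar.lin_comb_transfer[where c = "1"], assumption,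
      ((rule L'.Ar.lin_comb_intros)+, (simp; fail)?)+, (simp only: coeff_simps)?)
qed

lemma preserves_alternator_iff:
  assumes "x \<in> objs L" "y \<in> objs L"
  shows "F\<^sub>1 (\<S> x y) \<bullet>\<^bsub>L'\<^esub> F2 x y = (\<ominus>\<^sub>1\<^bsub>L'\<^esub> F2 y x) \<bullet>\<^bsub>L'\<^esub> \<S>\<^bsub>L'\<^esub> (F\<^sub>0 x) (F\<^sub>0 y)
    \<longleftrightarrow> \<phi> x y \<oplus>\<^sub>1\<^bsub>L'\<^esub> \<phi> y x = F\<^sub>1 \<langle>x, y\<rangle> \<ominus>\<^bsub>Arr L'\<^esub> \<langle>F\<^sub>0 x, F\<^sub>0 y\<rangle>\<^bsub>L'\<^esub>"
  (is "_ \<longleftrightarrow> ?l = ?r")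
proof -
  have *: "F\<^sub>1 (\<S> x y) \<bullet>\<^bsub>L'\<^esub> F2 x y = (\<ominus>\<^sub>1\<^bsub>L'\<^esub> F2 y x) \<bullet>\<^bsub>L'\<^esub> \<S>\<^bsub>L'\<^esub> (F\<^sub>0 x) (F\<^sub>0 y)
    \<longleftrightarrow> \<phi> x y \<oplus>\<^sub>1\<^bsub>L'\<^esub> \<ominus>\<^sub>1\<^bsub>L'\<^esub> F\<^sub>1 \<langle>x, y\<rangle> = \<ominus>\<^sub>1\<^bsub>L'\<^esub> \<langle>F\<^sub>0 x, F\<^sub>0 y\<rangle>\<^bsub>L'\<^esub> \<oplus>\<^sub>1\<^bsub>L'\<^esub> \<ominus>\<^sub>1\<^bsub>L'\<^esub> \<phi> y x"
    by (subst L'.square_commutes_iff) (use assms in auto)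
  show ?thesis unfolding * using assms by -
    (rule L'.Ar.lin_comb_iff, ((rule L'.Ar.lin_comb_intros)+, (simp; fail)?)+,
      (simp only: coeff_simps)?)
qed

lemma preserves_jacobiator_iff:
  assumes "x \<in> objs L" "y \<in> objs L" "z \<in> objs L"
  shows "F\<^sub>1 (\<J> x y z) \<bullet>\<^bsub>L'\<^esub> F2 x [y, z]\<^sub>0 \<bullet>\<^bsub>L'\<^esub> [\<iota>\<^bsub>L'\<^esub> (F\<^sub>0 x), F2 y z]\<^sub>1\<^bsub>L'\<^esub>
      = (F2 [x, y]\<^sub>0 z \<oplus>\<^sub>1\<^bsub>L'\<^esub> F2 y [x, z]\<^sub>0)
        \<bullet>\<^bsub>L'\<^esub> ([F2 x y, \<iota>\<^bsub>L'\<^esub> (F\<^sub>0 z)]\<^sub>1\<^bsub>L'\<^esub> \<oplus>\<^sub>1\<^bsub>L'\<^esub> [\<iota>\<^bsub>L'\<^esub> (F\<^sub>0 y), F2 x z]\<^sub>1\<^bsub>L'\<^esub>)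
        \<bullet>\<^bsub>L'\<^esub> \<J>\<^bsub>L'\<^esub> (F\<^sub>0 x) (F\<^sub>0 y) (F\<^sub>0 z)
    \<longleftrightarrow> \<phi> x [y, z]\<^sub>0 \<oplus>\<^sub>1\<^bsub>L'\<^esub> [\<iota>\<^bsub>L'\<^esub> (F\<^sub>0 x), \<phi> y z]\<^sub>1\<^bsub>L'\<^esub> \<ominus>\<^bsub>Arr L'\<^esub> \<phi> [x, y]\<^sub>0 z \<ominus>\<^bsub>Arr L'\<^esub> \<phi> y [x, z]\<^sub>0
        \<ominus>\<^bsub>Arr L'\<^esub> [\<phi> x y, \<iota>\<^bsub>L'\<^esub> (F\<^sub>0 z)]\<^sub>1\<^bsub>L'\<^esub> \<ominus>\<^bsub>Arr L'\<^esub> [\<iota>\<^bsub>L'\<^esub> (F\<^sub>0 y), \<phi> x z]\<^sub>1\<^bsub>L'\<^esub>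
      = F\<^sub>1 \<langle>x, y, z\<rangle> \<ominus>\<^bsub>Arr L'\<^esub> \<langle>F\<^sub>0 x, F\<^sub>0 y, F\<^sub>0 z\<rangle>\<^bsub>L'\<^esub>"
    (is "?f3 \<bullet>\<^bsub>L'\<^esub> ?f2 \<bullet>\<^bsub>L'\<^esub> ?f1 = ?g3 \<bullet>\<^bsub>L'\<^esub> ?g2 \<bullet>\<^bsub>L'\<^esub> ?g1 \<longleftrightarrow> ?l = ?r")
proof -
  have *: "?f3 \<bullet>\<^bsub>L'\<^esub> ?f2 \<bullet>\<^bsub>L'\<^esub> ?f1 = ?g3 \<bullet>\<^bsub>L'\<^esub> ?g2 \<bullet>\<^bsub>L'\<^esub> ?g1 \<longleftrightarrow>
      arr_part L' ?f1 \<oplus>\<^sub>1\<^bsub>L'\<^esub> arr_part L' ?f2 \<oplus>\<^sub>1\<^bsub>L'\<^esub> arr_part L' ?f3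
      = arr_part L' ?g1 \<oplus>\<^sub>1\<^bsub>L'\<^esub> arr_part L' ?g2 \<oplus>\<^sub>1\<^bsub>L'\<^esub> arr_part L' ?g3"
    using L'.arr_eq_iff[of "?f3 \<bullet>\<^bsub>L'\<^esub> ?f2 \<bullet>\<^bsub>L'\<^esub> ?f1" "?g3 \<bullet>\<^bsub>L'\<^esub> ?g2 \<bullet>\<^bsub>L'\<^esub> ?g1"] assms by simp
  show ?thesis unfolding * using assms by simp
    (rule L'.Ar.lin_comb_iff, ((rule L'.Ar.lin_comb_intros)+, (simp; fail)?)+,
      (simp only: coeff_simps)?)
qed

end

sublocale lie_2_morphism \<subseteq> pre_lie_2_morphism K L L' F\<^sub>0 F\<^sub>1 F2
  by unfold_locales (fact linear_functor nat_trans)+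

context lie_2_morphism
begin

lemma \<phi>_alternator:
  assumes "x \<in> objs L" "y \<in> objs L"
  shows "\<phi> x y \<oplus>\<^sub>1\<^bsub>L'\<^esub> \<phi> y x = F\<^sub>1 \<langle>x, y\<rangle> \<ominus>\<^bsub>Arr L'\<^esub> \<langle>F\<^sub>0 x, F\<^sub>0 y\<rangle>\<^bsub>L'\<^esub>"
  using preserves_alternator[OF assms] unfolding preserves_alternator_iff[OF assms] .

lemma \<phi>_jacobiator:
  assumes "x \<in> objs L" "y \<in> objs L" "z \<in> objs L"
  shows "\<phi> x [y, z]\<^sub>0 \<oplus>\<^sub>1\<^bsub>L'\<^esub> [\<iota>\<^bsub>L'\<^esub> (F\<^sub>0 x), \<phi> y z]\<^sub>1\<^bsub>L'\<^esub> \<ominus>\<^bsub>Arr L'\<^esub> \<phi> [x, y]\<^sub>0 z \<ominus>\<^bsub>Arr L'\<^esub> \<phi> y [x, z]\<^sub>0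
        \<ominus>\<^bsub>Arr L'\<^esub> [\<phi> x y, \<iota>\<^bsub>L'\<^esub> (F\<^sub>0 z)]\<^sub>1\<^bsub>L'\<^esub> \<ominus>\<^bsub>Arr L'\<^esub> [\<iota>\<^bsub>L'\<^esub> (F\<^sub>0 y), \<phi> x z]\<^sub>1\<^bsub>L'\<^esub>
      = F\<^sub>1 \<langle>x, y, z\<rangle> \<ominus>\<^bsub>Arr L'\<^esub> \<langle>F\<^sub>0 x, F\<^sub>0 y, F\<^sub>0 z\<rangle>\<^bsub>L'\<^esub>"
  using preserves_jacobiator[OF assms] unfolding preserves_jacobiator_iff[OF assms] .

end

section \<open>The skew part of a morphism\<close>

locale skewable_lie_2_morphism = lie_2_morphism K L L' F\<^sub>0 F\<^sub>1 F2
  for K and L :: "('k, 'o, 'a) lie2" (structure) and L' :: "('k, 'o, 'a) lie2" (structure)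
    and F\<^sub>0 F\<^sub>1 F2 +
  assumes invertible_2: "invertible_nat K 2" and invertible_3: "invertible_nat K 3"
begin

sublocale L: skewable_lie_2_algebra K L
  by unfold_locales (fact invertible_2 invertible_3)+
sublocale L': skewable_lie_2_algebra K L'
  by unfold_locales (fact invertible_2 invertible_3)+

abbreviation skew_F2 :: "'o \<Rightarrow> 'o \<Rightarrow> 'a" where
  "skew_F2 \<equiv> restrict2 (\<lambda>x y. recip K 2 \<odot>\<^bsub>Arr L'\<^esub> (F2 x y \<ominus>\<^bsub>Arr L'\<^esub> F2 y x)) (objs L) (objs L)"

lemma linear_functor_skew: "linear_functor K (skew_lie2 K L) (skew_lie2 K L') F\<^sub>0 F\<^sub>1"
  using linear_functor unfolding linear_functor_def by simp

lemma F0_skew_br [simp]: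
  "\<lbrakk>x \<in> objs L; y \<in> objs L\<rbrakk> \<Longrightarrow> F\<^sub>0 (L.O.skew_br x y)
    = recip K 2 \<odot>\<^bsub>Obj L'\<^esub> (F\<^sub>0 [x, y]\<^sub>0 \<ominus>\<^bsub>Obj L'\<^esub> F\<^sub>0 [y, x]\<^sub>0)"
  by (simp add: L.O.skew_br_def)

lemma F1_skew_br [simp]:
  "\<lbrakk>f \<in> arrs L; g \<in> arrs L\<rbrakk> \<Longrightarrow> F\<^sub>1 (L.A.skew_br f g)
    = recip K 2 \<odot>\<^bsub>Arr L'\<^esub> (F\<^sub>1 [f, g]\<^sub>1 \<ominus>\<^bsub>Arr L'\<^esub> F\<^sub>1 [g, f]\<^sub>1)"
  by (simp add: L.A.skew_br_def)

lemma nat_trans_skew: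
  "bilinear_nat_trans K (skew_lie2 K L) (skew_lie2 K L')
    (\<lambda>x y. br0 (skew_lie2 K L') (F\<^sub>0 x) (F\<^sub>0 y)) (\<lambda>f g. br1 (skew_lie2 K L') (F\<^sub>1 f) (F\<^sub>1 g))
    (\<lambda>x y. F\<^sub>0 (br0 (skew_lie2 K L) x y)) (\<lambda>f g. F\<^sub>1 (br1 (skew_lie2 K L) f g)) skew_F2"
proof -
  have "bilinear_map K (Obj L) (Obj L) (Arr L') skew_F2"
  proof (rule bilinear_map_restrict2[OF L.Ob.module_axioms L.Ob.module_axioms])
    show "bilinear_on K (Obj L) (Obj L) (Arr L') (\<lambda>x y. recip K 2 \<odot>\<^bsub>Arr L'\<^esub> (F2 x y \<ominus>\<^bsub>Arr L'\<^esub> F2 y x))"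
      unfolding bilinear_on_def
      by (auto intro!: OA.linear_on_intros bilinear_onD[OF F2_bilinear])
  qed
  moreover have "skew_F2 (tgt L f) (tgt L g) \<bullet>\<^bsub>L'\<^esub> L'.A.skew_br (F\<^sub>1 f) (F\<^sub>1 g)
      = F\<^sub>1 (L.A.skew_br f g) \<bullet>\<^bsub>L'\<^esub> skew_F2 (src L f) (src L g)"
    if fg: "f \<in> arrs L" "g \<in> arrs L" for f g
  proof -
    have "recip K 2 \<odot>\<^bsub>Arr L'\<^esub> (\<phi> (tgt L f) (tgt L g) \<ominus>\<^bsub>Arr L'\<^esub> \<phi> (src L f) (src L g))
          \<ominus>\<^bsub>Arr L'\<^esub> recip K 2 \<odot>\<^bsub>Arr L'\<^esub> (\<phi> (tgt L g) (tgt L f) \<ominus>\<^bsub>Arr L'\<^esub> \<phi> (src L g) (src L f))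
        = recip K 2 \<odot>\<^bsub>Arr L'\<^esub> (F\<^sub>1 (arr_part L [f, g]\<^sub>1) \<ominus>\<^bsub>Arr L'\<^esub> arr_part L' [F\<^sub>1 f, F\<^sub>1 g]\<^sub>1\<^bsub>L'\<^esub>)
          \<ominus>\<^bsub>Arr L'\<^esub> recip K 2 \<odot>\<^bsub>Arr L'\<^esub> (F\<^sub>1 (arr_part L [g, f]\<^sub>1) \<ominus>\<^bsub>Arr L'\<^esub> arr_part L' [F\<^sub>1 g, F\<^sub>1 f]\<^sub>1\<^bsub>L'\<^esub>)"
      unfolding \<phi>_natural[OF fg] \<phi>_natural[OF fg(2,1)] ..
    from this fg have "arr_part L' (L'.A.skew_br (F\<^sub>1 f) (F\<^sub>1 g)) \<oplus>\<^sub>1\<^bsub>L'\<^esub> arr_part L' (skew_F2 (tgt L f) (tgt L g))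
      = arr_part L' (skew_F2 (src L f) (src L g)) \<oplus>\<^sub>1\<^bsub>L'\<^esub> arr_part L' (F\<^sub>1 (L.A.skew_br f g))"
      apply (simp add: restrict2_def L'.A.skew_br_def)
      by - (rule L'.Ar.lin_comb_transfer[where c = "1"], assumption,
        ((rule L'.Ar.lin_comb_intros)+, (simp; fail)?)+, (simp only: coeff_simps)?)
    then show ?thesis
      by (subst L'.square_commutes_iff) (use fg in \<open>simp_all add: restrict2_def L'.O.skew_br_def\<close>)
  qed
  ultimately show ?thesis
    unfolding bilinear_nat_trans_def
    by (auto simp: L.br0_skew L.br1_skew L'.br0_skew L'.br1_skew)
      (auto simp: restrict2_def L'.O.skew_br_def)
qed

text \<open>The failure of F to commute with the skew 3-brackets, expressed through \<phi> alone.
  For the first sum this is the Jacobiator condition term by term; for the second the alternator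
  condition has to be combined with naturality, since F [x, y] and [F x, F y] differ.\<close>

lemma F1_skew3:
  assumes [simp]: "x \<in> objs L" "y \<in> objs L" "z \<in> objs L"
  shows "F\<^sub>1 (L.skew3 x y z) \<ominus>\<^bsub>Arr L'\<^esub> L'.skew3 (F\<^sub>0 x) (F\<^sub>0 y) (F\<^sub>0 z)
    = recip K 6 \<odot>\<^bsub>Arr L'\<^esub> alt_sum3 (Arr L') (\<lambda>x y z. \<phi> x [y, z]\<^sub>0 \<oplus>\<^sub>1\<^bsub>L'\<^esub> [\<iota>\<^bsub>L'\<^esub> (F\<^sub>0 x), \<phi> y z]\<^sub>1\<^bsub>L'\<^esub>
          \<ominus>\<^bsub>Arr L'\<^esub> \<phi> [x, y]\<^sub>0 z \<ominus>\<^bsub>Arr L'\<^esub> \<phi> y [x, z]\<^sub>0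
          \<ominus>\<^bsub>Arr L'\<^esub> [\<phi> x y, \<iota>\<^bsub>L'\<^esub> (F\<^sub>0 z)]\<^sub>1\<^bsub>L'\<^esub> \<ominus>\<^bsub>Arr L'\<^esub> [\<iota>\<^bsub>L'\<^esub> (F\<^sub>0 y), \<phi> x z]\<^sub>1\<^bsub>L'\<^esub>) x y z
      \<ominus>\<^bsub>Arr L'\<^esub> recip K 12 \<odot>\<^bsub>Arr L'\<^esub> alt_sum3 (Arr L') (\<lambda>x y z. \<phi> [x, y]\<^sub>0 z \<oplus>\<^sub>1\<^bsub>L'\<^esub> \<phi> z [x, y]\<^sub>0
          \<oplus>\<^sub>1\<^bsub>L'\<^esub> ([\<phi> x y, \<iota>\<^bsub>L'\<^esub> (F\<^sub>0 z)]\<^sub>1\<^bsub>L'\<^esub> \<oplus>\<^sub>1\<^bsub>L'\<^esub> [\<iota>\<^bsub>L'\<^esub> (F\<^sub>0 z), \<phi> x y]\<^sub>1\<^bsub>L'\<^esub>)) x y z"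
proof -
  have "F\<^sub>1 (L.skew3 x y z) \<ominus>\<^bsub>Arr L'\<^esub> L'.skew3 (F\<^sub>0 x) (F\<^sub>0 y) (F\<^sub>0 z)
    = recip K 6 \<odot>\<^bsub>Arr L'\<^esub> alt_sum3 (Arr L') (\<lambda>x y z. F\<^sub>1 \<langle>x, y, z\<rangle> \<ominus>\<^bsub>Arr L'\<^esub> \<langle>F\<^sub>0 x, F\<^sub>0 y, F\<^sub>0 z\<rangle>\<^bsub>L'\<^esub>) x y z
      \<ominus>\<^bsub>Arr L'\<^esub> recip K 12 \<odot>\<^bsub>Arr L'\<^esub> alt_sum3 (Arr L')
        (\<lambda>x y z. F\<^sub>1 \<langle>[x, y]\<^sub>0, z\<rangle> \<ominus>\<^bsub>Arr L'\<^esub> \<langle>[F\<^sub>0 x, F\<^sub>0 y]\<^sub>0\<^bsub>L'\<^esub>, F\<^sub>0 z\<rangle>\<^bsub>L'\<^esub>) x y z"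
    unfolding L.skew3_def L'.skew3_def alt_sum3_def by simp
      (rule L'.Ar.lin_comb_unique, ((rule L'.Ar.lin_comb_intros)+, (simp; fail)?)+,
        (simp only: coeff_simps)?)
  also have "alt_sum3 (Arr L') (\<lambda>x y z. F\<^sub>1 \<langle>x, y, z\<rangle> \<ominus>\<^bsub>Arr L'\<^esub> \<langle>F\<^sub>0 x, F\<^sub>0 y, F\<^sub>0 z\<rangle>\<^bsub>L'\<^esub>) x y z
    = alt_sum3 (Arr L') (\<lambda>x y z. \<phi> x [y, z]\<^sub>0 \<oplus>\<^sub>1\<^bsub>L'\<^esub> [\<iota>\<^bsub>L'\<^esub> (F\<^sub>0 x), \<phi> y z]\<^sub>1\<^bsub>L'\<^esub>
          \<ominus>\<^bsub>Arr L'\<^esub> \<phi> [x, y]\<^sub>0 z \<ominus>\<^bsub>Arr L'\<^esub> \<phi> y [x, z]\<^sub>0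
          \<ominus>\<^bsub>Arr L'\<^esub> [\<phi> x y, \<iota>\<^bsub>L'\<^esub> (F\<^sub>0 z)]\<^sub>1\<^bsub>L'\<^esub> \<ominus>\<^bsub>Arr L'\<^esub> [\<iota>\<^bsub>L'\<^esub> (F\<^sub>0 y), \<phi> x z]\<^sub>1\<^bsub>L'\<^esub>) x y z"
    by (intro alt_sum3_cong \<phi>_jacobiator[symmetric]) auto
  also have "alt_sum3 (Arr L') (\<lambda>x y z. F\<^sub>1 \<langle>[x, y]\<^sub>0, z\<rangle> \<ominus>\<^bsub>Arr L'\<^esub> \<langle>[F\<^sub>0 x, F\<^sub>0 y]\<^sub>0\<^bsub>L'\<^esub>, F\<^sub>0 z\<rangle>\<^bsub>L'\<^esub>) x y z
    = alt_sum3 (Arr L') (\<lambda>x y z. \<phi> [x, y]\<^sub>0 z \<oplus>\<^sub>1\<^bsub>L'\<^esub> \<phi> z [x, y]\<^sub>0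
          \<oplus>\<^sub>1\<^bsub>L'\<^esub> ([\<phi> x y, \<iota>\<^bsub>L'\<^esub> (F\<^sub>0 z)]\<^sub>1\<^bsub>L'\<^esub> \<oplus>\<^sub>1\<^bsub>L'\<^esub> [\<iota>\<^bsub>L'\<^esub> (F\<^sub>0 z), \<phi> x y]\<^sub>1\<^bsub>L'\<^esub>)) x y z"
  proof (rule alt_sum3_cong)
    fix a b c assume "a \<in> {x, y, z}" "b \<in> {x, y, z}" "c \<in> {x, y, z}"
    then have abc [simp]: "a \<in> objs L" "b \<in> objs L" "c \<in> objs L" by auto
    \<comment> \<open>The term \<langle>F [a, b], F c\<rangle> is inserted between the two terms
      compared. One half is the alternator condition, the other is naturality of the alternator of
      L' along \<open>F2 a b\<close>.\<close>
    have nat: "[\<phi> a b, \<iota>\<^bsub>L'\<^esub> (F\<^sub>0 c)]\<^sub>1\<^bsub>L'\<^esub> \<oplus>\<^sub>1\<^bsub>L'\<^esub> [\<iota>\<^bsub>L'\<^esub> (F\<^sub>0 c), \<phi> a b]\<^sub>1\<^bsub>L'\<^esub>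
        = \<langle>F\<^sub>0 [a, b]\<^sub>0, F\<^sub>0 c\<rangle>\<^bsub>L'\<^esub> \<ominus>\<^bsub>Arr L'\<^esub> \<langle>[F\<^sub>0 a, F\<^sub>0 b]\<^sub>0\<^bsub>L'\<^esub>, F\<^sub>0 c\<rangle>\<^bsub>L'\<^esub>"
      using L'.angle2_natural[of "F2 a b" "\<iota>\<^bsub>L'\<^esub> (F\<^sub>0 c)"] by simp
    show "F\<^sub>1 \<langle>[a, b]\<^sub>0, c\<rangle> \<ominus>\<^bsub>Arr L'\<^esub> \<langle>[F\<^sub>0 a, F\<^sub>0 b]\<^sub>0\<^bsub>L'\<^esub>, F\<^sub>0 c\<rangle>\<^bsub>L'\<^esub>
      = \<phi> [a, b]\<^sub>0 c \<oplus>\<^sub>1\<^bsub>L'\<^esub> \<phi> c [a, b]\<^sub>0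
          \<oplus>\<^sub>1\<^bsub>L'\<^esub> ([\<phi> a b, \<iota>\<^bsub>L'\<^esub> (F\<^sub>0 c)]\<^sub>1\<^bsub>L'\<^esub> \<oplus>\<^sub>1\<^bsub>L'\<^esub> [\<iota>\<^bsub>L'\<^esub> (F\<^sub>0 c), \<phi> a b]\<^sub>1\<^bsub>L'\<^esub>)"
      unfolding nat by (subst \<phi>_alternator) (simp_all,
        (rule L'.Ar.lin_comb_unique, ((rule L'.Ar.lin_comb_intros)+, (simp; fail)?)+,
          (simp only: coeff_simps)?))
  qed
  finally show ?thesis .
qed

text \<open>The identity to be checked is the first-order variation of \<open>skew_jacobi\<close>:
  x(yz) is replaced by \<phi> x [y, z] + [F x, \<phi> y z] and (xy)z by \<phi> [x, y] z +
  [\<phi> x y, F z]. Hence the coefficients 1/6 and 1/12 work for the same reason.\<close>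

lemma lie_2_morphism_skew:
  "lie_2_morphism K (skew_lie2 K L) (skew_lie2 K L') F\<^sub>0 F\<^sub>1 skew_F2"
proof -
  interpret SL: lie_2_algebra K "skew_lie2 K L" by (rule L.lie_2_algebra_skew)
  interpret SL': lie_2_algebra K "skew_lie2 K L'" by (rule L'.lie_2_algebra_skew)
  interpret S: pre_lie_2_morphism K "skew_lie2 K L" "skew_lie2 K L'" F\<^sub>0 F\<^sub>1 skew_F2
    by unfold_locales (fact linear_functor_skew nat_trans_skew)+
  have \<phi>: "S.\<phi> x y = recip K 2 \<odot>\<^bsub>Arr L'\<^esub> (\<phi> x y \<ominus>\<^bsub>Arr L'\<^esub> \<phi> y x)" if "x \<in> objs L" "y \<in> objs L" for x y
    unfolding S.\<phi>_def using that by (simp add: restrict2_def)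
  have \<phi>_closed: "S.\<phi> x y \<in> arrs L'" if "x \<in> objs L" "y \<in> objs L" for x y
    using that by (simp add: \<phi>)
  have alternator: "S.\<phi> x y \<oplus>\<^sub>1\<^bsub>L'\<^esub> S.\<phi> y x = \<zero>\<^bsub>Arr L'\<^esub> \<ominus>\<^bsub>Arr L'\<^esub> \<zero>\<^bsub>Arr L'\<^esub>"
    if "x \<in> objs L" "y \<in> objs L" for x y
    using that by (simp add: \<phi>)
      (rule L'.Ar.lin_comb_unique, ((rule L'.Ar.lin_comb_intros)+, (simp; fail)?)+,
        (simp only: coeff_simps)?)
  have jacobiator: "S.\<phi> x (L.O.skew_br y z) \<oplus>\<^sub>1\<^bsub>L'\<^esub> L'.A.skew_br (\<iota>\<^bsub>L'\<^esub> (F\<^sub>0 x)) (S.\<phi> y z)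
        \<ominus>\<^bsub>Arr L'\<^esub> S.\<phi> (L.O.skew_br x y) z \<ominus>\<^bsub>Arr L'\<^esub> S.\<phi> y (L.O.skew_br x z)
        \<ominus>\<^bsub>Arr L'\<^esub> L'.A.skew_br (S.\<phi> x y) (\<iota>\<^bsub>L'\<^esub> (F\<^sub>0 z)) \<ominus>\<^bsub>Arr L'\<^esub> L'.A.skew_br (\<iota>\<^bsub>L'\<^esub> (F\<^sub>0 y)) (S.\<phi> x z)
      = F\<^sub>1 (L.skew3 x y z) \<ominus>\<^bsub>Arr L'\<^esub> L'.skew3 (F\<^sub>0 x) (F\<^sub>0 y) (F\<^sub>0 z)"
    if [simp]: "x \<in> objs L" "y \<in> objs L" "z \<in> objs L" for x y z
    unfolding F1_skew3[OF that] alt_sum3_def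
    by (simp add: \<phi> L.O.skew_br_def L'.A.skew_br_def)
      (rule L'.Ar.lin_comb_unique, ((rule L'.Ar.lin_comb_intros)+, (simp; fail)?)+,
        (simp only: coeff_simps)?)
  show ?thesis
  proof (intro lie_2_morphism.intro lie_2_morphism_axioms.intro)
  qed (fact SL.lie_2_algebra_axioms SL'.lie_2_algebra_axioms linear_functor_skew nat_trans_skew
    | rule S.preserves_alternator_iff[THEN iffD2] S.preserves_jacobiator_iff[THEN iffD2];
      simp add: L.angle2_skew L.angle3_skew L'.angle2_skew L'.angle3_skew L.br0_skew L'.br0_skew L'.br1_skew
        \<phi>_closed alternator jacobiator)+
qed

end

section \<open>Identity morphisms and composites\<close>

lemma (in lie_2_algebra) lie_2_morphism_id:
  "lie_2_morphism K L L (\<lambda>x\<in>objs L. x) (\<lambda>f\<in>arrs L. f) (restrict2 (\<lambda>x y. \<iota> [x, y]\<^sub>0) (objs L) (objs L))"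
proof -
  have "bilinear_on K (Obj L) (Obj L) (Arr L) (\<lambda>x y. \<iota> [x, y]\<^sub>0)"
    unfolding bilinear_on_def
    by (blast intro: linear_on_compose[OF bilinear_onD(1)[OF br0_bilinear] ident_linear_on]
      linear_on_compose[OF bilinear_onD(2)[OF br0_bilinear] ident_linear_on])
  note bilin = bilinear_map_restrict2[OF Ob.module_axioms Ob.module_axioms this]
  interpret I: pre_lie_2_morphism K L L "\<lambda>x\<in>objs L. x" "\<lambda>f\<in>arrs L. f"
    "restrict2 (\<lambda>x y. \<iota> [x, y]\<^sub>0) (objs L) (objs L)"
  proof unfold_locales
    show "linear_functor K L L (\<lambda>x\<in>objs L. x) (\<lambda>f\<in>arrs L. f)"
      by (auto simp: linear_functor_def linear_map_def)
    show "bilinear_nat_trans K L L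
      (\<lambda>x y. [(\<lambda>x\<in>objs L. x) x, (\<lambda>x\<in>objs L. x) y]\<^sub>0) (\<lambda>f g. [(\<lambda>f\<in>arrs L. f) f, (\<lambda>f\<in>arrs L. f) g]\<^sub>1)
      (\<lambda>x y. (\<lambda>x\<in>objs L. x) [x, y]\<^sub>0) (\<lambda>f g. (\<lambda>f\<in>arrs L. f) [f, g]\<^sub>1)
      (restrict2 (\<lambda>x y. \<iota> [x, y]\<^sub>0) (objs L) (objs L))"
    proof -
      have "\<iota> [src L f, src L g]\<^sub>0 \<oplus>\<^sub>1 arr_part L [f, g]\<^sub>1 = [f, g]\<^sub>1" if "f \<in> arrs L" "g \<in> arrs L" for f g
        using arr_decomp[of "[f, g]\<^sub>1"] that by simp
      with bilin show ?thesis
        unfolding bilinear_nat_trans_def by (auto simp: restrict2_def cmp_eq)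
    qed
  qed
  have \<phi>: "I.\<phi> x y = \<zero>\<^bsub>Arr L\<^esub>" if "x \<in> objs L" "y \<in> objs L" for x y
    unfolding I.\<phi>_def using that by (simp add: restrict2_def)
  show ?thesis
  proof (intro lie_2_morphism.intro lie_2_morphism_axioms.intro)
  qed (fact lie_2_algebra_axioms I.linear_functor I.nat_trans
    | rule I.preserves_alternator_iff[THEN iffD2] I.preserves_jacobiator_iff[THEN iffD2];
      simp add: \<phi> a_minus_def Ar.M.minus_equality Ar.M.r_neg)+
qed

text \<open>In components the composite has \<phi> x y equal to \<phi> of G at (F x, F y) plus G
  applied to \<phi> of F at (x, y). Each condition is thus G of the condition for F plus the
  condition for G at the images under F.\<close>

lemma lie_2_morphism_compose:
  fixes L L' L'' :: "('k, 'o, 'a) lie2"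
  assumes F: "lie_2_morphism K L L' F\<^sub>0 F\<^sub>1 F2" and G: "lie_2_morphism K L' L'' G\<^sub>0 G\<^sub>1 G2"
  shows "lie_2_morphism K L L'' (compose (objs L) G\<^sub>0 F\<^sub>0) (compose (arrs L) G\<^sub>1 F\<^sub>1)
    (restrict2 (\<lambda>x y. G\<^sub>1 (F2 x y) \<bullet>\<^bsub>L''\<^esub> G2 (F\<^sub>0 x) (F\<^sub>0 y)) (objs L) (objs L))"
    (is "lie_2_morphism K L L'' ?F\<^sub>0 ?F\<^sub>1 ?F2")
proof -
  interpret F: lie_2_morphism K L L' F\<^sub>0 F\<^sub>1 F2 by fact
  interpret G: lie_2_morphism K L' L'' G\<^sub>0 G\<^sub>1 G2 by fact
  interpret LL'': module_pair K "Obj L" "Arr L''" ..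
  note [simp] = compose_eq
  have F2: "?F2 x y = G2 (F\<^sub>0 x) (F\<^sub>0 y) \<oplus>\<^bsub>Arr L''\<^esub> G\<^sub>1 (F.\<phi> x y)" if "x \<in> objs L" "y \<in> objs L" for x y
    using that by (simp add: restrict2_def G.L'.cmp_eq)
  have "bilinear_on K (Obj L) (Obj L) (Arr L'') (\<lambda>x y. G2 (F\<^sub>0 x) (F\<^sub>0 y) \<oplus>\<^bsub>Arr L''\<^esub> G\<^sub>1 (F.\<phi> x y))"
    unfolding bilinear_on_def
    by (intro conjI ballI LL''.linear_on_sum
      linear_on_compose[OF F.F0_linear_on bilinear_onD(1)[OF G.F2_bilinear]]
      linear_on_compose[OF F.F0_linear_on bilinear_onD(2)[OF G.F2_bilinear]]
      linear_on_compose[OF bilinear_onD(1)[OF F.\<phi>_bilinear] G.F1_linear_on]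
      linear_on_compose[OF bilinear_onD(2)[OF F.\<phi>_bilinear] G.F1_linear_on]) simp_all
  then have "bilinear_on K (Obj L) (Obj L) (Arr L'') ?F2"
    by (rule bilinear_on_cong[OF F.L.Ob.module_axioms F.L.Ob.module_axioms]) (simp add: F2)
  then have bilin: "bilinear_map K (Obj L) (Obj L) (Arr L'') ?F2"
    by (rule bilinear_mapI) (auto simp: restrict2_def)
  interpret C: pre_lie_2_morphism K L L'' ?F\<^sub>0 ?F\<^sub>1 ?F2
  proof unfold_locales
    show "linear_functor K L L'' ?F\<^sub>0 ?F\<^sub>1"
      using F.linear_functor G.linear_functor
        linear_map_compose[OF F.L.Ob.module_axioms, of "Obj L'" F\<^sub>0 "Obj L''" G\<^sub>0]
        linear_map_compose[OF F.L.Ar.module_axioms, of "Arr L'" F\<^sub>1 "Arr L''" G\<^sub>1]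
      unfolding linear_functor_def by (auto simp: F.F1_cmp G.F1_cmp)
    have nat: "?F2 (tgt L f) (tgt L g) \<bullet>\<^bsub>L''\<^esub> [?F\<^sub>1 f, ?F\<^sub>1 g]\<^sub>1\<^bsub>L''\<^esub> = ?F\<^sub>1 [f, g]\<^sub>1\<^bsub>L\<^esub> \<bullet>\<^bsub>L''\<^esub> ?F2 (src L f) (src L g)"
      if fg: "f \<in> arrs L" "g \<in> arrs L" for f g
    proof -
      have "G.\<phi> (tgt L' (F\<^sub>1 f)) (tgt L' (F\<^sub>1 g)) \<ominus>\<^bsub>Arr L''\<^esub> G.\<phi> (src L' (F\<^sub>1 f)) (src L' (F\<^sub>1 g))
          \<oplus>\<^bsub>Arr L''\<^esub> G\<^sub>1 (F.\<phi> (tgt L f) (tgt L g) \<ominus>\<^bsub>Arr L'\<^esub> F.\<phi> (src L f) (src L g))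
        = (G\<^sub>1 (arr_part L' [F\<^sub>1 f, F\<^sub>1 g]\<^sub>1\<^bsub>L'\<^esub>) \<ominus>\<^bsub>Arr L''\<^esub> arr_part L'' [G\<^sub>1 (F\<^sub>1 f), G\<^sub>1 (F\<^sub>1 g)]\<^sub>1\<^bsub>L''\<^esub>)
          \<oplus>\<^bsub>Arr L''\<^esub> G\<^sub>1 (F\<^sub>1 (arr_part L [f, g]\<^sub>1\<^bsub>L\<^esub>) \<ominus>\<^bsub>Arr L'\<^esub> arr_part L' [F\<^sub>1 f, F\<^sub>1 g]\<^sub>1\<^bsub>L'\<^esub>)"
        unfolding F.\<phi>_natural[OF fg] G.\<phi>_natural[OF F.F1_simps(1)[OF fg(1)] F.F1_simps(1)[OF fg(2)]] ..
      from this fg have "arr_part L'' [?F\<^sub>1 f, ?F\<^sub>1 g]\<^sub>1\<^bsub>L''\<^esub> \<oplus>\<^bsub>Arr L''\<^esub> arr_part L'' (?F2 (tgt L f) (tgt L g))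
          = arr_part L'' (?F2 (src L f) (src L g)) \<oplus>\<^bsub>Arr L''\<^esub> arr_part L'' (?F\<^sub>1 [f, g]\<^sub>1\<^bsub>L\<^esub>)"
        apply (simp add: F2)
        by - (rule G.L'.Ar.lin_comb_transfer[where c = "1"], assumption,
          ((rule G.L'.Ar.lin_comb_intros)+, (simp; fail)?)+, (simp only: coeff_simps)?)
      then show ?thesis
        by (subst G.L'.square_commutes_iff) (use fg in \<open>simp_all add: restrict2_def\<close>)
    qed
    show "bilinear_nat_trans K L L'' (\<lambda>x y. [?F\<^sub>0 x, ?F\<^sub>0 y]\<^sub>0\<^bsub>L''\<^esub>) (\<lambda>f g. [?F\<^sub>1 f, ?F\<^sub>1 g]\<^sub>1\<^bsub>L''\<^esub>)
      (\<lambda>x y. ?F\<^sub>0 [x, y]\<^sub>0\<^bsub>L\<^esub>) (\<lambda>f g. ?F\<^sub>1 [f, g]\<^sub>1\<^bsub>L\<^esub>) ?F2"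
      unfolding bilinear_nat_trans_def using bilin nat by (simp add: restrict2_def)
  qed
  have \<phi>: "C.\<phi> x y = G.\<phi> (F\<^sub>0 x) (F\<^sub>0 y) \<oplus>\<^bsub>Arr L''\<^esub> G\<^sub>1 (F.\<phi> x y)"
    if "x \<in> objs L" "y \<in> objs L" for x y
    unfolding C.\<phi>_def using that by (simp add: restrict2_def)
  have alternator: "C.\<phi> x y \<oplus>\<^bsub>Arr L''\<^esub> C.\<phi> y x
      = G\<^sub>1 (F\<^sub>1 \<langle>x, y\<rangle>\<^bsub>L\<^esub>) \<ominus>\<^bsub>Arr L''\<^esub> \<langle>G\<^sub>0 (F\<^sub>0 x), G\<^sub>0 (F\<^sub>0 y)\<rangle>\<^bsub>L''\<^esub>"
    if "x \<in> objs L" "y \<in> objs L" for x y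
  proof -
    have "G.\<phi> (F\<^sub>0 x) (F\<^sub>0 y) \<oplus>\<^bsub>Arr L''\<^esub> G.\<phi> (F\<^sub>0 y) (F\<^sub>0 x) \<oplus>\<^bsub>Arr L''\<^esub> G\<^sub>1 (F.\<phi> x y \<oplus>\<^bsub>Arr L'\<^esub> F.\<phi> y x)
      = (G\<^sub>1 \<langle>F\<^sub>0 x, F\<^sub>0 y\<rangle>\<^bsub>L'\<^esub> \<ominus>\<^bsub>Arr L''\<^esub> \<langle>G\<^sub>0 (F\<^sub>0 x), G\<^sub>0 (F\<^sub>0 y)\<rangle>\<^bsub>L''\<^esub>)
        \<oplus>\<^bsub>Arr L''\<^esub> G\<^sub>1 (F\<^sub>1 \<langle>x, y\<rangle>\<^bsub>L\<^esub> \<ominus>\<^bsub>Arr L'\<^esub> \<langle>F\<^sub>0 x, F\<^sub>0 y\<rangle>\<^bsub>L'\<^esub>)"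
      using that by (simp only: G.\<phi>_alternator F.\<phi>_alternator F.F0_simps)
    from this that show ?thesis
      apply (simp add: \<phi>)
      by - (rule G.L'.Ar.lin_comb_transfer[where c = "1"], assumption,
        ((rule G.L'.Ar.lin_comb_intros)+, (simp; fail)?)+, (simp only: coeff_simps)?)
  qed
  \<comment> \<open>The condition for G at F x, F y, F z involves [F y, F z], the composite involves
    F [y, z]. Naturality of \<open>G2\<close> along \<open>F2 y z\<close> accounts for the
    difference, in either argument.\<close>
  have nat_left: "G.\<phi> (F\<^sub>0 x) (F\<^sub>0 [y, z]\<^sub>0\<^bsub>L\<^esub>) = G.\<phi> (F\<^sub>0 x) [F\<^sub>0 y, F\<^sub>0 z]\<^sub>0\<^bsub>L'\<^esub> \<oplus>\<^bsub>Arr L''\<^esub>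
      (G\<^sub>1 [\<iota>\<^bsub>L'\<^esub> (F\<^sub>0 x), F.\<phi> y z]\<^sub>1\<^bsub>L'\<^esub> \<ominus>\<^bsub>Arr L''\<^esub> [\<iota>\<^bsub>L''\<^esub> (G\<^sub>0 (F\<^sub>0 x)), G\<^sub>1 (F.\<phi> y z)]\<^sub>1\<^bsub>L''\<^esub>)"
    and nat_right: "G.\<phi> (F\<^sub>0 [y, z]\<^sub>0\<^bsub>L\<^esub>) (F\<^sub>0 x) = G.\<phi> [F\<^sub>0 y, F\<^sub>0 z]\<^sub>0\<^bsub>L'\<^esub> (F\<^sub>0 x) \<oplus>\<^bsub>Arr L''\<^esub>
      (G\<^sub>1 [F.\<phi> y z, \<iota>\<^bsub>L'\<^esub> (F\<^sub>0 x)]\<^sub>1\<^bsub>L'\<^esub> \<ominus>\<^bsub>Arr L''\<^esub> [G\<^sub>1 (F.\<phi> y z), \<iota>\<^bsub>L''\<^esub> (G\<^sub>0 (F\<^sub>0 x))]\<^sub>1\<^bsub>L''\<^esub>)"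
    if xyz: "x \<in> objs L" "y \<in> objs L" "z \<in> objs L" for x y z
  proof -
    have "G.\<phi> (F\<^sub>0 x) (F\<^sub>0 [y, z]\<^sub>0\<^bsub>L\<^esub>) \<ominus>\<^bsub>Arr L''\<^esub> G.\<phi> (F\<^sub>0 x) [F\<^sub>0 y, F\<^sub>0 z]\<^sub>0\<^bsub>L'\<^esub>
        = G\<^sub>1 [\<iota>\<^bsub>L'\<^esub> (F\<^sub>0 x), F.\<phi> y z]\<^sub>1\<^bsub>L'\<^esub> \<ominus>\<^bsub>Arr L''\<^esub> [\<iota>\<^bsub>L''\<^esub> (G\<^sub>0 (F\<^sub>0 x)), G\<^sub>1 (F.\<phi> y z)]\<^sub>1\<^bsub>L''\<^esub>"
      using xyz G.\<phi>_natural[of "\<iota>\<^bsub>L'\<^esub> (F\<^sub>0 x)" "F2 y z"] by simp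
    from this xyz show "G.\<phi> (F\<^sub>0 x) (F\<^sub>0 [y, z]\<^sub>0\<^bsub>L\<^esub>) = G.\<phi> (F\<^sub>0 x) [F\<^sub>0 y, F\<^sub>0 z]\<^sub>0\<^bsub>L'\<^esub> \<oplus>\<^bsub>Arr L''\<^esub>
      (G\<^sub>1 [\<iota>\<^bsub>L'\<^esub> (F\<^sub>0 x), F.\<phi> y z]\<^sub>1\<^bsub>L'\<^esub> \<ominus>\<^bsub>Arr L''\<^esub> [\<iota>\<^bsub>L''\<^esub> (G\<^sub>0 (F\<^sub>0 x)), G\<^sub>1 (F.\<phi> y z)]\<^sub>1\<^bsub>L''\<^esub>)"
      by - (rule G.L'.Ar.lin_comb_transfer[where c = "1"], assumption,
        ((rule G.L'.Ar.lin_comb_intros)+, (simp; fail)?)+, (simp only: coeff_simps)?)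
    have "G.\<phi> (F\<^sub>0 [y, z]\<^sub>0\<^bsub>L\<^esub>) (F\<^sub>0 x) \<ominus>\<^bsub>Arr L''\<^esub> G.\<phi> [F\<^sub>0 y, F\<^sub>0 z]\<^sub>0\<^bsub>L'\<^esub> (F\<^sub>0 x)
        = G\<^sub>1 [F.\<phi> y z, \<iota>\<^bsub>L'\<^esub> (F\<^sub>0 x)]\<^sub>1\<^bsub>L'\<^esub> \<ominus>\<^bsub>Arr L''\<^esub> [G\<^sub>1 (F.\<phi> y z), \<iota>\<^bsub>L''\<^esub> (G\<^sub>0 (F\<^sub>0 x))]\<^sub>1\<^bsub>L''\<^esub>"
      using xyz G.\<phi>_natural[of "F2 y z" "\<iota>\<^bsub>L'\<^esub> (F\<^sub>0 x)"] by simp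
    from this xyz show "G.\<phi> (F\<^sub>0 [y, z]\<^sub>0\<^bsub>L\<^esub>) (F\<^sub>0 x) = G.\<phi> [F\<^sub>0 y, F\<^sub>0 z]\<^sub>0\<^bsub>L'\<^esub> (F\<^sub>0 x) \<oplus>\<^bsub>Arr L''\<^esub>
      (G\<^sub>1 [F.\<phi> y z, \<iota>\<^bsub>L'\<^esub> (F\<^sub>0 x)]\<^sub>1\<^bsub>L'\<^esub> \<ominus>\<^bsub>Arr L''\<^esub> [G\<^sub>1 (F.\<phi> y z), \<iota>\<^bsub>L''\<^esub> (G\<^sub>0 (F\<^sub>0 x))]\<^sub>1\<^bsub>L''\<^esub>)"
      by - (rule G.L'.Ar.lin_comb_transfer[where c = "1"], assumption,
        ((rule G.L'.Ar.lin_comb_intros)+, (simp; fail)?)+, (simp only: coeff_simps)?)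
  qed
  \<comment> \<open>The right side is split by inserting G of the 3-bracket of F x, F y, F z; the
    correction terms of \<open>nat_left\<close> and \<open>nat_right\<close> then cancel against the
    brackets with G applied.\<close>
  have jacobiator: "C.\<phi> x [y, z]\<^sub>0\<^bsub>L\<^esub> \<oplus>\<^bsub>Arr L''\<^esub> [\<iota>\<^bsub>L''\<^esub> (G\<^sub>0 (F\<^sub>0 x)), C.\<phi> y z]\<^sub>1\<^bsub>L''\<^esub>
        \<ominus>\<^bsub>Arr L''\<^esub> C.\<phi> [x, y]\<^sub>0\<^bsub>L\<^esub> z \<ominus>\<^bsub>Arr L''\<^esub> C.\<phi> y [x, z]\<^sub>0\<^bsub>L\<^esub>
        \<ominus>\<^bsub>Arr L''\<^esub> [C.\<phi> x y, \<iota>\<^bsub>L''\<^esub> (G\<^sub>0 (F\<^sub>0 z))]\<^sub>1\<^bsub>L''\<^esub> \<ominus>\<^bsub>Arr L''\<^esub> [\<iota>\<^bsub>L''\<^esub> (G\<^sub>0 (F\<^sub>0 y)), C.\<phi> x z]\<^sub>1\<^bsub>L''\<^esub>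
      = G\<^sub>1 (F\<^sub>1 \<langle>x, y, z\<rangle>\<^bsub>L\<^esub>) \<ominus>\<^bsub>Arr L''\<^esub> \<langle>G\<^sub>0 (F\<^sub>0 x), G\<^sub>0 (F\<^sub>0 y), G\<^sub>0 (F\<^sub>0 z)\<rangle>\<^bsub>L''\<^esub>"
    if xyz: "x \<in> objs L" "y \<in> objs L" "z \<in> objs L" for x y z
  proof -
    have Fxyz: "F\<^sub>0 x \<in> objs L'" "F\<^sub>0 y \<in> objs L'" "F\<^sub>0 z \<in> objs L'"
      using xyz by simp_all
    have "G\<^sub>1 (F\<^sub>1 \<langle>x, y, z\<rangle>\<^bsub>L\<^esub>) \<ominus>\<^bsub>Arr L''\<^esub> \<langle>G\<^sub>0 (F\<^sub>0 x), G\<^sub>0 (F\<^sub>0 y), G\<^sub>0 (F\<^sub>0 z)\<rangle>\<^bsub>L''\<^esub>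
      = G\<^sub>1 (F\<^sub>1 \<langle>x, y, z\<rangle>\<^bsub>L\<^esub> \<ominus>\<^bsub>Arr L'\<^esub> \<langle>F\<^sub>0 x, F\<^sub>0 y, F\<^sub>0 z\<rangle>\<^bsub>L'\<^esub>)
        \<oplus>\<^bsub>Arr L''\<^esub> (G\<^sub>1 \<langle>F\<^sub>0 x, F\<^sub>0 y, F\<^sub>0 z\<rangle>\<^bsub>L'\<^esub> \<ominus>\<^bsub>Arr L''\<^esub> \<langle>G\<^sub>0 (F\<^sub>0 x), G\<^sub>0 (F\<^sub>0 y), G\<^sub>0 (F\<^sub>0 z)\<rangle>\<^bsub>L''\<^esub>)"
      using xyz by simp
        (rule G.L'.Ar.lin_comb_unique, ((rule G.L'.Ar.lin_comb_intros)+, (simp; fail)?)+,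
          (simp only: coeff_simps)?)
    also have "\<dots> = C.\<phi> x [y, z]\<^sub>0\<^bsub>L\<^esub> \<oplus>\<^bsub>Arr L''\<^esub> [\<iota>\<^bsub>L''\<^esub> (G\<^sub>0 (F\<^sub>0 x)), C.\<phi> y z]\<^sub>1\<^bsub>L''\<^esub>
        \<ominus>\<^bsub>Arr L''\<^esub> C.\<phi> [x, y]\<^sub>0\<^bsub>L\<^esub> z \<ominus>\<^bsub>Arr L''\<^esub> C.\<phi> y [x, z]\<^sub>0\<^bsub>L\<^esub>
        \<ominus>\<^bsub>Arr L''\<^esub> [C.\<phi> x y, \<iota>\<^bsub>L''\<^esub> (G\<^sub>0 (F\<^sub>0 z))]\<^sub>1\<^bsub>L''\<^esub> \<ominus>\<^bsub>Arr L''\<^esub> [\<iota>\<^bsub>L''\<^esub> (G\<^sub>0 (F\<^sub>0 y)), C.\<phi> x z]\<^sub>1\<^bsub>L''\<^esub>"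
      unfolding F.\<phi>_jacobiator[OF xyz, symmetric] G.\<phi>_jacobiator[OF Fxyz, symmetric]
      using xyz by (simp add: \<phi> nat_left nat_right)
        (rule G.L'.Ar.lin_comb_unique, ((rule G.L'.Ar.lin_comb_intros)+, (simp; fail)?)+,
          (simp only: coeff_simps)?)
    finally show ?thesis ..
  qed
  show ?thesis
  proof (intro lie_2_morphism.intro lie_2_morphism_axioms.intro)
  qed (fact F.L.lie_2_algebra_axioms G.L'.lie_2_algebra_axioms C.linear_functor C.nat_trans
    | rule C.preserves_alternator_iff[THEN iffD2] C.preserves_jacobiator_iff[THEN iffD2];
      simp add: alternator jacobiator)+
qed

section \<open>2-morphisms\<close>

locale lie_2_2morphism =
  F: lie_2_morphism K L L' F\<^sub>0 F\<^sub>1 F2 + G: lie_2_morphism K L L' G\<^sub>0 G\<^sub>1 G2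
  for K and L :: "('k, 'o, 'a) lie2" (structure) and L' :: "('k, 'o, 'a) lie2" (structure)
    and F\<^sub>0 F\<^sub>1 F2 G\<^sub>0 G\<^sub>1 G2 +
  fixes \<Theta> :: "'o \<Rightarrow> 'a"
  assumes natural: "linear_nat_trans K L L' F\<^sub>0 F\<^sub>1 G\<^sub>0 G\<^sub>1 \<Theta>"
    and compatible: "\<lbrakk>x \<in> objs L; y \<in> objs L\<rbrakk> \<Longrightarrow>
      \<Theta> [x, y]\<^sub>0 \<bullet>\<^bsub>L'\<^esub> F2 x y = G2 x y \<bullet>\<^bsub>L'\<^esub> [\<Theta> x, \<Theta> y]\<^sub>1\<^bsub>L'\<^esub>"
begin

lemma \<Theta>_linear_on: "linear_on K (Obj L) (Arr L') \<Theta>"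
  and \<Theta>_undefined: "x \<notin> objs L \<Longrightarrow> \<Theta> x = undefined"
  using natural by (auto simp: linear_nat_trans_def linear_map_iff extensional_def)

lemmas \<Theta>_simps [simp] = F.OA.linear_on_simps[OF \<Theta>_linear_on]

lemma src_\<Theta> [simp]: "x \<in> objs L \<Longrightarrow> src L' (\<Theta> x) = F\<^sub>0 x"
  and tgt_\<Theta> [simp]: "x \<in> objs L \<Longrightarrow> tgt L' (\<Theta> x) = G\<^sub>0 x"
  using natural by (auto simp: linear_nat_trans_def)

lemma arr_part_natural:
  assumes "f \<in> arrs L"
  shows "arr_part L' (\<Theta> (tgt L f)) \<ominus>\<^bsub>Arr L'\<^esub> arr_part L' (\<Theta> (src L f))
    = G\<^sub>1 (arr_part L f) \<ominus>\<^bsub>Arr L'\<^esub> F\<^sub>1 (arr_part L f)"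
proof -
  have "\<Theta> (tgt L f) \<bullet>\<^bsub>L'\<^esub> F\<^sub>1 f = G\<^sub>1 f \<bullet>\<^bsub>L'\<^esub> \<Theta> (src L f)"
    using natural assms by (auto simp: linear_nat_trans_def)
  then have "F\<^sub>1 (arr_part L f) \<oplus>\<^sub>1\<^bsub>L'\<^esub> arr_part L' (\<Theta> (tgt L f))
      = arr_part L' (\<Theta> (src L f)) \<oplus>\<^sub>1\<^bsub>L'\<^esub> G\<^sub>1 (arr_part L f)"
    by (subst (asm) F.L'.square_commutes_iff) (use assms in auto)
  from this assms show ?thesis
    by - (rule F.L'.Ar.lin_comb_transfer[where c = "1"], assumption,
      ((rule F.L'.Ar.lin_comb_intros)+, (simp; fail)?)+, (simp only: coeff_simps)?)
qed

lemma arr_part_compatible: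
  assumes "x \<in> objs L" "y \<in> objs L"
  shows "F.\<phi> x y \<oplus>\<^sub>1\<^bsub>L'\<^esub> arr_part L' (\<Theta> [x, y]\<^sub>0) = arr_part L' [\<Theta> x, \<Theta> y]\<^sub>1\<^bsub>L'\<^esub> \<oplus>\<^sub>1\<^bsub>L'\<^esub> G.\<phi> x y"
  using compatible[OF assms] assms by (subst (asm) F.L'.square_commutes_iff) auto

end

text \<open>Naturality and compatibility only need to be checked on arrow parts once sources and
  targets are known; the compositions of 2-morphisms are then sums.\<close>

lemma lie_2_2morphismI:
  fixes L L' :: "('k, 'o, 'a) lie2"
  assumes F: "lie_2_morphism K L L' F\<^sub>0 F\<^sub>1 F2" and G: "lie_2_morphism K L L' G\<^sub>0 G\<^sub>1 G2"
    and T: "linear_on K (Obj L) (Arr L') T" "T \<in> extensional (objs L)"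
    and src: "\<And>x. x \<in> objs L \<Longrightarrow> src L' (T x) = F\<^sub>0 x" and tgt: "\<And>x. x \<in> objs L \<Longrightarrow> tgt L' (T x) = G\<^sub>0 x"
    and nat: "\<And>f. f \<in> arrs L \<Longrightarrow>
      F\<^sub>1 (arr_part L f) \<oplus>\<^bsub>Arr L'\<^esub> arr_part L' (T (tgt L f)) = arr_part L' (T (src L f)) \<oplus>\<^bsub>Arr L'\<^esub> G\<^sub>1 (arr_part L f)"
    and compat: "\<And>x y. \<lbrakk>x \<in> objs L; y \<in> objs L\<rbrakk> \<Longrightarrow>
      arr_part L' (F2 x y) \<oplus>\<^bsub>Arr L'\<^esub> arr_part L' (T [x, y]\<^sub>0\<^bsub>L\<^esub>)
      = arr_part L' [T x, T y]\<^sub>1\<^bsub>L'\<^esub> \<oplus>\<^bsub>Arr L'\<^esub> arr_part L' (G2 x y)"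
  shows "lie_2_2morphism K L L' F\<^sub>0 F\<^sub>1 F2 G\<^sub>0 G\<^sub>1 G2 T"
proof -
  interpret F: lie_2_morphism K L L' F\<^sub>0 F\<^sub>1 F2 by fact
  interpret G: lie_2_morphism K L L' G\<^sub>0 G\<^sub>1 G2 by fact
  have closed [simp]: "T x \<in> arrs L'" if "x \<in> objs L" for x
    using linear_on_closed[OF T(1) that] .
  show ?thesis
  proof
    have "T (tgt L f) \<bullet>\<^bsub>L'\<^esub> F\<^sub>1 f = G\<^sub>1 f \<bullet>\<^bsub>L'\<^esub> T (src L f)" if "f \<in> arrs L" for f
      using nat[OF that] that by (subst F.L'.square_commutes_iff) (simp_all add: src tgt)
    then show "linear_nat_trans K L L' F\<^sub>0 F\<^sub>1 G\<^sub>0 G\<^sub>1 T"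
      using T src tgt by (simp add: linear_nat_trans_def linear_map_iff)
    show "T [x, y]\<^sub>0\<^bsub>L\<^esub> \<bullet>\<^bsub>L'\<^esub> F2 x y = G2 x y \<bullet>\<^bsub>L'\<^esub> [T x, T y]\<^sub>1\<^bsub>L'\<^esub>"
      if "x \<in> objs L" "y \<in> objs L" for x y
      using compat[OF that] that by (subst F.L'.square_commutes_iff) (simp_all add: src tgt)
  qed
qed

lemma lie_2_2morphism_id:
  fixes L L' :: "('k, 'o, 'a) lie2"
  assumes F: "lie_2_morphism K L L' F\<^sub>0 F\<^sub>1 F2"
  shows "lie_2_2morphism K L L' F\<^sub>0 F\<^sub>1 F2 F\<^sub>0 F\<^sub>1 F2 (\<lambda>x\<in>objs L. \<iota>\<^bsub>L'\<^esub> (F\<^sub>0 x))"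
proof -
  interpret F: lie_2_morphism K L L' F\<^sub>0 F\<^sub>1 F2 by fact
  have "linear_on K (Obj L) (Arr L') (\<lambda>x\<in>objs L. \<iota>\<^bsub>L'\<^esub> (F\<^sub>0 x))"
    by (rule linear_on_cong[OF F.L.Ob.module_axioms linear_on_compose[OF F.F0_linear_on F.L'.ident_linear_on]]) simp
  then show ?thesis
    by (intro lie_2_2morphismI[OF F F]) simp_all
qed

lemma lie_2_2morphism_vcomp:
  fixes L L' :: "('k, 'o, 'a) lie2"
  assumes S: "lie_2_2morphism K L L' F\<^sub>0 F\<^sub>1 F2 G\<^sub>0 G\<^sub>1 G2 S" and T: "lie_2_2morphism K L L' G\<^sub>0 G\<^sub>1 G2 H\<^sub>0 H\<^sub>1 H2 T"
  shows "lie_2_2morphism K L L' F\<^sub>0 F\<^sub>1 F2 H\<^sub>0 H\<^sub>1 H2 (\<lambda>x\<in>objs L. T x \<bullet>\<^bsub>L'\<^esub> S x)"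
    (is "lie_2_2morphism K L L' _ _ _ _ _ _ ?T")
proof -
  interpret S: lie_2_2morphism K L L' F\<^sub>0 F\<^sub>1 F2 G\<^sub>0 G\<^sub>1 G2 S by fact
  interpret T: lie_2_2morphism K L L' G\<^sub>0 G\<^sub>1 G2 H\<^sub>0 H\<^sub>1 H2 T by fact
  have "linear_on K (Obj L) (Arr L') ?T"
    by (rule linear_on_cong[OF S.F.L.Ob.module_axioms
      S.F.OA.linear_on_sum[OF S.\<Theta>_linear_on linear_on_compose[OF T.\<Theta>_linear_on S.F.L'.arr_part_linear_on]]])
      (simp add: S.F.L'.cmp_eq)
  then show ?thesis
  proof (intro lie_2_2morphismI[OF S.F.lie_2_morphism_axioms T.G.lie_2_morphism_axioms])
    fix f assume f: "f \<in> arrs L"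
    have "(arr_part L' (S (tgt L f)) \<ominus>\<^bsub>Arr L'\<^esub> arr_part L' (S (src L f)))
        \<oplus>\<^bsub>Arr L'\<^esub> (arr_part L' (T (tgt L f)) \<ominus>\<^bsub>Arr L'\<^esub> arr_part L' (T (src L f)))
      = (G\<^sub>1 (arr_part L f) \<ominus>\<^bsub>Arr L'\<^esub> F\<^sub>1 (arr_part L f)) \<oplus>\<^bsub>Arr L'\<^esub> (H\<^sub>1 (arr_part L f) \<ominus>\<^bsub>Arr L'\<^esub> G\<^sub>1 (arr_part L f))"
      unfolding S.arr_part_natural[OF f] T.arr_part_natural[OF f] ..
    from this f show "F\<^sub>1 (arr_part L f) \<oplus>\<^bsub>Arr L'\<^esub> arr_part L' (?T (tgt L f))
        = arr_part L' (?T (src L f)) \<oplus>\<^bsub>Arr L'\<^esub> H\<^sub>1 (arr_part L f)"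
      apply simp
      by - (rule S.F.L'.Ar.lin_comb_transfer[where c = "1"], assumption,
        ((rule S.F.L'.Ar.lin_comb_intros)+, (simp; fail)?)+, (simp only: coeff_simps)?)
  next
    fix x y assume xy: "x \<in> objs L" "y \<in> objs L"
    have "(S.F.\<phi> x y \<oplus>\<^bsub>Arr L'\<^esub> arr_part L' (S [x, y]\<^sub>0\<^bsub>L\<^esub>)) \<oplus>\<^bsub>Arr L'\<^esub> (S.G.\<phi> x y \<oplus>\<^bsub>Arr L'\<^esub> arr_part L' (T [x, y]\<^sub>0\<^bsub>L\<^esub>))
      = (arr_part L' [S x, S y]\<^sub>1\<^bsub>L'\<^esub> \<oplus>\<^bsub>Arr L'\<^esub> S.G.\<phi> x y) \<oplus>\<^bsub>Arr L'\<^esub> (arr_part L' [T x, T y]\<^sub>1\<^bsub>L'\<^esub> \<oplus>\<^bsub>Arr L'\<^esub> T.G.\<phi> x y)"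
      unfolding S.arr_part_compatible[OF xy] T.arr_part_compatible[OF xy] ..
    from this xy show "arr_part L' (F2 x y) \<oplus>\<^bsub>Arr L'\<^esub> arr_part L' (?T [x, y]\<^sub>0\<^bsub>L\<^esub>)
      = arr_part L' [?T x, ?T y]\<^sub>1\<^bsub>L'\<^esub> \<oplus>\<^bsub>Arr L'\<^esub> arr_part L' (H2 x y)"
      \<comment> \<open>Functoriality splits the bracket of the composites T x after S x and T y
        after S y into the bracket of the T after that of the S, so the two compatibility equations
        simply add up.\<close>
      apply (simp add: S.F.L'.br1_cmp)
      by - (rule S.F.L'.Ar.lin_comb_transfer[where c = "1"], assumption,
        ((rule S.F.L'.Ar.lin_comb_intros)+, (simp; fail)?)+, (simp only: coeff_simps)?)
  qed simp_all
qed

text \<open>Compatibility combines four relations: compatibility of S under the functor F',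
  naturality of \<open>F2'\<close> along S x and S y with a minus sign, naturality of T along
  \<open>G2 x y\<close>, and compatibility of T at G x and G y. All intermediate terms
  cancel.\<close>

lemma lie_2_2morphism_hcomp:
  fixes L L' L'' :: "('k, 'o, 'a) lie2"
  assumes S: "lie_2_2morphism K L L' F\<^sub>0 F\<^sub>1 F2 G\<^sub>0 G\<^sub>1 G2 S"
    and T: "lie_2_2morphism K L' L'' F\<^sub>0' F\<^sub>1' F2' G\<^sub>0' G\<^sub>1' G2' T"
  shows "lie_2_2morphism K L L''
    (compose (objs L) F\<^sub>0' F\<^sub>0) (compose (arrs L) F\<^sub>1' F\<^sub>1)
    (restrict2 (\<lambda>x y. F\<^sub>1' (F2 x y) \<bullet>\<^bsub>L''\<^esub> F2' (F\<^sub>0 x) (F\<^sub>0 y)) (objs L) (objs L))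
    (compose (objs L) G\<^sub>0' G\<^sub>0) (compose (arrs L) G\<^sub>1' G\<^sub>1)
    (restrict2 (\<lambda>x y. G\<^sub>1' (G2 x y) \<bullet>\<^bsub>L''\<^esub> G2' (G\<^sub>0 x) (G\<^sub>0 y)) (objs L) (objs L))
    (\<lambda>x\<in>objs L. T (G\<^sub>0 x) \<bullet>\<^bsub>L''\<^esub> F\<^sub>1' (S x))"
    (is "lie_2_2morphism K L L'' ?F\<^sub>0 ?F\<^sub>1 ?F2 ?G\<^sub>0 ?G\<^sub>1 ?G2 ?T")
proof -
  interpret S: lie_2_2morphism K L L' F\<^sub>0 F\<^sub>1 F2 G\<^sub>0 G\<^sub>1 G2 S by fact
  interpret T: lie_2_2morphism K L' L'' F\<^sub>0' F\<^sub>1' F2' G\<^sub>0' G\<^sub>1' G2' T by fact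
  interpret LL'': module_pair K "Obj L" "Arr L''" ..
  note [simp] = compose_eq
  have "linear_on K (Obj L) (Arr L'') ?T"
    by (rule linear_on_cong[OF S.F.L.Ob.module_axioms
      LL''.linear_on_sum[OF linear_on_compose[OF S.\<Theta>_linear_on T.F.F1_linear_on]
        linear_on_compose[OF S.G.F0_linear_on linear_on_compose[OF T.\<Theta>_linear_on T.F.L'.arr_part_linear_on]]]])
      (simp add: T.F.L'.cmp_eq)
  then show ?thesis
  proof (intro lie_2_2morphismI)
    show "lie_2_morphism K L L'' ?F\<^sub>0 ?F\<^sub>1 ?F2"
      by (rule lie_2_morphism_compose[OF S.F.lie_2_morphism_axioms T.F.lie_2_morphism_axioms])
    show "lie_2_morphism K L L'' ?G\<^sub>0 ?G\<^sub>1 ?G2"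
      by (rule lie_2_morphism_compose[OF S.G.lie_2_morphism_axioms T.G.lie_2_morphism_axioms])
  next
    fix f assume f: "f \<in> arrs L"
    have "F\<^sub>1' (arr_part L' (S (tgt L f)) \<ominus>\<^bsub>Arr L'\<^esub> arr_part L' (S (src L f)))
        \<oplus>\<^bsub>Arr L''\<^esub> (arr_part L'' (T (tgt L' (G\<^sub>1 f))) \<ominus>\<^bsub>Arr L''\<^esub> arr_part L'' (T (src L' (G\<^sub>1 f))))
      = F\<^sub>1' (G\<^sub>1 (arr_part L f) \<ominus>\<^bsub>Arr L'\<^esub> F\<^sub>1 (arr_part L f))
        \<oplus>\<^bsub>Arr L''\<^esub> (G\<^sub>1' (arr_part L' (G\<^sub>1 f)) \<ominus>\<^bsub>Arr L''\<^esub> F\<^sub>1' (arr_part L' (G\<^sub>1 f)))"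
      unfolding S.arr_part_natural[OF f] T.arr_part_natural[OF S.G.F1_simps(1)[OF f]] ..
    from this f show "?F\<^sub>1 (arr_part L f) \<oplus>\<^bsub>Arr L''\<^esub> arr_part L'' (?T (tgt L f))
        = arr_part L'' (?T (src L f)) \<oplus>\<^bsub>Arr L''\<^esub> ?G\<^sub>1 (arr_part L f)"
      apply simp
      by - (rule T.F.L'.Ar.lin_comb_transfer[where c = "1"], assumption,
        ((rule T.F.L'.Ar.lin_comb_intros)+, (simp; fail)?)+, (simp only: coeff_simps)?)
  next
    fix x y assume xy: "x \<in> objs L" "y \<in> objs L"
    then have Gxy: "G\<^sub>0 x \<in> objs L'" "G\<^sub>0 y \<in> objs L'" and Sxy: "S x \<in> arrs L'" "S y \<in> arrs L'"
      and G2xy: "G2 x y \<in> arrs L'"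
      by simp_all
    have "F\<^sub>1' (S.F.\<phi> x y \<oplus>\<^bsub>Arr L'\<^esub> arr_part L' (S [x, y]\<^sub>0\<^bsub>L\<^esub>))
        \<ominus>\<^bsub>Arr L''\<^esub> (T.F.\<phi> (tgt L' (S x)) (tgt L' (S y)) \<ominus>\<^bsub>Arr L''\<^esub> T.F.\<phi> (src L' (S x)) (src L' (S y)))
        \<oplus>\<^bsub>Arr L''\<^esub> (arr_part L'' (T (tgt L' (G2 x y))) \<ominus>\<^bsub>Arr L''\<^esub> arr_part L'' (T (src L' (G2 x y))))
        \<oplus>\<^bsub>Arr L''\<^esub> (T.F.\<phi> (G\<^sub>0 x) (G\<^sub>0 y) \<oplus>\<^bsub>Arr L''\<^esub> arr_part L'' (T [G\<^sub>0 x, G\<^sub>0 y]\<^sub>0\<^bsub>L'\<^esub>))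
      = F\<^sub>1' (arr_part L' [S x, S y]\<^sub>1\<^bsub>L'\<^esub> \<oplus>\<^bsub>Arr L'\<^esub> S.G.\<phi> x y)
        \<ominus>\<^bsub>Arr L''\<^esub> (F\<^sub>1' (arr_part L' [S x, S y]\<^sub>1\<^bsub>L'\<^esub>) \<ominus>\<^bsub>Arr L''\<^esub> arr_part L'' [F\<^sub>1' (S x), F\<^sub>1' (S y)]\<^sub>1\<^bsub>L''\<^esub>)
        \<oplus>\<^bsub>Arr L''\<^esub> (G\<^sub>1' (arr_part L' (G2 x y)) \<ominus>\<^bsub>Arr L''\<^esub> F\<^sub>1' (arr_part L' (G2 x y)))
        \<oplus>\<^bsub>Arr L''\<^esub> (arr_part L'' [T (G\<^sub>0 x), T (G\<^sub>0 y)]\<^sub>1\<^bsub>L''\<^esub> \<oplus>\<^bsub>Arr L''\<^esub> T.G.\<phi> (G\<^sub>0 x) (G\<^sub>0 y))"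
      unfolding S.arr_part_compatible[OF xy] T.F.\<phi>_natural[OF Sxy] T.arr_part_natural[OF G2xy]
        T.arr_part_compatible[OF Gxy] ..
    from this xy show "arr_part L'' (?F2 x y) \<oplus>\<^bsub>Arr L''\<^esub> arr_part L'' (?T [x, y]\<^sub>0\<^bsub>L\<^esub>)
      = arr_part L'' [?T x, ?T y]\<^sub>1\<^bsub>L''\<^esub> \<oplus>\<^bsub>Arr L''\<^esub> arr_part L'' (?G2 x y)"
      apply (simp add: T.F.L'.br1_cmp restrict2_def)
      by - (rule T.F.L'.Ar.lin_comb_transfer[where c = "1"], assumption,
        ((rule T.F.L'.Ar.lin_comb_intros)+, (simp; fail)?)+, (simp only: coeff_simps)?)
  qed simp_all
qed

section \<open>The 2-category of Lie 2-algebras\<close>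

lemma is_lie2_2mor_iff:
  "is_lie2_2mor K T \<longleftrightarrow>
    mdom (tcod T) = mdom (tdom T) \<and> mcod (tcod T) = mcod (tdom T) \<and>
    lie_2_2morphism K (mdom (tdom T)) (mcod (tdom T)) (mor0 (tdom T)) (mor1 (tdom T)) (mor2 (tdom T))
      (mor0 (tcod T)) (mor1 (tcod T)) (mor2 (tcod T)) (trafo T)"
  by (auto simp: is_lie2_2mor_def is_lie2_mor_def Let_def lie_2_2morphism_def lie_2_2morphism_axioms_def)

lemma lie2_mor_selectors [simp]:
  "mdom (lie2_id_mor L) = L" "mcod (lie2_id_mor L) = L"
  "mor0 (lie2_id_mor L) = (\<lambda>x\<in>objs L. x)" "mor1 (lie2_id_mor L) = (\<lambda>f\<in>arrs L. f)"
  "mor2 (lie2_id_mor L) = restrict2 (\<lambda>x y. \<iota>\<^bsub>L\<^esub> [x, y]\<^sub>0\<^bsub>L\<^esub>) (objs L) (objs L)"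
  "mdom (lie2_comp_mor G F) = mdom F" "mcod (lie2_comp_mor G F) = mcod G"
  "mor0 (lie2_comp_mor G F) = compose (objs (mdom F)) (mor0 G) (mor0 F)"
  "mor1 (lie2_comp_mor G F) = compose (arrs (mdom F)) (mor1 G) (mor1 F)"
  "mor2 (lie2_comp_mor G F) = restrict2
     (\<lambda>x y. mor1 G (mor2 F x y) \<bullet>\<^bsub>mcod G\<^esub> mor2 G (mor0 F x) (mor0 F y)) (objs (mdom F)) (objs (mdom F))"
  by (simp_all add: lie2_id_mor_def lie2_comp_mor_def)

lemma lie2_2mor_selectors [simp]:
  "tdom (lie2_id_2mor F) = F" "tcod (lie2_id_2mor F) = F"
  "trafo (lie2_id_2mor F) = (\<lambda>x\<in>objs (mdom F). \<iota>\<^bsub>mcod F\<^esub> (mor0 F x))"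
  "tdom (lie2_vcomp T S) = tdom S" "tcod (lie2_vcomp T S) = tcod T"
  "trafo (lie2_vcomp T S) = (\<lambda>x\<in>objs (mdom (tdom S)). trafo T x \<bullet>\<^bsub>mcod (tdom S)\<^esub> trafo S x)"
  "tdom (lie2_hcomp T S) = lie2_comp_mor (tdom T) (tdom S)"
  "tcod (lie2_hcomp T S) = lie2_comp_mor (tcod T) (tcod S)"
  "trafo (lie2_hcomp T S) = (\<lambda>x\<in>objs (mdom (tdom S)).
     trafo T (mor0 (tcod S) x) \<bullet>\<^bsub>mcod (tdom T)\<^esub> mor1 (tdom T) (trafo S x))"
  by (simp_all add: lie2_id_2mor_def lie2_vcomp_def lie2_hcomp_def)

lemma is_lie2_mor_id: "lie_2_algebra K L \<Longrightarrow> is_lie2_mor K (lie2_id_mor L)"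
  by (simp add: is_lie2_mor_def lie_2_algebra.lie_2_morphism_id)

lemma is_lie2_mor_comp:
  "\<lbrakk>is_lie2_mor K G; is_lie2_mor K F; mdom G = mcod F\<rbrakk> \<Longrightarrow> is_lie2_mor K (lie2_comp_mor G F)"
  by (simp add: is_lie2_mor_def lie_2_morphism_compose)

lemma is_lie2_mor_algebras:
  assumes "is_lie2_mor K F"
  shows "lie_2_algebra K (mdom F)" "lie_2_algebra K (mcod F)"
  using assms by (auto simp: is_lie2_mor_def lie_2_morphism_def)

lemma is_lie2_2mor_mors:
  assumes "is_lie2_2mor K T"
  shows "is_lie2_mor K (tdom T)" "is_lie2_mor K (tcod T)"
    "mdom (tcod T) = mdom (tdom T)" "mcod (tcod T) = mcod (tdom T)"
  using assms by (auto simp: is_lie2_2mor_def Let_def)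

section \<open>Unit and associativity laws of morphisms\<close>

lemma lie2_comp_mor_id_right:
  assumes "is_lie2_mor K F"
  shows "lie2_comp_mor F (lie2_id_mor (mdom F)) = F"
proof -
  interpret F: lie_2_morphism K "mdom F" "mcod F" "mor0 F" "mor1 F" "mor2 F"
    using assms by (simp add: is_lie2_mor_def)
  have "mor2 (lie2_comp_mor F (lie2_id_mor (mdom F))) = mor2 F"
    by (rule F.F2_eqI) (auto simp: restrict2_def F.L'.cmp_eq simp flip: F.tgt_F2)
  moreover have "mor0 (lie2_comp_mor F (lie2_id_mor (mdom F))) = mor0 F"
    "mor1 (lie2_comp_mor F (lie2_id_mor (mdom F))) = mor1 F"
    using F.linear_functor by (auto simp: linear_functor_def linear_map_iff linear_on_def intro!: compose_Id)
  ultimately show ?thesis by simp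
qed

lemma lie2_comp_mor_id_left:
  assumes "is_lie2_mor K F"
  shows "lie2_comp_mor (lie2_id_mor (mcod F)) F = F"
proof -
  interpret F: lie_2_morphism K "mdom F" "mcod F" "mor0 F" "mor1 F" "mor2 F"
    using assms by (simp add: is_lie2_mor_def)
  have "mor2 (lie2_comp_mor (lie2_id_mor (mcod F)) F) = mor2 F"
  proof (rule F.F2_eqI)
    fix x y assume "x \<in> objs (mdom F)" "y \<in> objs (mdom F)"
    then show "mor2 (lie2_comp_mor (lie2_id_mor (mcod F)) F) x y = mor2 F x y"
      using F.L'.cmp_ident_right[of "mor2 F x y"] by (simp add: restrict2_def)
  qed (auto simp: restrict2_def)
  moreover have "mor0 (lie2_comp_mor (lie2_id_mor (mcod F)) F) = mor0 F"
    "mor1 (lie2_comp_mor (lie2_id_mor (mcod F)) F) = mor1 F"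
    using F.linear_functor by (auto simp: linear_functor_def linear_map_iff linear_on_def intro!: Id_compose)
  ultimately show ?thesis by simp
qed

text \<open>On the structure arrows both sides are composites of the same three arrows, once
  functoriality of H has been used to apply it to each factor.\<close>

lemma lie2_comp_mor_assoc:
  assumes F: "is_lie2_mor K F" and G: "is_lie2_mor K G" and H: "is_lie2_mor K H"
    and GF: "mdom G = mcod F" and HG: "mdom H = mcod G"
  shows "lie2_comp_mor (lie2_comp_mor H G) F = lie2_comp_mor H (lie2_comp_mor G F)"
proof -
  interpret F: lie_2_morphism K "mdom F" "mcod F" "mor0 F" "mor1 F" "mor2 F"
    using F by (simp add: is_lie2_mor_def)
  interpret G: lie_2_morphism K "mcod F" "mcod G" "mor0 G" "mor1 G" "mor2 G"
    using G GF by (simp add: is_lie2_mor_def)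
  interpret H: lie_2_morphism K "mcod G" "mcod H" "mor0 H" "mor1 H" "mor2 H"
    using H HG by (simp add: is_lie2_mor_def)
  have "mor2 (lie2_comp_mor (lie2_comp_mor H G) F) = mor2 (lie2_comp_mor H (lie2_comp_mor G F))"
    using GF HG
    by (auto simp: fun_eq_iff restrict2_def compose_eq G.F1_cmp H.F1_cmp H.L'.cmp_assoc)
  then show ?thesis
    using GF HG by (auto simp: lie2_mor.equality compose_def fun_eq_iff)
qed

lemma is_lie2_2mor_id: "is_lie2_mor K F \<Longrightarrow> is_lie2_2mor K (lie2_id_2mor F)"
  by (simp add: is_lie2_2mor_iff is_lie2_mor_def lie_2_2morphism_id)

lemma is_lie2_2mor_vcomp:
  assumes "is_lie2_2mor K T" "is_lie2_2mor K S" "tdom T = tcod S"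
  shows "is_lie2_2mor K (lie2_vcomp T S)"
proof -
  have S: "lie_2_2morphism K (mdom (tdom S)) (mcod (tdom S)) (mor0 (tdom S)) (mor1 (tdom S)) (mor2 (tdom S))
      (mor0 (tcod S)) (mor1 (tcod S)) (mor2 (tcod S)) (trafo S)"
    using assms(2) by (simp add: is_lie2_2mor_iff)
  have T: "lie_2_2morphism K (mdom (tdom S)) (mcod (tdom S)) (mor0 (tcod S)) (mor1 (tcod S)) (mor2 (tcod S))
      (mor0 (tcod T)) (mor1 (tcod T)) (mor2 (tcod T)) (trafo T)"
    using assms by (simp add: is_lie2_2mor_iff)
  show ?thesis
    using lie_2_2morphism_vcomp[OF S T] assms by (simp add: is_lie2_2mor_iff)
qed

lemma is_lie2_2mor_hcomp:
  assumes "is_lie2_2mor K T" "is_lie2_2mor K S" "mdom (tdom T) = mcod (tdom S)"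
  shows "is_lie2_2mor K (lie2_hcomp T S)"
proof -
  have S: "lie_2_2morphism K (mdom (tdom S)) (mcod (tdom S)) (mor0 (tdom S)) (mor1 (tdom S)) (mor2 (tdom S))
      (mor0 (tcod S)) (mor1 (tcod S)) (mor2 (tcod S)) (trafo S)"
    using assms(2) by (simp add: is_lie2_2mor_iff)
  have T: "lie_2_2morphism K (mcod (tdom S)) (mcod (tdom T)) (mor0 (tdom T)) (mor1 (tdom T)) (mor2 (tdom T))
      (mor0 (tcod T)) (mor1 (tcod T)) (mor2 (tcod T)) (trafo T)"
    using assms by (simp add: is_lie2_2mor_iff)
  show ?thesis
    unfolding is_lie2_2mor_iff lie2_2mor_selectors lie2_mor_selectors
      is_lie2_2mor_mors(3,4)[OF assms(1)] is_lie2_2mor_mors(3,4)[OF assms(2)]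
    by (intro conjI refl lie_2_2morphism_hcomp[OF S T])
qed

lemma trafo_eqI:
  assumes "is_lie2_2mor K T" "\<And>x. x \<in> objs (mdom (tdom T)) \<Longrightarrow> t x = trafo T x"
    "t \<in> extensional (objs (mdom (tdom T)))"
  shows "t = trafo T"
proof -
  have T: "lie_2_2morphism K (mdom (tdom T)) (mcod (tdom T)) (mor0 (tdom T)) (mor1 (tdom T)) (mor2 (tdom T))
      (mor0 (tcod T)) (mor1 (tcod T)) (mor2 (tcod T)) (trafo T)"
    using assms(1) by (simp add: is_lie2_2mor_iff)
  have "trafo T \<in> extensional (objs (mdom (tdom T)))"
    using lie_2_2morphism.\<Theta>_undefined[OF T] by (simp add: extensional_def)
  then show ?thesis using assms(2,3) by (intro extensionalityI) auto
qed

section \<open>Unit, associativity and interchange laws of 2-morphisms\<close>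

lemma lie2_vcomp_id_right:
  assumes "is_lie2_2mor K T"
  shows "lie2_vcomp T (lie2_id_2mor (tdom T)) = T"
proof -
  interpret T: lie_2_2morphism K "mdom (tdom T)" "mcod (tdom T)" "mor0 (tdom T)" "mor1 (tdom T)" "mor2 (tdom T)"
    "mor0 (tcod T)" "mor1 (tcod T)" "mor2 (tcod T)" "trafo T"
    using assms by (simp add: is_lie2_2mor_iff)
  have "trafo T x \<bullet>\<^bsub>mcod (tdom T)\<^esub> \<iota>\<^bsub>mcod (tdom T)\<^esub> (mor0 (tdom T) x) = trafo T x"
    if "x \<in> objs (mdom (tdom T))" for x
    using T.F.L'.cmp_ident_right[of "trafo T x"] that by simp
  then have "trafo (lie2_vcomp T (lie2_id_2mor (tdom T))) = trafo T"
    by (intro trafo_eqI[OF assms]) auto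
  then show ?thesis by simp
qed

lemma lie2_vcomp_id_left:
  assumes "is_lie2_2mor K T"
  shows "lie2_vcomp (lie2_id_2mor (tcod T)) T = T"
proof -
  interpret T: lie_2_2morphism K "mdom (tdom T)" "mcod (tdom T)" "mor0 (tdom T)" "mor1 (tdom T)" "mor2 (tdom T)"
    "mor0 (tcod T)" "mor1 (tcod T)" "mor2 (tcod T)" "trafo T"
    using assms by (simp add: is_lie2_2mor_iff)
  have "\<iota>\<^bsub>mcod (tdom T)\<^esub> (mor0 (tcod T) x) \<bullet>\<^bsub>mcod (tdom T)\<^esub> trafo T x = trafo T x"
    if "x \<in> objs (mdom (tdom T))" for x
    using T.F.L'.cmp_ident_left[of "trafo T x"] that by simp
  then have "trafo (lie2_vcomp (lie2_id_2mor (tcod T)) T) = trafo T"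
    using is_lie2_2mor_mors[OF assms] by (intro trafo_eqI[OF assms]) auto
  then show ?thesis by simp
qed

lemma lie2_vcomp_assoc:
  assumes R: "is_lie2_2mor K R" and S: "is_lie2_2mor K S" and T: "is_lie2_2mor K T"
    and RS: "tdom S = tcod R" and ST: "tdom T = tcod S"
  shows "lie2_vcomp (lie2_vcomp T S) R = lie2_vcomp T (lie2_vcomp S R)"
proof -
  interpret R: lie_2_2morphism K "mdom (tdom R)" "mcod (tdom R)" "mor0 (tdom R)" "mor1 (tdom R)" "mor2 (tdom R)"
    "mor0 (tcod R)" "mor1 (tcod R)" "mor2 (tcod R)" "trafo R"
    using R by (simp add: is_lie2_2mor_iff)
  interpret S: lie_2_2morphism K "mdom (tdom R)" "mcod (tdom R)" "mor0 (tcod R)" "mor1 (tcod R)" "mor2 (tcod R)"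
    "mor0 (tcod S)" "mor1 (tcod S)" "mor2 (tcod S)" "trafo S"
    using R S RS by (simp add: is_lie2_2mor_iff)
  interpret T: lie_2_2morphism K "mdom (tdom R)" "mcod (tdom R)" "mor0 (tcod S)" "mor1 (tcod S)" "mor2 (tcod S)"
    "mor0 (tcod T)" "mor1 (tcod T)" "mor2 (tcod T)" "trafo T"
    using R S T RS ST by (simp add: is_lie2_2mor_iff)
  show ?thesis
    using is_lie2_2mor_mors[OF R] is_lie2_2mor_mors[OF S] RS ST
    by (intro lie2_2mor.equality) (auto simp: fun_eq_iff restrict_def R.F.L'.cmp_assoc)
qed

lemma lie2_hcomp_id_right:
  assumes "is_lie2_2mor K T"
  shows "lie2_hcomp T (lie2_id_2mor (lie2_id_mor (mdom (tdom T)))) = T"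
proof -
  interpret T: lie_2_2morphism K "mdom (tdom T)" "mcod (tdom T)" "mor0 (tdom T)" "mor1 (tdom T)" "mor2 (tdom T)"
    "mor0 (tcod T)" "mor1 (tcod T)" "mor2 (tcod T)" "trafo T"
    using assms by (simp add: is_lie2_2mor_iff)
  note mors = is_lie2_2mor_mors[OF assms]
  have "trafo T x \<bullet>\<^bsub>mcod (tdom T)\<^esub> \<iota>\<^bsub>mcod (tdom T)\<^esub> (mor0 (tdom T) x) = trafo T x"
    if "x \<in> objs (mdom (tdom T))" for x
    using T.F.L'.cmp_ident_right[of "trafo T x"] that by simp
  then have "trafo (lie2_hcomp T (lie2_id_2mor (lie2_id_mor (mdom (tdom T))))) = trafo T"
    by (intro trafo_eqI[OF assms]) auto
  then show ?thesis
    using lie2_comp_mor_id_right[OF mors(1)] lie2_comp_mor_id_right[OF mors(2)] mors(3)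
    by (intro lie2_2mor.equality) auto
qed

lemma lie2_hcomp_id_left:
  assumes "is_lie2_2mor K T"
  shows "lie2_hcomp (lie2_id_2mor (lie2_id_mor (mcod (tdom T)))) T = T"
proof -
  interpret T: lie_2_2morphism K "mdom (tdom T)" "mcod (tdom T)" "mor0 (tdom T)" "mor1 (tdom T)" "mor2 (tdom T)"
    "mor0 (tcod T)" "mor1 (tcod T)" "mor2 (tcod T)" "trafo T"
    using assms by (simp add: is_lie2_2mor_iff)
  note mors = is_lie2_2mor_mors[OF assms]
  have "\<iota>\<^bsub>mcod (tdom T)\<^esub> (mor0 (tcod T) x) \<bullet>\<^bsub>mcod (tdom T)\<^esub> trafo T x = trafo T x"
    if "x \<in> objs (mdom (tdom T))" for x
    using T.F.L'.cmp_ident_left[of "trafo T x"] that by simp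
  then have "trafo (lie2_hcomp (lie2_id_2mor (lie2_id_mor (mcod (tdom T)))) T) = trafo T"
    by (intro trafo_eqI[OF assms]) auto
  then show ?thesis
    using lie2_comp_mor_id_left[OF mors(1)] lie2_comp_mor_id_left[OF mors(2)] mors(4)
    by (intro lie2_2mor.equality) auto
qed

lemma lie2_hcomp_assoc:
  assumes R: "is_lie2_2mor K R" and S: "is_lie2_2mor K S" and T: "is_lie2_2mor K T"
    and RS: "mdom (tdom S) = mcod (tdom R)" and ST: "mdom (tdom T) = mcod (tdom S)"
  shows "lie2_hcomp (lie2_hcomp T S) R = lie2_hcomp T (lie2_hcomp S R)"
proof -
  interpret R: lie_2_2morphism K "mdom (tdom R)" "mcod (tdom R)" "mor0 (tdom R)" "mor1 (tdom R)" "mor2 (tdom R)"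
    "mor0 (tcod R)" "mor1 (tcod R)" "mor2 (tcod R)" "trafo R"
    using R by (simp add: is_lie2_2mor_iff)
  interpret S: lie_2_2morphism K "mcod (tdom R)" "mcod (tdom S)" "mor0 (tdom S)" "mor1 (tdom S)" "mor2 (tdom S)"
    "mor0 (tcod S)" "mor1 (tcod S)" "mor2 (tcod S)" "trafo S"
    using S RS by (simp add: is_lie2_2mor_iff)
  interpret T: lie_2_2morphism K "mcod (tdom S)" "mcod (tdom T)" "mor0 (tdom T)" "mor1 (tdom T)" "mor2 (tdom T)"
    "mor0 (tcod T)" "mor1 (tcod T)" "mor2 (tcod T)" "trafo T"
    using T ST by (simp add: is_lie2_2mor_iff)
  note mors = is_lie2_2mor_mors[OF R] is_lie2_2mor_mors[OF S] is_lie2_2mor_mors[OF T]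
  have "trafo (lie2_hcomp (lie2_hcomp T S) R) = trafo (lie2_hcomp T (lie2_hcomp S R))"
    using RS ST mors by (auto simp: fun_eq_iff restrict_def compose_def T.F.F1_cmp T.F.L'.cmp_assoc)
  then show ?thesis
    using RS ST mors by (intro lie2_2mor.equality) (simp_all add: lie2_comp_mor_assoc)
qed

lemma lie2_hcomp_id_2mor:
  assumes F: "is_lie2_mor K F" and G: "is_lie2_mor K G" and GF: "mdom G = mcod F"
  shows "lie2_hcomp (lie2_id_2mor G) (lie2_id_2mor F) = lie2_id_2mor (lie2_comp_mor G F)"
proof -
  interpret F: lie_2_morphism K "mdom F" "mcod F" "mor0 F" "mor1 F" "mor2 F"
    using F by (simp add: is_lie2_mor_def)
  interpret G: lie_2_morphism K "mcod F" "mcod G" "mor0 G" "mor1 G" "mor2 G"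
    using G GF by (simp add: is_lie2_mor_def)
  have "\<iota>\<^bsub>mcod G\<^esub> y \<bullet>\<^bsub>mcod G\<^esub> \<iota>\<^bsub>mcod G\<^esub> y = \<iota>\<^bsub>mcod G\<^esub> y" if "y \<in> objs (mcod G)" for y
    using G.L'.cmp_ident_left[of "\<iota>\<^bsub>mcod G\<^esub> y"] that by simp
  then show ?thesis
    using GF by (intro lie2_2mor.equality) (auto simp: fun_eq_iff restrict_def compose_def)
qed

lemma lie2_interchange:
  assumes S: "is_lie2_2mor K S" and S': "is_lie2_2mor K S'" and T: "is_lie2_2mor K T" and T': "is_lie2_2mor K T'"
    and S'S: "tdom S' = tcod S" and T'T: "tdom T' = tcod T" and TS: "mdom (tdom T) = mcod (tdom S)"
  shows "lie2_hcomp (lie2_vcomp T' T) (lie2_vcomp S' S) = lie2_vcomp (lie2_hcomp T' S') (lie2_hcomp T S)"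
proof -
  note mors = is_lie2_2mor_mors[OF S] is_lie2_2mor_mors[OF S'] is_lie2_2mor_mors[OF T] is_lie2_2mor_mors[OF T']
  let ?L = "mdom (tdom S)" and ?L' = "mcod (tdom S)" and ?L'' = "mcod (tdom T)"
  interpret S: lie_2_2morphism K ?L ?L' "mor0 (tdom S)" "mor1 (tdom S)" "mor2 (tdom S)"
    "mor0 (tcod S)" "mor1 (tcod S)" "mor2 (tcod S)" "trafo S"
    using S by (simp add: is_lie2_2mor_iff)
  interpret S': lie_2_2morphism K ?L ?L' "mor0 (tcod S)" "mor1 (tcod S)" "mor2 (tcod S)"
    "mor0 (tcod S')" "mor1 (tcod S')" "mor2 (tcod S')" "trafo S'"
    using S S' S'S by (simp add: is_lie2_2mor_iff)
  interpret T: lie_2_2morphism K ?L' ?L'' "mor0 (tdom T)" "mor1 (tdom T)" "mor2 (tdom T)"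
    "mor0 (tcod T)" "mor1 (tcod T)" "mor2 (tcod T)" "trafo T"
    using T TS by (simp add: is_lie2_2mor_iff)
  interpret T': lie_2_2morphism K ?L' ?L'' "mor0 (tcod T)" "mor1 (tcod T)" "mor2 (tcod T)"
    "mor0 (tcod T')" "mor1 (tcod T')" "mor2 (tcod T')" "trafo T'"
    using T T' T'T TS by (simp add: is_lie2_2mor_iff)
  have "(trafo T' (mor0 (tcod S') x) \<bullet>\<^bsub>?L''\<^esub> trafo T (mor0 (tcod S') x)) \<bullet>\<^bsub>?L''\<^esub>
        mor1 (tdom T) (trafo S' x \<bullet>\<^bsub>?L'\<^esub> trafo S x)
      = (trafo T' (mor0 (tcod S') x) \<bullet>\<^bsub>?L''\<^esub> mor1 (tcod T) (trafo S' x)) \<bullet>\<^bsub>?L''\<^esub>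
        (trafo T (mor0 (tcod S) x) \<bullet>\<^bsub>?L''\<^esub> mor1 (tdom T) (trafo S x))"
    if x: "x \<in> objs ?L" for x
  proof -
    \<comment> \<open>Interchange comes down to exchanging the two middle factors, which is
      naturality of T along the arrow S' x.\<close>
    have nat: "trafo T (mor0 (tcod S') x) \<bullet>\<^bsub>?L''\<^esub> mor1 (tdom T) (trafo S' x)
        = mor1 (tcod T) (trafo S' x) \<bullet>\<^bsub>?L''\<^esub> trafo T (mor0 (tcod S) x)"
      using T.natural S'.\<Theta>_simps(1)[OF x] S'.src_\<Theta>[OF x] S'.tgt_\<Theta>[OF x]
      unfolding linear_nat_trans_def by metis
    have "(trafo T' (mor0 (tcod S') x) \<bullet>\<^bsub>?L''\<^esub> trafo T (mor0 (tcod S') x)) \<bullet>\<^bsub>?L''\<^esub>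
        mor1 (tdom T) (trafo S' x \<bullet>\<^bsub>?L'\<^esub> trafo S x)
      = trafo T' (mor0 (tcod S') x) \<bullet>\<^bsub>?L''\<^esub> (trafo T (mor0 (tcod S') x) \<bullet>\<^bsub>?L''\<^esub>
        mor1 (tdom T) (trafo S' x)) \<bullet>\<^bsub>?L''\<^esub> mor1 (tdom T) (trafo S x)"
      using x by (simp add: T.F.F1_cmp T.F.L'.cmp_assoc)
    also have "\<dots> = (trafo T' (mor0 (tcod S') x) \<bullet>\<^bsub>?L''\<^esub> mor1 (tcod T) (trafo S' x)) \<bullet>\<^bsub>?L''\<^esub>
        (trafo T (mor0 (tcod S) x) \<bullet>\<^bsub>?L''\<^esub> mor1 (tdom T) (trafo S x))"
      unfolding nat using x by (simp add: T.F.L'.cmp_assoc)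
    finally show ?thesis .
  qed
  then show ?thesis
    using mors S'S T'T TS by (intro lie2_2mor.equality) (auto simp: fun_eq_iff restrict_def)
qed

theorem strict_2_category_Lie2:
  "strict_2_category (Lie2 K :: (('k, 'o, 'a) lie2, ('k, 'o, 'a) lie2_mor, ('k, 'o, 'a) lie2_2mor) two_cat)"
  by unfold_locales (auto simp: Lie2_def comp1_able_def vcomp_able_def hcomp_able_def is_lie2_mor_id is_lie2_mor_comp
    is_lie2_mor_algebras is_lie2_2mor_mors lie2_comp_mor_id_right lie2_comp_mor_id_left
    is_lie2_2mor_id is_lie2_2mor_vcomp is_lie2_2mor_hcomp lie2_vcomp_id_right lie2_vcomp_id_left
    lie2_hcomp_id_right lie2_hcomp_id_left lie2_hcomp_id_2mor
    intro: lie2_comp_mor_assoc lie2_vcomp_assoc lie2_hcomp_assoc lie2_interchange)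

lemma (in strict_2_category) strict_2_category_full_sub:
  "strict_2_category (full_sub_2_category C Q)"
proof -
  note able = comp1_able_def vcomp_able_def hcomp_able_def
  note axioms = src1_closed tgt1_closed src2_closed tgt2_closed id1_cell
    comp1_cell comp1_id_right comp1_id_left comp1_assoc id2_cell vcomp_cell vcomp_id_right vcomp_id_left
    vcomp_assoc hcomp_cell hcomp_id_right hcomp_id_left hcomp_assoc hcomp_id2 interchange
    \<comment> \<open>Reversed, so that the endpoints of a target 1-cell are rewritten to those of
      the source 1-cell, by which the 2-cells of the full sub-2-category are selected.\<close>
    globular_src[symmetric] globular_tgt[symmetric]
  show ?thesis
    by unfold_locales (simp_all add: full_sub_2_category_def able axioms[unfolded able, simplified])
qed

section \<open>The projection\<close>

lemma skew_mor_selectors [simp]: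
  "mdom (skew_mor K F) = skew_lie2 K (mdom F)" "mcod (skew_mor K F) = skew_lie2 K (mcod F)"
  "mor0 (skew_mor K F) = mor0 F" "mor1 (skew_mor K F) = mor1 F"
  "mor2 (skew_mor K F) = restrict2
     (\<lambda>x y. recip K 2 \<odot>\<^bsub>Arr (mcod F)\<^esub> (mor2 F x y \<ominus>\<^bsub>Arr (mcod F)\<^esub> mor2 F y x))
     (objs (mdom F)) (objs (mdom F))"
  by (simp_all add: skew_mor_def)

lemma skew_2mor_selectors [simp]:
  "tdom (skew_2mor K T) = skew_mor K (tdom T)" "tcod (skew_2mor K T) = skew_mor K (tcod T)"
  "trafo (skew_2mor K T) = trafo T"
  by (simp_all add: skew_2mor_def)

section \<open>Skew-symmetrization on 1-cells and 2-cells\<close>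

locale invertible_2_3 =
  fixes K :: "('k, 'm) ring_scheme"
  assumes invertible_2: "invertible_nat K 2" and invertible_3: "invertible_nat K 3"
begin

lemma skewable_algebra: "lie_2_algebra K L \<Longrightarrow> skewable_lie_2_algebra K L"
  by (intro skewable_lie_2_algebra.intro skewable_lie_2_algebra_axioms.intro invertible_2 invertible_3)

lemma skewable_morphism:
  assumes "is_lie2_mor K F"
  shows "skewable_lie_2_morphism K (mdom F) (mcod F) (mor0 F) (mor1 F) (mor2 F)"
  using assms invertible_2 invertible_3
  by (simp add: skewable_lie_2_morphism_def skewable_lie_2_morphism_axioms_def is_lie2_mor_def)

lemma is_lie2_mor_skew: "is_lie2_mor K F \<Longrightarrow> is_lie2_mor K (skew_mor K F)"
  using skewable_lie_2_morphism.lie_2_morphism_skew[OF skewable_morphism] by (simp add: is_lie2_mor_def)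

text \<open>The compatibility equation in arrow parts is bilinear in x and y, and half its
  difference under exchanging x and y is the equation for the skew parts. The transformation itself
  need not change.\<close>

lemma is_lie2_2mor_skew:
  assumes "is_lie2_2mor K T"
  shows "is_lie2_2mor K (skew_2mor K T)"
proof -
  note mors = is_lie2_2mor_mors[OF assms]
  interpret T: lie_2_2morphism K "mdom (tdom T)" "mcod (tdom T)" "mor0 (tdom T)" "mor1 (tdom T)" "mor2 (tdom T)"
    "mor0 (tcod T)" "mor1 (tcod T)" "mor2 (tcod T)" "trafo T"
    using assms by (simp add: is_lie2_2mor_iff)
  interpret F: skewable_lie_2_morphism K "mdom (tdom T)" "mcod (tdom T)" "mor0 (tdom T)" "mor1 (tdom T)" "mor2 (tdom T)"
    using skewable_morphism[OF mors(1)] .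
  let ?L' = "mcod (tdom T)"
  let ?skew = "\<lambda>f x y. recip K 2 \<odot>\<^bsub>Arr ?L'\<^esub> (f x y \<ominus>\<^bsub>Arr ?L'\<^esub> f y x)"
  have "trafo T (F.L.O.skew_br x y) \<bullet>\<^bsub>?L'\<^esub> ?skew (mor2 (tdom T)) x y
      = ?skew (mor2 (tcod T)) x y \<bullet>\<^bsub>?L'\<^esub> F.L'.A.skew_br (trafo T x) (trafo T y)"
    if xy: "x \<in> objs (mdom (tdom T))" "y \<in> objs (mdom (tdom T))" for x y
  proof -
    have "recip K 2 \<odot>\<^bsub>Arr ?L'\<^esub> (T.F.\<phi> x y \<oplus>\<^bsub>Arr ?L'\<^esub> arr_part ?L' (trafo T [x, y]\<^sub>0\<^bsub>mdom (tdom T)\<^esub>))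
        \<ominus>\<^bsub>Arr ?L'\<^esub> recip K 2 \<odot>\<^bsub>Arr ?L'\<^esub> (T.F.\<phi> y x \<oplus>\<^bsub>Arr ?L'\<^esub> arr_part ?L' (trafo T [y, x]\<^sub>0\<^bsub>mdom (tdom T)\<^esub>))
      = recip K 2 \<odot>\<^bsub>Arr ?L'\<^esub> (arr_part ?L' [trafo T x, trafo T y]\<^sub>1\<^bsub>?L'\<^esub> \<oplus>\<^bsub>Arr ?L'\<^esub> T.G.\<phi> x y)
        \<ominus>\<^bsub>Arr ?L'\<^esub> recip K 2 \<odot>\<^bsub>Arr ?L'\<^esub> (arr_part ?L' [trafo T y, trafo T x]\<^sub>1\<^bsub>?L'\<^esub> \<oplus>\<^bsub>Arr ?L'\<^esub> T.G.\<phi> y x)"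
      unfolding T.arr_part_compatible[OF xy] T.arr_part_compatible[OF xy(2,1)] ..
    from this xy have "arr_part ?L' (?skew (mor2 (tdom T)) x y) \<oplus>\<^bsub>Arr ?L'\<^esub> arr_part ?L' (trafo T (F.L.O.skew_br x y))
      = arr_part ?L' (F.L'.A.skew_br (trafo T x) (trafo T y)) \<oplus>\<^bsub>Arr ?L'\<^esub> arr_part ?L' (?skew (mor2 (tcod T)) x y)"
      apply (simp add: F.L.O.skew_br_def F.L'.A.skew_br_def)
      by - (rule T.F.L'.Ar.lin_comb_transfer[where c = "1"], assumption,
        ((rule T.F.L'.Ar.lin_comb_intros)+, (simp; fail)?)+, (simp only: coeff_simps)?)
    then show ?thesis
      using xy by (subst T.F.L'.square_commutes_iff) (simp_all add: F.L.O.skew_br_def F.L'.O.skew_br_def)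
  qed
  then show ?thesis
    using mors is_lie2_mor_skew[OF mors(1)] is_lie2_mor_skew[OF mors(2)] T.natural
    unfolding is_lie2_2mor_def Let_def
    by (simp add: restrict2_def F.L.br0_skew F.L'.br1_skew linear_nat_trans_def)
qed

lemma skew_mor_id:
  assumes "lie_2_algebra K L"
  shows "skew_mor K (lie2_id_mor L) = lie2_id_mor (skew_lie2 K L)"
proof -
  interpret skewable_lie_2_algebra K L using skewable_algebra[OF assms] .
  show ?thesis
    by (intro lie2_mor.equality) (auto simp: fun_eq_iff restrict2_def br0_skew O.skew_br_def)
qed

text \<open>The structure arrow of a composite is the sum of that of G and the image under G of the
  arrow part of that of F. Both summands are linear in the structure arrows, so the skew part can be
  taken separately in each.\<close>

lemma skew_mor_comp:
  assumes F: "is_lie2_mor K F" and G: "is_lie2_mor K G" and GF: "mdom G = mcod F"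
  shows "skew_mor K (lie2_comp_mor G F) = lie2_comp_mor (skew_mor K G) (skew_mor K F)"
proof -
  interpret F: skewable_lie_2_morphism K "mdom F" "mcod F" "mor0 F" "mor1 F" "mor2 F"
    using skewable_morphism[OF F] .
  interpret G: skewable_lie_2_morphism K "mcod F" "mcod G" "mor0 G" "mor1 G" "mor2 G"
    using skewable_morphism[OF G] GF by simp
  let ?L'' = "mcod G" and ?c = "\<lambda>x y. mor1 G (mor2 F x y) \<bullet>\<^bsub>mcod G\<^esub> mor2 G (mor0 F x) (mor0 F y)"
  have "recip K 2 \<odot>\<^bsub>Arr ?L''\<^esub> (?c x y \<ominus>\<^bsub>Arr ?L''\<^esub> ?c y x)
      = mor1 G (recip K 2 \<odot>\<^bsub>Arr (mcod F)\<^esub> (mor2 F x y \<ominus>\<^bsub>Arr (mcod F)\<^esub> mor2 F y x))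
        \<bullet>\<^bsub>?L''\<^esub> recip K 2 \<odot>\<^bsub>Arr ?L''\<^esub>
          (mor2 G (mor0 F x) (mor0 F y) \<ominus>\<^bsub>Arr ?L''\<^esub> mor2 G (mor0 F y) (mor0 F x))"
    if "x \<in> objs (mdom F)" "y \<in> objs (mdom F)" for x y
    using that by (simp add: G.L'.cmp_eq)
      (rule G.L'.Ar.lin_comb_unique, ((rule G.L'.Ar.lin_comb_intros)+, (simp; fail)?)+,
        (simp only: coeff_simps)?)
  then show ?thesis
    using GF by (intro lie2_mor.equality) (simp_all add: fun_eq_iff restrict2_def)
qed

text \<open>Between semistrict algebras the alternator condition makes \<phi> skew, and the bracket
  of the codomain is skew too. Hence \<open>mor2 F\<close> is skew as an arrow, source included, and
  is its own skew part.\<close>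

lemma skew_mor_semistrict:
  fixes F :: "('k, 'o, 'a) lie2_mor"
  assumes F: "is_lie2_mor K F" and "semistrict (mdom F)" "semistrict (mcod F)"
  shows "skew_mor K F = F"
proof -
  interpret F: skewable_lie_2_morphism K "mdom F" "mcod F" "mor0 F" "mor1 F" "mor2 F"
    using skewable_morphism[OF F] .
  let ?L = "mdom F" and ?L' = "mcod F"
  \<comment> \<open>A semistrict algebra is equal to its skew-symmetrization, and there \<langle>x,
    y\<rangle> is known to be zero.\<close>
  have S: "\<langle>x, y\<rangle>\<^bsub>L\<^esub> = \<zero>\<^bsub>Arr L\<^esub>" if "skewable_lie_2_algebra K L" "semistrict L" "x \<in> objs L" "y \<in> objs L"
    for x y and L :: "('k, 'o, 'a) lie2"
    using skewable_lie_2_algebra.angle2_skew[OF that(1,3,4)]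
      skewable_lie_2_algebra.skew_semistrict[OF that(1,2)] by simp
  have neg: "mor2 F y x = \<ominus>\<^bsub>Arr ?L'\<^esub> mor2 F x y" if xy: "x \<in> objs ?L" "y \<in> objs ?L" for x y
  proof -
    have Fxy: "mor0 F x \<in> objs ?L'" "mor0 F y \<in> objs ?L'" using xy by simp_all
    note S0 = S[OF F.L.skewable_lie_2_algebra_axioms assms(2) xy]
      S[OF F.L'.skewable_lie_2_algebra_axioms assms(3) Fxy]
    have "[mor0 F x, mor0 F y]\<^sub>0\<^bsub>?L'\<^esub> \<oplus>\<^bsub>Obj ?L'\<^esub> [mor0 F y, mor0 F x]\<^sub>0\<^bsub>?L'\<^esub> = \<zero>\<^bsub>Obj ?L'\<^esub>"
      using F.L'.tgt_angle2[OF Fxy] by (simp add: S0)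
    moreover have "F.\<phi> x y \<oplus>\<^bsub>Arr ?L'\<^esub> F.\<phi> y x = \<zero>\<^bsub>Arr ?L'\<^esub>"
      using F.\<phi>_alternator[OF xy] by (simp add: S0 a_minus_def F.L'.Ar.M.r_neg)
    ultimately have "mor2 F x y \<oplus>\<^bsub>Arr ?L'\<^esub> mor2 F y x = \<zero>\<^bsub>Arr ?L'\<^esub>"
      using xy F.L'.arr_eq_iff[of "mor2 F x y \<oplus>\<^bsub>Arr ?L'\<^esub> mor2 F y x" "\<zero>\<^bsub>Arr ?L'\<^esub>"] by simp
    from this xy show ?thesis
      by - (rule F.L'.Ar.lin_comb_transfer[where c = "1"], assumption,
        ((rule F.L'.Ar.lin_comb_intros)+, (simp; fail)?)+, (simp only: coeff_simps)?)
  qed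
  have "recip K 2 \<odot>\<^bsub>Arr ?L'\<^esub> (mor2 F x y \<ominus>\<^bsub>Arr ?L'\<^esub> mor2 F y x) = mor2 F x y"
    if "x \<in> objs ?L" "y \<in> objs ?L" for x y
    unfolding neg[OF that] using that by -
      (rule F.L'.Ar.lin_comb_unique, ((rule F.L'.Ar.lin_comb_intros)+, (simp; fail)?)+,
        (simp only: coeff_simps)?)
  then have "mor2 (skew_mor K F) = mor2 F"
    by (intro F.F2_eqI) (auto simp: restrict2_def)
  then show ?thesis
    using assms F.L.skew_semistrict F.L'.skew_semistrict by (intro lie2_mor.equality) simp_all
qed

lemma strict_2_functor_SS:
  "strict_2_functor (Lie2 K :: (('k, 'o, 'a) lie2, ('k, 'o, 'a) lie2_mor, ('k, 'o, 'a) lie2_2mor) two_cat)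
    (SSLie2 K) (SS K)"
proof -
  interpret C: strict_2_category "Lie2 K :: (('k, 'o, 'a) lie2, ('k, 'o, 'a) lie2_mor, ('k, 'o, 'a) lie2_2mor) two_cat"
    by (rule strict_2_category_Lie2)
  interpret D: strict_2_category "SSLie2 K :: (('k, 'o, 'a) lie2, ('k, 'o, 'a) lie2_mor, ('k, 'o, 'a) lie2_2mor) two_cat"
    unfolding SSLie2_def by (rule C.strict_2_category_full_sub)
  note skew = skewable_lie_2_algebra.lie_2_algebra_skew[OF skewable_algebra]
    skewable_lie_2_algebra.semistrict_skew[OF skewable_algebra]
  show ?thesis
    by unfold_locales (auto simp: SS_def Lie2_def SSLie2_def full_sub_2_category_def comp1_able_def vcomp_able_def
      hcomp_able_def skew is_lie2_mor_skew is_lie2_2mor_skew is_lie2_mor_algebras is_lie2_2mor_mors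
      skew_mor_id skew_mor_comp intro!: lie2_2mor.equality)
qed

end

theorem theorem3p2:
  fixes K :: "('k, 'm) ring_scheme"
  assumes "field K" and "ring_char K \<noteq> 2" and "ring_char K \<noteq> 3"
  shows "projection_2_functor
    (Lie2 K :: (('k, 'o, 'a) lie2, ('k, 'o, 'a) lie2_mor, ('k, 'o, 'a) lie2_2mor) two_cat)
    (SSLie2 K) (SS K)"
proof -
  interpret invertible_2_3 K
    using field.invertible_nat_2_3[OF assms] by unfold_locales
  show ?thesis
    unfolding projection_2_functor_def
    using strict_2_functor_SS
    \<comment> \<open>A 2-cell between semistrict algebras keeps its transformation, and its two
      morphisms are fixed by \<open>skew_mor_semistrict\<close>; so the whole record is
      fixed.\<close>
    by (auto simp: SS_def Lie2_def SSLie2_def full_sub_2_category_def skew_mor_semistrict is_lie2_2mor_mors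
      skewable_lie_2_algebra.skew_semistrict[OF skewable_algebra] intro!: lie2_2mor.equality)
qed

end
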